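(* Let $\pi=F_m$ be a free group of rank $m\geq 4$, and let $\rho:\pi\to\mathrm{SL}_2(\mathbb{C})$ be a semisimple representation. Then $\rho$ has finite $\mathrm{Out}(\pi)$-orbit in $X(\pi,\mathrm{SL}_2)$ if and only if $\rho$ has finite image. Likewise, $\rho$ has bounded $\mathrm{Out}(\pi)$-orbit in $X(\pi,\mathrm{SL}_2)$ if and only if $\rho$ has bounded image in $\mathrm{SL}_2(\mathbb{C})$.
   Context: For a finitely generated group $\pi$, $X(\pi,\mathrm{SL}_2)=\mathrm{Hom}(\pi,\mathrm{SL}_2(\mathbb{C}))/\!/\mathrm{SL}_2(\mathbb{C})$ is the $\mathrm{SL}_2$-character variety (affine GIT quotient by conjugation); its complex points parametrize conjugacy classes of semisimple representations $\pi\to\mathrm{SL}_2(\mathbb{C})$. A representation is semisimple if it is irreducible or conjugate to a diagonal representation. The automorphism group $\mathrm{Aut}(\pi)$ acts on $X(\pi,\mathrm{SL}_2)$ by precomposition, and the action factors through $\mathrm{Out}(\pi)$. The orbit of $\rho$ means the orbit of its class in $X(\pi,\mathrm{SL}_2)(\mathbb{C})$. For a complex algebraic variety $V$, a subset of $V(\mathbb{C})$ is bounded if it has compact closure in $V(\mathbb{C})$ with respect to the Euclidean topology. *)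

theory Defs
  imports "HOL-Analysis.Analysis" "HOL-Algebra.Bij" "HOL-Algebra.Generated_Groups"
begin

section \<open>Free groups of finite rank\<close>

text \<open>The letter \<open>(b, True)\<close> stands for \<open>b\<close>, and \<open>(b, False)\<close> for its inverse.\<close>

definition letter_val :: "('g, 'b) monoid_scheme \<Rightarrow> 'g \<times> bool \<Rightarrow> 'g" where
  "letter_val G l = (if snd l then fst l else inv\<^bsub>G\<^esub> (fst l))"

definition word_val :: "('g, 'b) monoid_scheme \<Rightarrow> ('g \<times> bool) list \<Rightarrow> 'g" where
  "word_val G w = foldr (\<lambda>l x. letter_val G l \<otimes>\<^bsub>G\<^esub> x) w \<one>\<^bsub>G\<^esub>"

definition reduced_word :: "('g \<times> bool) list \<Rightarrow> bool" where
  "reduced_word w \<longleftrightarrow> successively (\<lambda>l l'. \<not> (fst l = fst l' \<and> snd l \<noteq> snd l')) w"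

definition free_basis :: "('g, 'b) monoid_scheme \<Rightarrow> 'g set \<Rightarrow> bool" where
  "free_basis G B \<longleftrightarrow> B \<subseteq> carrier G \<and> generate G B = carrier G \<and>
     (\<forall>w. set w \<subseteq> B \<times> UNIV \<and> reduced_word w \<and> w \<noteq> [] \<longrightarrow> word_val G w \<noteq> \<one>\<^bsub>G\<^esub>)"

definition free_group_of_rank :: "('g, 'b) monoid_scheme \<Rightarrow> nat \<Rightarrow> bool" where
  "free_group_of_rank G m \<longleftrightarrow> group G \<and> (\<exists>B. finite B \<and> card B = m \<and> free_basis G B)"


section \<open>Outer automorphisms\<close>

definition Inn :: "('g, 'b) monoid_scheme \<Rightarrow> ('g \<Rightarrow> 'g) set" where
  "Inn G = (\<lambda>g. \<lambda>x\<in>carrier G. g \<otimes>\<^bsub>G\<^esub> x \<otimes>\<^bsub>G\<^esub> inv\<^bsub>G\<^esub> g) ` carrier G"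

definition Out :: "('g, 'b) monoid_scheme \<Rightarrow> ('g \<Rightarrow> 'g) set monoid" where
  "Out G = AutoGroup G Mod Inn G"


section \<open>Representations into \<open>SL\<^sub>2\<close> over the complex numbers\<close>

type_synonym mat2 = "complex^2^2"

definition SL2 :: "mat2 monoid" where
  "SL2 = \<lparr>carrier = {A. det A = 1}, mult = (**), one = mat 1\<rparr>"

text \<open>Homomorphisms are taken extensional, so that two of them are equal
  as soon as they agree on the carrier.\<close>

definition Reps :: "('g, 'b) monoid_scheme \<Rightarrow> ('g \<Rightarrow> mat2) set" where
  "Reps G = hom G SL2 \<inter> extensional (carrier G)"

definition conj_rep :: "('g, 'b) monoid_scheme \<Rightarrow> mat2 \<Rightarrow> ('g \<Rightarrow> mat2) \<Rightarrow> ('g \<Rightarrow> mat2)" where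
  "conj_rep G A \<rho> = (\<lambda>g\<in>carrier G. A \<otimes>\<^bsub>SL2\<^esub> \<rho> g \<otimes>\<^bsub>SL2\<^esub> inv\<^bsub>SL2\<^esub> A)"

text \<open>Here \<open>vec.subspace\<close> is the notion of a complex (not just real) linear subspace.\<close>

definition irreducible_rep :: "('g, 'b) monoid_scheme \<Rightarrow> ('g \<Rightarrow> mat2) \<Rightarrow> bool" where
  "irreducible_rep G \<rho> \<longleftrightarrow>
     (\<forall>W :: (complex^2) set.
        vec.subspace W \<and> (\<forall>g\<in>carrier G. \<forall>v\<in>W. \<rho> g *v v \<in> W) \<longrightarrow> W = {0} \<or> W = UNIV)"

definition diagonal_rep :: "('g, 'b) monoid_scheme \<Rightarrow> ('g \<Rightarrow> mat2) \<Rightarrow> bool" where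
  "diagonal_rep G \<rho> \<longleftrightarrow> (\<forall>g\<in>carrier G. \<forall>i j. i \<noteq> j \<longrightarrow> \<rho> g $ i $ j = 0)"

definition semisimple_rep :: "('g, 'b) monoid_scheme \<Rightarrow> ('g \<Rightarrow> mat2) \<Rightarrow> bool" where
  "semisimple_rep G \<rho> \<longleftrightarrow>
     irreducible_rep G \<rho> \<or> (\<exists>A\<in>carrier SL2. diagonal_rep G (conj_rep G A \<rho>))"


section \<open>The \<open>SL\<^sub>2\<close>-character variety\<close>

text \<open>The coordinate ring of the affine variety \<open>Reps G\<close>: the complex algebra of functions on it
  generated by the matrix entries of the \<open>\<rho> g\<close>.  Functions on \<open>Reps G\<close> are extensional.\<close>

inductive_set regular_funs :: "('g, 'b) monoid_scheme \<Rightarrow> (('g \<Rightarrow> mat2) \<Rightarrow> complex) set"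
  for G where
  const: "(\<lambda>\<rho>\<in>Reps G. c) \<in> regular_funs G"
| entry: "g \<in> carrier G \<Longrightarrow> (\<lambda>\<rho>\<in>Reps G. \<rho> g $ i $ j) \<in> regular_funs G"
| add: "f \<in> regular_funs G \<Longrightarrow> h \<in> regular_funs G \<Longrightarrow> (\<lambda>\<rho>\<in>Reps G. f \<rho> + h \<rho>) \<in> regular_funs G"
| mult: "f \<in> regular_funs G \<Longrightarrow> h \<in> regular_funs G \<Longrightarrow> (\<lambda>\<rho>\<in>Reps G. f \<rho> * h \<rho>) \<in> regular_funs G"

definition invariant_funs :: "('g, 'b) monoid_scheme \<Rightarrow> (('g \<Rightarrow> mat2) \<Rightarrow> complex) set" where
  "invariant_funs G =
     {f \<in> regular_funs G. \<forall>A\<in>carrier SL2. \<forall>\<rho>\<in>Reps G. f (conj_rep G A \<rho>) = f \<rho>}"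

text \<open>The GIT quotient is the spectrum of the ring of invariants, so its complex points are the
  complex algebra homomorphisms from that ring to the complex numbers.  Passing to the reduced
  ring of functions on \<open>Reps G\<close> does not affect complex points (and for a free group the
  representation scheme, a power of \<open>SL\<^sub>2\<close>, is reduced anyway).\<close>

type_synonym 'g char_point = "(('g \<Rightarrow> mat2) \<Rightarrow> complex) \<Rightarrow> complex"

definition char_variety :: "('g, 'b) monoid_scheme \<Rightarrow> 'g char_point set" where
  "char_variety G = {\<phi> \<in> extensional (invariant_funs G).
     (\<forall>c. \<phi> (\<lambda>\<rho>\<in>Reps G. c) = c) \<and>
     (\<forall>f\<in>invariant_funs G. \<forall>h\<in>invariant_funs G.
        \<phi> (\<lambda>\<rho>\<in>Reps G. f \<rho> + h \<rho>) = \<phi> f + \<phi> h \<and>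
        \<phi> (\<lambda>\<rho>\<in>Reps G. f \<rho> * h \<rho>) = \<phi> f * \<phi> h)}"

text \<open>The Euclidean topology on the complex points of an affine variety is the coarsest one making
  all regular functions continuous, i.e. the topology of pointwise convergence on the coordinate
  ring; any finite set of ring generators induces the same topology.\<close>

definition char_topology :: "('g, 'b) monoid_scheme \<Rightarrow> 'g char_point topology" where
  "char_topology G =
     subtopology (product_topology (\<lambda>_. euclidean) (invariant_funs G)) (char_variety G)"

definition char_class :: "('g, 'b) monoid_scheme \<Rightarrow> ('g \<Rightarrow> mat2) \<Rightarrow> 'g char_point" where
  "char_class G \<rho> = (\<lambda>f\<in>invariant_funs G. f \<rho>)"

text \<open>Precomposition \<open>\<rho> \<mapsto> \<rho> \<circ> \<alpha>\<close> pulls back invariant functions on \<open>Reps G\<close>, hence acts on the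
  points of the character variety.\<close>

definition aut_act :: "('g, 'b) monoid_scheme \<Rightarrow> ('g \<Rightarrow> 'g) \<Rightarrow> 'g char_point \<Rightarrow> 'g char_point" where
  "aut_act G \<alpha> \<phi> =
     (\<lambda>f\<in>invariant_funs G. \<phi> (\<lambda>\<rho>\<in>Reps G. f (compose (carrier G) \<rho> \<alpha>)))"

text \<open>An outer class acts through any of the automorphisms representing it; by the lemma
  \<open>aut_act_inner\<close> below the choice does not matter.\<close>

definition out_orbit :: "('g, 'b) monoid_scheme \<Rightarrow> 'g char_point \<Rightarrow> 'g char_point set" where
  "out_orbit G \<phi> = (\<Union>c\<in>carrier (Out G). (\<lambda>\<alpha>. aut_act G \<alpha> \<phi>) ` c)"


section \<open>Boundedness\<close>

definition bounded_in :: "'a topology \<Rightarrow> 'a set \<Rightarrow> bool" where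
  "bounded_in X S \<longleftrightarrow> S \<subseteq> topspace X \<and> compactin X (X closure_of S)"

abbreviation SL2_topology :: "mat2 topology" where
  "SL2_topology \<equiv> top_of_set (carrier SL2)"


section \<open>Basic properties\<close>

lemma group_SL2: "group SL2"
proof (rule groupI)
  fix A assume "A \<in> carrier SL2"
  then have d: "det A = 1" by (simp add: SL2_def)
  then have "invertible A" by (simp add: invertible_det_nz)
  then obtain B where i: "B ** A = mat 1" by (auto simp: invertible_def)
  then have "det B * det A = 1" by (metis det_mul det_I)
  with i d show "\<exists>B\<in>carrier SL2. B \<otimes>\<^bsub>SL2\<^esub> A = \<one>\<^bsub>SL2\<^esub>"
    by (auto simp: SL2_def)
qed (auto simp: SL2_def det_mul matrix_mul_assoc)

lemma topspace_char_topology: "topspace (char_topology G) = char_variety G"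
  by (auto simp: char_topology_def char_variety_def PiE_def)

lemma conj_rep_Reps:
  assumes "group G" "A \<in> carrier SL2" "\<rho> \<in> Reps G"
  shows "conj_rep G A \<rho> \<in> Reps G"
proof -
  interpret G: group G by fact
  interpret S: group SL2 by (rule group_SL2)
  have r: "\<And>g. g \<in> carrier G \<Longrightarrow> \<rho> g \<in> carrier SL2"
    and rm: "\<And>g h. g \<in> carrier G \<Longrightarrow> h \<in> carrier G \<Longrightarrow> \<rho> (g \<otimes>\<^bsub>G\<^esub> h) = \<rho> g \<otimes>\<^bsub>SL2\<^esub> \<rho> h"
    using assms(3) by (auto simp: Reps_def hom_def)
  have "A \<otimes>\<^bsub>SL2\<^esub> (x \<otimes>\<^bsub>SL2\<^esub> y) \<otimes>\<^bsub>SL2\<^esub> inv\<^bsub>SL2\<^esub> A =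
        A \<otimes>\<^bsub>SL2\<^esub> x \<otimes>\<^bsub>SL2\<^esub> inv\<^bsub>SL2\<^esub> A \<otimes>\<^bsub>SL2\<^esub> (A \<otimes>\<^bsub>SL2\<^esub> y \<otimes>\<^bsub>SL2\<^esub> inv\<^bsub>SL2\<^esub> A)"
    if "x \<in> carrier SL2" "y \<in> carrier SL2" for x y
    using that assms(2) by (simp add: S.m_assoc S.inv_solve_left)
  then show ?thesis
    using assms(2) r rm by (auto simp: Reps_def hom_def conj_rep_def)
qed

lemma compose_Reps:
  assumes "group G" "\<rho> \<in> Reps G" "\<alpha> \<in> auto G"
  shows "compose (carrier G) \<rho> \<alpha> \<in> Reps G"
proof -
  interpret G: group G by fact
  show ?thesis
    using assms(2,3) by (auto simp: Reps_def auto_def hom_def compose_def Pi_def)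
qed

lemma regular_extensional: "f \<in> regular_funs G \<Longrightarrow> f \<in> extensional (Reps G)"
  by (induction rule: regular_funs.induct) (rule restrict_extensional)+

lemma const_invariant: "group G \<Longrightarrow> (\<lambda>\<rho>\<in>Reps G. c) \<in> invariant_funs G"
  by (auto simp: invariant_funs_def conj_rep_Reps intro: regular_funs.const)

lemma add_invariant:
  "group G \<Longrightarrow> f \<in> invariant_funs G \<Longrightarrow> h \<in> invariant_funs G \<Longrightarrow>
   (\<lambda>\<rho>\<in>Reps G. f \<rho> + h \<rho>) \<in> invariant_funs G"
  by (auto simp: invariant_funs_def conj_rep_Reps intro: regular_funs.add)

lemma mult_invariant:
  "group G \<Longrightarrow> f \<in> invariant_funs G \<Longrightarrow> h \<in> invariant_funs G \<Longrightarrow>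
   (\<lambda>\<rho>\<in>Reps G. f \<rho> * h \<rho>) \<in> invariant_funs G"
  by (auto simp: invariant_funs_def conj_rep_Reps intro: regular_funs.mult)

lemma char_class_in_char_variety:
  "group G \<Longrightarrow> \<rho> \<in> Reps G \<Longrightarrow> char_class G \<rho> \<in> char_variety G"
  by (simp add: char_variety_def char_class_def const_invariant add_invariant mult_invariant)

lemma pullback_regular:
  assumes "group G" "\<alpha> \<in> auto G" "f \<in> regular_funs G"
  shows "(\<lambda>\<rho>\<in>Reps G. f (compose (carrier G) \<rho> \<alpha>)) \<in> regular_funs G"
  using assms(3)
proof (induction rule: regular_funs.induct)
  case (const c)
  have "(\<lambda>\<rho>\<in>Reps G. (\<lambda>\<rho>\<in>Reps G. c) (compose (carrier G) \<rho> \<alpha>)) = (\<lambda>\<rho>\<in>Reps G. c)"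
    by (rule restrict_ext) (simp add: compose_Reps assms)
  then show ?case using regular_funs.const by metis
next
  case (entry g i j)
  have "(\<lambda>\<rho>\<in>Reps G. (\<lambda>\<rho>\<in>Reps G. \<rho> g $ i $ j) (compose (carrier G) \<rho> \<alpha>)) =
        (\<lambda>\<rho>\<in>Reps G. \<rho> (\<alpha> g) $ i $ j)"
    by (rule restrict_ext) (simp add: compose_Reps assms entry compose_eq)
  moreover have "\<alpha> g \<in> carrier G" using assms(2) entry by (auto simp: auto_def hom_def)
  ultimately show ?case using regular_funs.entry by metis
next
  case (add f h)
  have "(\<lambda>\<rho>\<in>Reps G. (\<lambda>\<rho>\<in>Reps G. f \<rho> + h \<rho>) (compose (carrier G) \<rho> \<alpha>)) =
        (\<lambda>\<rho>\<in>Reps G. (\<lambda>\<rho>\<in>Reps G. f (compose (carrier G) \<rho> \<alpha>)) \<rho> +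
                     (\<lambda>\<rho>\<in>Reps G. h (compose (carrier G) \<rho> \<alpha>)) \<rho>)"
    by (rule restrict_ext) (simp add: compose_Reps assms)
  then show ?case using regular_funs.add[OF add.IH] by (simp only:)
next
  case (mult f h)
  have "(\<lambda>\<rho>\<in>Reps G. (\<lambda>\<rho>\<in>Reps G. f \<rho> * h \<rho>) (compose (carrier G) \<rho> \<alpha>)) =
        (\<lambda>\<rho>\<in>Reps G. (\<lambda>\<rho>\<in>Reps G. f (compose (carrier G) \<rho> \<alpha>)) \<rho> *
                     (\<lambda>\<rho>\<in>Reps G. h (compose (carrier G) \<rho> \<alpha>)) \<rho>)"
    by (rule restrict_ext) (simp add: compose_Reps assms)
  then show ?case using regular_funs.mult[OF mult.IH] by (simp only:)
qed

lemma pullback_invariant: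
  assumes "group G" "\<alpha> \<in> auto G" "f \<in> invariant_funs G"
  shows "(\<lambda>\<rho>\<in>Reps G. f (compose (carrier G) \<rho> \<alpha>)) \<in> invariant_funs G"
proof -
  have "compose (carrier G) (conj_rep G A \<rho>) \<alpha> = conj_rep G A (compose (carrier G) \<rho> \<alpha>)" for A \<rho>
    unfolding compose_def conj_rep_def
    by (rule restrict_ext) (use assms(2) in \<open>auto simp: auto_def hom_def\<close>)
  with assms show ?thesis
    by (auto simp: invariant_funs_def conj_rep_Reps compose_Reps pullback_regular)
qed

lemma aut_act_char_variety:
  assumes "group G" "\<alpha> \<in> auto G" "\<phi> \<in> char_variety G"
  shows "aut_act G \<alpha> \<phi> \<in> char_variety G"
proof -
  let ?p = "\<lambda>f. \<lambda>\<rho>\<in>Reps G. f (compose (carrier G) \<rho> \<alpha>)"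
  have c: "?p (\<lambda>\<rho>\<in>Reps G. c) = (\<lambda>\<rho>\<in>Reps G. c)" for c :: complex
    by (rule restrict_ext) (simp add: compose_Reps assms)
  have a: "?p (\<lambda>\<rho>\<in>Reps G. f \<rho> + h \<rho>) = (\<lambda>\<rho>\<in>Reps G. ?p f \<rho> + ?p h \<rho>)"
    and m: "?p (\<lambda>\<rho>\<in>Reps G. f \<rho> * h \<rho>) = (\<lambda>\<rho>\<in>Reps G. ?p f \<rho> * ?p h \<rho>)"
    for f h :: "('a \<Rightarrow> mat2) \<Rightarrow> complex"
    by (rule restrict_ext, simp add: compose_Reps assms)+
  have pc: "\<phi> (\<lambda>\<rho>\<in>Reps G. c) = c" for c
    using assms(3) by (simp add: char_variety_def)
  have pa: "\<phi> (\<lambda>\<rho>\<in>Reps G. f \<rho> + h \<rho>) = \<phi> f + \<phi> h"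
    and pm: "\<phi> (\<lambda>\<rho>\<in>Reps G. f \<rho> * h \<rho>) = \<phi> f * \<phi> h"
    if "f \<in> invariant_funs G" "h \<in> invariant_funs G" for f h
    using that assms(3) unfolding char_variety_def by blast+
  note inv = pullback_invariant[OF assms(1,2)]
  have act: "aut_act G \<alpha> \<phi> f = \<phi> (?p f)" if "f \<in> invariant_funs G" for f
    using that by (simp add: aut_act_def)
  show ?thesis
    unfolding char_variety_def
  proof (intro CollectI conjI IntI ballI allI)
    show "aut_act G \<alpha> \<phi> \<in> extensional (invariant_funs G)" by (simp add: aut_act_def)
    fix c show "aut_act G \<alpha> \<phi> (\<lambda>\<rho>\<in>Reps G. c) = c"
      unfolding act[OF const_invariant[OF assms(1)]] c by (rule pc)
  next
    fix f h assume fh: "f \<in> invariant_funs G" "h \<in> invariant_funs G"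
    show "aut_act G \<alpha> \<phi> (\<lambda>\<rho>\<in>Reps G. f \<rho> + h \<rho>) = aut_act G \<alpha> \<phi> f + aut_act G \<alpha> \<phi> h"
      unfolding act[OF add_invariant[OF assms(1) fh]] act[OF fh(1)] act[OF fh(2)] a
      by (rule pa[OF inv[OF fh(1)] inv[OF fh(2)]])
    show "aut_act G \<alpha> \<phi> (\<lambda>\<rho>\<in>Reps G. f \<rho> * h \<rho>) = aut_act G \<alpha> \<phi> f * aut_act G \<alpha> \<phi> h"
      unfolding act[OF mult_invariant[OF assms(1) fh]] act[OF fh(1)] act[OF fh(2)] m
      by (rule pm[OF inv[OF fh(1)] inv[OF fh(2)]])
  qed
qed

lemma aut_act_char_class:
  assumes "group G" "\<alpha> \<in> auto G" "\<rho> \<in> Reps G"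
  shows "aut_act G \<alpha> (char_class G \<rho>) = char_class G (compose (carrier G) \<rho> \<alpha>)"
  unfolding aut_act_def char_class_def
  by (rule restrict_ext) (simp add: pullback_invariant assms)

lemma aut_act_inner:
  assumes "group G" "\<alpha> \<in> Inn G" "\<phi> \<in> char_variety G"
  shows "aut_act G \<alpha> \<phi> = \<phi>"
proof -
  interpret G: group G by fact
  obtain g where g: "g \<in> carrier G"
    and al: "\<alpha> = (\<lambda>x\<in>carrier G. g \<otimes>\<^bsub>G\<^esub> x \<otimes>\<^bsub>G\<^esub> inv\<^bsub>G\<^esub> g)"
    using assms(2) by (auto simp: Inn_def)
  have comp: "compose (carrier G) \<rho> \<alpha> = conj_rep G (\<rho> g) \<rho>" if "\<rho> \<in> Reps G" for \<rho>
  proof -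
    interpret h: group_hom G SL2 \<rho>
      using that assms(1) group_SL2
      by (auto simp: group_hom_def group_hom_axioms_def Reps_def)
    show ?thesis using g by (auto simp: compose_def conj_rep_def al)
  qed
  have "(\<lambda>\<rho>\<in>Reps G. f (compose (carrier G) \<rho> \<alpha>)) = f" if "f \<in> invariant_funs G" for f
  proof (rule extensionalityI[of _ "Reps G"])
    fix \<rho> assume r: "\<rho> \<in> Reps G"
    then have "\<rho> g \<in> carrier SL2" using g by (auto simp: Reps_def hom_def)
    then show "(\<lambda>\<rho>\<in>Reps G. f (compose (carrier G) \<rho> \<alpha>)) \<rho> = f \<rho>"
      using r that by (simp add: comp invariant_funs_def)
  qed (use that in \<open>auto simp: invariant_funs_def regular_extensional\<close>)
  then have "aut_act G \<alpha> \<phi> = restrict \<phi> (invariant_funs G)"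
    unfolding aut_act_def by (intro restrict_ext) simp
  also have "\<dots> = \<phi>"
    using assms(3) by (simp add: char_variety_def extensional_restrict)
  finally show ?thesis .
qed

lemma Inn_subset_auto:
  assumes "group G"
  shows "Inn G \<subseteq> auto G"
proof
  interpret G: group G by fact
  fix \<alpha> assume "\<alpha> \<in> Inn G"
  then obtain g where g: "g \<in> carrier G"
    and al: "\<alpha> = (\<lambda>x\<in>carrier G. g \<otimes>\<^bsub>G\<^esub> x \<otimes>\<^bsub>G\<^esub> inv\<^bsub>G\<^esub> g)"
    by (auto simp: Inn_def)
  have cancel: "inv\<^bsub>G\<^esub> g \<otimes>\<^bsub>G\<^esub> (g \<otimes>\<^bsub>G\<^esub> x) = x" "g \<otimes>\<^bsub>G\<^esub> (inv\<^bsub>G\<^esub> g \<otimes>\<^bsub>G\<^esub> x) = x"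
    if "x \<in> carrier G" for x
    using that g by (simp_all flip: G.m_assoc)
  have "bij_betw \<alpha> (carrier G) (carrier G)"
    by (rule bij_betw_byWitness[where f' = "\<lambda>x. inv\<^bsub>G\<^esub> g \<otimes>\<^bsub>G\<^esub> x \<otimes>\<^bsub>G\<^esub> g"])
       (use g in \<open>auto simp: al G.m_assoc cancel\<close>)
  moreover have "\<alpha> \<in> hom G G"
    using g by (auto simp: al hom_def G.m_assoc cancel)
  ultimately show "\<alpha> \<in> auto G" by (auto simp: auto_def Bij_def al)
qed

lemma Union_Out:
  assumes "group G"
  shows "\<Union> (carrier (Out G)) = auto G"
proof -
  interpret G: group G by fact
  interpret A: group "AutoGroup G" by (rule G.AutoGroup)
  have car: "carrier (AutoGroup G) = auto G" by (simp add: AutoGroup_def)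
  have one: "\<one>\<^bsub>AutoGroup G\<^esub> = (\<lambda>x\<in>carrier G. x)" by (simp add: AutoGroup_def BijGroup_def)
  have "(\<lambda>x\<in>carrier G. x) = (\<lambda>x\<in>carrier G. \<one>\<^bsub>G\<^esub> \<otimes>\<^bsub>G\<^esub> x \<otimes>\<^bsub>G\<^esub> inv\<^bsub>G\<^esub> \<one>\<^bsub>G\<^esub>)"
    by (rule restrict_ext) simp
  then have "\<one>\<^bsub>AutoGroup G\<^esub> \<in> Inn G" unfolding one Inn_def by blast
  moreover have "Inn G \<subseteq> carrier (AutoGroup G)" using Inn_subset_auto[OF assms] car by simp
  ultimately have I: "\<one>\<^bsub>AutoGroup G\<^esub> \<in> Inn G" "Inn G \<subseteq> carrier (AutoGroup G)" by auto
  have "\<Union> (rcosets\<^bsub>AutoGroup G\<^esub> Inn G) = carrier (AutoGroup G)"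
  proof (intro equalityI subsetI)
    fix a assume "a \<in> \<Union> (rcosets\<^bsub>AutoGroup G\<^esub> Inn G)"
    then show "a \<in> carrier (AutoGroup G)"
      using I(2) A.r_coset_subset_G unfolding RCOSETS_def by blast
  next
    fix a assume a: "a \<in> carrier (AutoGroup G)"
    then have "\<one>\<^bsub>AutoGroup G\<^esub> \<otimes>\<^bsub>AutoGroup G\<^esub> a = a" by (rule A.l_one)
    with I(1) have "a \<in> Inn G #>\<^bsub>AutoGroup G\<^esub> a" unfolding r_coset_def by force
    with a show "a \<in> \<Union> (rcosets\<^bsub>AutoGroup G\<^esub> Inn G)" unfolding RCOSETS_def by blast
  qed
  then show ?thesis by (simp add: Out_def FactGroup_def car)
qed

lemma out_orbit_char_class:
  assumes "group G" "\<rho> \<in> Reps G"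
  shows "out_orbit G (char_class G \<rho>) = (\<lambda>\<alpha>. char_class G (compose (carrier G) \<rho> \<alpha>)) ` auto G"
proof -
  have "out_orbit G (char_class G \<rho>) =
        (\<lambda>\<alpha>. aut_act G \<alpha> (char_class G \<rho>)) ` \<Union> (carrier (Out G))"
    by (auto simp: out_orbit_def)
  then show ?thesis
    using assms by (auto simp: Union_Out aut_act_char_class)
qed

end

theory Submission
  imports Defs "HOL-Computational_Algebra.Polynomial"
begin

text \<open>
  Let \<open>x\<^sub>1, \<dots>, x\<^sub>m\<close> be the basis and \<open>A\<^sub>i\<close> the image of \<open>x\<^sub>i\<close>. The transvections \<open>x\<^sub>k \<mapsto> x\<^sub>k w\<close>, with \<open>w\<close> a word
  in the other generators, show that the traces of \<open>A\<^sub>k h\<close>, for \<open>h\<close> in the group \<open>H\<^sub>k\<close> generated by the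
  other matrices, form a bounded (finite) set. The diagonal case follows directly. In the irreducible
  case one may assume, after an automorphism, that \<open>A\<^sub>1, A\<^sub>2\<close> is an irreducible pair. A matrix \<open>Z\<close> is
  a linear function of the traces of \<open>Z\<close>, \<open>A\<^sub>1 Z\<close>, \<open>A\<^sub>2 Z\<close>, \<open>A\<^sub>1 A\<^sub>2 Z\<close>, so \<open>H\<^sub>k\<close> is bounded (finite) for \<open>k \<ge> 3\<close>.

  Bounded case: the elements of \<open>H\<^sub>k\<close> have traces in \<open>[-2, 2]\<close>. Hence \<open>A\<^sub>1, A\<^sub>2\<close> preserve a Hermitian form,
  which is definite because the commutator has trace at most \<open>2\<close>, and since \<open>m \<ge> 4\<close> every other \<open>A\<^sub>i\<close>
  has real traces against \<open>1, A\<^sub>1, A\<^sub>2, A\<^sub>1 A\<^sub>2\<close>, so it preserves the same form.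

  Finite case: the traces of the \<open>A\<^sub>i\<close>, \<open>A\<^sub>i A\<^sub>j\<close> and \<open>A\<^sub>1 A\<^sub>2 A\<^sub>i\<close> are sums \<open>z + 1/z\<close> of roots of unity, so the
  group is defined over a cyclotomic field and, by the Fricke relations, its entries have bounded
  denominators. Every Galois conjugate of the representation again has finite trace sets, hence
  bounded image by the first case. Cyclotomic numbers with bounded denominators and bounded conjugates
  form a finite set.
\<close>


section \<open>Conjugates of cyclotomic integers\<close>

text \<open>Three obstacles shape the argument. Boundedness need not survive a Galois conjugation,
  whereas finiteness does: the trace sets of a conjugate family are images of the original ones. So
  the bounded case comes before the finite case and is proved for arbitrary families of matrices,
  since it is later applied to conjugates. Next, cyclotomic traces alone need not give cyclotomic
  entries; this is why A_1 is diagonalised, which makes its diagonal entries roots of unity, and why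
  one entry of A_2 is scaled to 1. Finally, for m = 4 no group H_k with k = 3 or 4 contains both A_3
  and A_4, so the trace of A_3 A_4 is reached by a further transvection that turns this product into
  the image of a single generator. In the opposite direction, precomposition with an automorphism
  preserves the image of a representation, so a finite or bounded image controls all points of the
  orbit at once.\<close>

definition rat_eval :: "complex \<Rightarrow> rat poly \<Rightarrow> complex" where
  "rat_eval z p = poly (map_poly of_rat p) z"

lemma rat_eval_0 [simp]: "rat_eval z 0 = 0"
  by (simp add: rat_eval_def)

lemma rat_eval_pCons [simp]: "rat_eval z (pCons a p) = of_rat a + z * rat_eval z p"
  by (simp add: rat_eval_def map_poly_pCons)

lemma rat_eval_1 [simp]: "rat_eval z 1 = 1"
  by (simp add: one_pCons)

lemma rat_eval_add [simp]: "rat_eval z (p + q) = rat_eval z p + rat_eval z q"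
  by (induction p q rule: poly_induct2) (simp_all add: of_rat_add algebra_simps)

lemma rat_eval_smult [simp]: "rat_eval z (smult c p) = of_rat c * rat_eval z p"
  by (induction p) (simp_all add: of_rat_mult algebra_simps)

lemma rat_eval_mult [simp]: "rat_eval z (p * q) = rat_eval z p * rat_eval z q"
  by (induction p) (simp_all add: algebra_simps)

lemma rat_eval_minus [simp]: "rat_eval z (- p) = - rat_eval z p"
  using rat_eval_smult[of z "-1" p] by simp

lemma rat_eval_diff [simp]: "rat_eval z (p - q) = rat_eval z p - rat_eval z q"
  using rat_eval_add[of z p "- q"] by simp

lemma rat_eval_monom [simp]: "rat_eval z (monom c n) = of_rat c * z ^ n"
  by (simp add: rat_eval_def map_poly_monom poly_monom)

lemma rat_eval_altdef: "rat_eval z p = (\<Sum>i\<le>degree p. of_rat (coeff p i) * z ^ i)"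
proof -
  have "degree (map_poly of_rat p :: complex poly) = degree p"
    by (rule degree_map_poly) (simp add: of_rat_eq_0_iff)
  then show ?thesis by (simp add: rat_eval_def poly_altdef coeff_map_poly)
qed

text \<open>Integrality is a predicate on rational polynomials, so that elements of Z[\<zeta>] and
  of Q(\<zeta>) are evaluated and conjugated by the same function.\<close>

definition int_coeffs :: "rat poly \<Rightarrow> bool" where
  "int_coeffs p \<longleftrightarrow> (\<forall>i. coeff p i \<in> \<int>)"

lemma int_coeffs_add: "int_coeffs p \<Longrightarrow> int_coeffs q \<Longrightarrow> int_coeffs (p + q)"
  by (simp add: int_coeffs_def)


lemma int_coeffs_mult: "int_coeffs p \<Longrightarrow> int_coeffs q \<Longrightarrow> int_coeffs (p * q)"
  by (auto simp: int_coeffs_def coeff_mult intro!: Ints_sum Ints_mult)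

lemma int_coeffs_monom: "int_coeffs (monom 1 n)"
  by (simp add: int_coeffs_def)

lemma clear_denominators: "\<exists>E::int. E > 0 \<and> int_coeffs (smult (of_int E) p)"
proof (induction p)
  case 0
  then show ?case by (intro exI[of _ 1]) (simp add: int_coeffs_def)
next
  case (pCons a p)
  then obtain E :: int where E: "E > 0" "int_coeffs (smult (of_int E) p)" by blast
  obtain n d where nd: "quotient_of a = (n, d)" by force
  have d: "d > 0" using nd by (rule quotient_of_denom_pos)
  have a: "a = of_int n / of_int d" using nd by (rule quotient_of_div)
  have "of_int (d * E) * coeff (pCons a p) i \<in> \<int>" for i
  proof (cases i)
    case 0
    have "of_int (d * E) * a = of_int (E * n)" using d by (simp add: a)
    then show ?thesis using 0 by (metis Ints_of_int coeff_pCons_0)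
  next
    case (Suc j)
    have "of_int d * (of_int E * coeff p j) \<in> \<int>" using E(2) by (auto simp: int_coeffs_def)
    then show ?thesis using Suc by (simp add: mult.assoc)
  qed
  then have "int_coeffs (smult (of_int (d * E)) (pCons a p))"
    unfolding int_coeffs_def coeff_smult by blast
  then show ?case using d E(1) by (intro exI[of _ "d * E"]) simp
qed

section \<open>Annihilating polynomials and inverses in Q(\<zeta>)\<close>

lemma minimal_polynomial:
  assumes "p \<noteq> 0" "rat_eval \<zeta> p = 0"
  obtains \<mu> where "\<mu> \<noteq> 0" "\<And>q. rat_eval \<zeta> q = 0 \<longleftrightarrow> \<mu> dvd q"
proof -
  define \<mu> where "\<mu> = arg_min degree (\<lambda>p. p \<noteq> 0 \<and> rat_eval \<zeta> p = 0)"
  have \<mu>: "\<mu> \<noteq> 0" "rat_eval \<zeta> \<mu> = 0"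
    using arg_min_natI[of "\<lambda>p. p \<noteq> 0 \<and> rat_eval \<zeta> p = 0" p degree] assms by (auto simp: \<mu>_def)
  have min: "degree \<mu> \<le> degree q" if "q \<noteq> 0" "rat_eval \<zeta> q = 0" for q
    unfolding \<mu>_def by (rule arg_min_nat_le) (use that in auto)
  have "\<mu> dvd q" if q: "rat_eval \<zeta> q = 0" for q
  proof -
    have "rat_eval \<zeta> (q mod \<mu>) = rat_eval \<zeta> (q - q div \<mu> * \<mu>)"
      by (simp add: minus_div_mult_eq_mod)
    also have "\<dots> = 0" using q \<mu>(2) by simp
    finally have "q mod \<mu> = 0"
      using min[of "q mod \<mu>"] degree_mod_less'[of \<mu> q] \<mu>(1) by (meson leD)
    then show ?thesis by auto
  qed
  moreover have "rat_eval \<zeta> q = 0" if "\<mu> dvd q" for q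
    using that \<mu>(2) by (auto elim!: dvdE)
  ultimately have "rat_eval \<zeta> q = 0 \<longleftrightarrow> \<mu> dvd q" for q by (rule iffI)
  with \<mu>(1) show ?thesis by (rule that)
qed

text \<open>Induction on the degree of \<open>q\<close>, below that of \<mu>: at \<zeta> the
  remainder of \<mu> modulo \<open>q\<close> is a multiple of the value of \<open>q\<close>, so an
  inverse of the remainder yields an inverse of that value.\<close>

lemma rat_eval_inverse:
  assumes "p \<noteq> 0" "rat_eval \<zeta> p = 0" "rat_eval \<zeta> q \<noteq> 0"
  shows "\<exists>r. rat_eval \<zeta> r * rat_eval \<zeta> q = 1"
proof -
  obtain \<mu> where \<mu>: "\<mu> \<noteq> 0" "\<And>q. rat_eval \<zeta> q = 0 \<longleftrightarrow> \<mu> dvd q"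
    using minimal_polynomial[OF assms(1,2)] by blast
  have main: "\<exists>r. rat_eval \<zeta> r * rat_eval \<zeta> q = 1"
    if "rat_eval \<zeta> q \<noteq> 0" "degree q < degree \<mu>" for q
    using that
  proof (induction "degree q" arbitrary: q rule: less_induct)
    case less
    have q0: "q \<noteq> 0" using less.prems by auto
    show ?case
    proof (cases "degree q = 0")
      case True
      then obtain c where c: "q = [:c:]" by (metis degree_eq_zeroE)
      then have "c \<noteq> 0" using q0 by auto
      then show ?thesis unfolding c
        by (intro exI[of _ "[:inverse c:]"]) (simp flip: of_rat_mult)
    next
      case False
      define s where "s = \<mu> mod q"
      have e: "rat_eval \<zeta> s = - rat_eval \<zeta> (\<mu> div q) * rat_eval \<zeta> q"
      proof -
        have "s = \<mu> - \<mu> div q * q" by (simp add: s_def minus_div_mult_eq_mod)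
        then show ?thesis using \<mu>(2)[of \<mu>] by simp
      qed
      \<comment> \<open>If the remainder vanished at \<zeta>, it would be zero by its degree, and
        \<mu> would divide the quotient \<open>\<mu> div q\<close>. Comparing degrees, this is
        impossible for a nonconstant \<open>q\<close>.\<close>
      have ne: "rat_eval \<zeta> s \<noteq> 0"
      proof
        assume "rat_eval \<zeta> s = 0"
        then have "rat_eval \<zeta> (\<mu> div q) = 0" using e less.prems(1) by simp
        then have d: "\<mu> dvd \<mu> div q" using \<mu>(2) by blast
        have "\<mu> dvd s" using \<open>rat_eval \<zeta> s = 0\<close> \<mu>(2) by blast
        moreover have "s = 0 \<or> degree s < degree q"
          unfolding s_def using degree_mod_less'[OF q0] by blast
        ultimately have "s = 0" using less.prems(2) dvd_imp_degree_le by fastforce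
        then have m: "\<mu> = \<mu> div q * q" unfolding s_def by auto
        then have "\<mu> div q \<noteq> 0" using \<mu>(1) by auto
        then have "degree \<mu> = degree (\<mu> div q) + degree q" "degree \<mu> \<le> degree (\<mu> div q)"
          using m degree_mult_eq[OF _ q0] dvd_imp_degree_le[OF d] by metis+
        then show False using False by simp
      qed
      then have "s \<noteq> 0" by auto
      then have "degree s < degree q" unfolding s_def using degree_mod_less'[OF q0] by blast
      with less ne obtain r where "rat_eval \<zeta> r * rat_eval \<zeta> s = 1" by fastforce
      then show ?thesis using e
        by (intro exI[of _ "- (r * (\<mu> div q))"]) (simp add: algebra_simps)
    qed
  qed
  have "rat_eval \<zeta> (q mod \<mu>) = rat_eval \<zeta> (q - q div \<mu> * \<mu>)"
    by (simp add: minus_div_mult_eq_mod)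
  also have "\<dots> = rat_eval \<zeta> q" using \<mu>(2)[of \<mu>] by simp
  finally have e: "rat_eval \<zeta> (q mod \<mu>) = rat_eval \<zeta> q" .
  then have "q mod \<mu> \<noteq> 0" using assms(3) by auto
  then have "degree (q mod \<mu>) < degree \<mu>" using degree_mod_less'[OF \<mu>(1)] by blast
  then show ?thesis using main[of "q mod \<mu>"] assms(3) by (simp add: e)
qed

section \<open>Embeddings of Q(\<zeta>) into the complex numbers\<close>

text \<open>For algebraic \<zeta> these are the images of \<zeta> under the embeddings of
  Q(\<zeta>). The condition on vanishing polynomials is what makes evaluation at \<omega>
  independent of the polynomial chosen to represent an element.\<close>

definition rat_conjugates :: "complex \<Rightarrow> complex set" where
  "rat_conjugates \<zeta> = {\<omega>. \<forall>p. rat_eval \<zeta> p = 0 \<longrightarrow> rat_eval \<omega> p = 0}"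

text \<open>Meaningful only for \<open>\<omega>\<close> conjugate to \<open>\<zeta>\<close> and \<open>z\<close> in the field generated by \<open>\<zeta>\<close>; there the choice
  of \<open>p\<close> does not matter.\<close>

definition conj_hom :: "complex \<Rightarrow> complex \<Rightarrow> complex \<Rightarrow> complex" where
  "conj_hom \<zeta> \<omega> z = rat_eval \<omega> (SOME p. rat_eval \<zeta> p = z)"

lemma conj_hom_rat_eval:
  assumes "\<omega> \<in> rat_conjugates \<zeta>"
  shows "conj_hom \<zeta> \<omega> (rat_eval \<zeta> p) = rat_eval \<omega> p"
proof -
  define q where "q = (SOME q. rat_eval \<zeta> q = rat_eval \<zeta> p)"
  have "rat_eval \<zeta> q = rat_eval \<zeta> p" unfolding q_def by (rule someI) simp
  then have "rat_eval \<zeta> (q - p) = 0" by simp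
  then have "rat_eval \<omega> (q - p) = 0" using assms unfolding rat_conjugates_def by blast
  then show ?thesis by (simp add: conj_hom_def q_def)
qed

abbreviation rat_adjoin :: "complex \<Rightarrow> complex set" where
  "rat_adjoin \<zeta> \<equiv> range (rat_eval \<zeta>)"

lemma rat_adjoin_closed:
  shows "0 \<in> rat_adjoin \<zeta>" "1 \<in> rat_adjoin \<zeta>"
    and "x \<in> rat_adjoin \<zeta> \<Longrightarrow> y \<in> rat_adjoin \<zeta> \<Longrightarrow> x + y \<in> rat_adjoin \<zeta>"
    and "x \<in> rat_adjoin \<zeta> \<Longrightarrow> y \<in> rat_adjoin \<zeta> \<Longrightarrow> x - y \<in> rat_adjoin \<zeta>"
    and "x \<in> rat_adjoin \<zeta> \<Longrightarrow> y \<in> rat_adjoin \<zeta> \<Longrightarrow> x * y \<in> rat_adjoin \<zeta>"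
    and "x \<in> rat_adjoin \<zeta> \<Longrightarrow> - x \<in> rat_adjoin \<zeta>"
proof -
  show "0 \<in> rat_adjoin \<zeta>" by (metis rangeI rat_eval_0)
  show "1 \<in> rat_adjoin \<zeta>" by (metis rangeI rat_eval_1)
  show "x + y \<in> rat_adjoin \<zeta>" if "x \<in> rat_adjoin \<zeta>" "y \<in> rat_adjoin \<zeta>"
    using that by (elim imageE) (simp only: rangeI flip: rat_eval_add)
  show "x - y \<in> rat_adjoin \<zeta>" if "x \<in> rat_adjoin \<zeta>" "y \<in> rat_adjoin \<zeta>"
    using that by (elim imageE) (simp only: rangeI flip: rat_eval_diff)
  show "x * y \<in> rat_adjoin \<zeta>" if "x \<in> rat_adjoin \<zeta>" "y \<in> rat_adjoin \<zeta>"
    using that by (elim imageE) (simp only: rangeI flip: rat_eval_mult)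
  show "- x \<in> rat_adjoin \<zeta>" if "x \<in> rat_adjoin \<zeta>"
    using that by (elim imageE) (simp only: rangeI flip: rat_eval_minus)
qed

lemma conj_hom_simps:
  assumes "\<omega> \<in> rat_conjugates \<zeta>"
  shows "conj_hom \<zeta> \<omega> 0 = 0" "conj_hom \<zeta> \<omega> 1 = 1"
    and "x \<in> rat_adjoin \<zeta> \<Longrightarrow> y \<in> rat_adjoin \<zeta> \<Longrightarrow>
           conj_hom \<zeta> \<omega> (x + y) = conj_hom \<zeta> \<omega> x + conj_hom \<zeta> \<omega> y"
    and "x \<in> rat_adjoin \<zeta> \<Longrightarrow> y \<in> rat_adjoin \<zeta> \<Longrightarrow>
           conj_hom \<zeta> \<omega> (x - y) = conj_hom \<zeta> \<omega> x - conj_hom \<zeta> \<omega> y"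
    and "x \<in> rat_adjoin \<zeta> \<Longrightarrow> y \<in> rat_adjoin \<zeta> \<Longrightarrow>
           conj_hom \<zeta> \<omega> (x * y) = conj_hom \<zeta> \<omega> x * conj_hom \<zeta> \<omega> y"
    and "x \<in> rat_adjoin \<zeta> \<Longrightarrow> conj_hom \<zeta> \<omega> (- x) = - conj_hom \<zeta> \<omega> x"
proof -
  note c = conj_hom_rat_eval[OF assms]
  show "conj_hom \<zeta> \<omega> 0 = 0" using c[of 0] by simp
  show "conj_hom \<zeta> \<omega> 1 = 1" using c[of 1] by simp
  show "conj_hom \<zeta> \<omega> (- x) = - conj_hom \<zeta> \<omega> x" if "x \<in> rat_adjoin \<zeta>"
    using that by (elim imageE) (simp only: c flip: rat_eval_minus)
  show "conj_hom \<zeta> \<omega> (x + y) = conj_hom \<zeta> \<omega> x + conj_hom \<zeta> \<omega> y"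
    and "conj_hom \<zeta> \<omega> (x - y) = conj_hom \<zeta> \<omega> x - conj_hom \<zeta> \<omega> y"
    and "conj_hom \<zeta> \<omega> (x * y) = conj_hom \<zeta> \<omega> x * conj_hom \<zeta> \<omega> y"
    if "x \<in> rat_adjoin \<zeta>" "y \<in> rat_adjoin \<zeta>"
    using that by (elim imageE, simp only: c flip: rat_eval_add rat_eval_diff rat_eval_mult)+
qed

lemma root_unity_poly:
  assumes "\<zeta> ^ N = 1" "N > 0"
  shows "monom 1 N - 1 \<noteq> (0 :: rat poly)" "rat_eval \<zeta> (monom 1 N - 1) = 0"
proof -
  have "coeff (monom 1 N - 1) N = (1 :: rat)" using assms(2) by simp
  then show "monom 1 N - 1 \<noteq> (0 :: rat poly)" by force
qed (use assms in simp)

lemma rat_adjoin_divide: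
  assumes "\<zeta> ^ N = 1" "N > 0" "x \<in> rat_adjoin \<zeta>" "y \<in> rat_adjoin \<zeta>"
  shows "x / y \<in> rat_adjoin \<zeta>"
proof (cases "y = 0")
  case False
  obtain q where q: "y = rat_eval \<zeta> q" using assms(4) by blast
  obtain r where "rat_eval \<zeta> r * y = 1"
    using rat_eval_inverse[OF root_unity_poly[OF assms(1,2)], of q] False q by blast
  then have "x / y = x * rat_eval \<zeta> r" using False by (simp add: field_simps)
  then show ?thesis using assms(3) by (simp add: rat_adjoin_closed)
qed (simp add: rat_adjoin_closed)

text \<open>A ring homomorphism defined on a field is injective. This carries the inequalities that
  define a normal pair over to conjugate matrices.\<close>

lemma conj_hom_nonzero:
  assumes "\<zeta> ^ N = 1" "N > 0" "\<omega> \<in> rat_conjugates \<zeta>" "x \<in> rat_adjoin \<zeta>" "x \<noteq> 0"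
  shows "conj_hom \<zeta> \<omega> x \<noteq> 0"
proof
  assume z: "conj_hom \<zeta> \<omega> x = 0"
  have "1 / x \<in> rat_adjoin \<zeta>" using rat_adjoin_divide assms rat_adjoin_closed(2) by blast
  then have "conj_hom \<zeta> \<omega> (x * (1 / x)) = 0"
    using conj_hom_simps(5)[OF assms(3,4), of "1 / x"] z by (simp del: times_divide_eq_right)
  moreover have "x * (1 / x) = 1" using assms(5) by simp
  ultimately show False using conj_hom_simps(2)[OF assms(3)] by simp
qed

lemma finite_rat_conjugates:
  assumes "\<zeta> ^ N = 1" "N > 0"
  shows "finite (rat_conjugates \<zeta>)"
proof (rule finite_subset)
  show "rat_conjugates \<zeta> \<subseteq> {\<omega>. \<omega> ^ N = 1}"
  proof
    fix \<omega> assume "\<omega> \<in> rat_conjugates \<zeta>"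
    then have "rat_eval \<omega> (monom 1 N - 1) = 0"
      using root_unity_poly(2)[OF assms] unfolding rat_conjugates_def by blast
    then show "\<omega> \<in> {\<omega>. \<omega> ^ N = 1}" by simp
  qed
  show "finite {\<omega>::complex. \<omega> ^ N = 1}" using assms(2) by (intro finite_roots_unity) simp
qed

section \<open>Finiteness of cyclotomic integers with bounded conjugates\<close>

text \<open>Multiplication by a root of unity \<eta> permutes the summation range and scales the sum
  by \<open>\<eta> ^ n\<close>, so the sum vanishes unless all these factors are 1.\<close>

lemma sum_power_roots_unity:
  assumes "N > 0"
  shows "(\<Sum>\<omega> | \<omega> ^ N = (1::complex). \<omega> ^ n) \<in> {0, of_nat N}"
proof (cases "\<forall>\<omega>::complex. \<omega> ^ N = 1 \<longrightarrow> \<omega> ^ n = 1")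
  case True
  then have "(\<Sum>\<omega> | \<omega> ^ N = (1::complex). \<omega> ^ n) = (\<Sum>\<omega> | \<omega> ^ N = (1::complex). 1)"
    by (intro sum.cong) auto
  then show ?thesis using card_roots_unity_eq[OF assms] by simp
next
  case False
  then obtain \<eta> :: complex where \<eta>: "\<eta> ^ N = 1" "\<eta> ^ n \<noteq> 1" by blast
  have "\<eta> \<noteq> 0" using \<eta>(1) assms by (auto simp: power_0_left)
  let ?S = "\<Sum>\<omega> | \<omega> ^ N = (1::complex). \<omega> ^ n"
  have "bij_betw (\<lambda>\<omega>. \<eta> * \<omega>) {\<omega>. \<omega> ^ N = 1} {\<omega>. \<omega> ^ N = 1}"
    by (rule bij_betw_byWitness[where f' = "\<lambda>\<omega>. \<omega> / \<eta>"])
       (use \<eta>(1) \<open>\<eta> \<noteq> 0\<close> in \<open>auto simp: power_mult_distrib power_divide\<close>)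
  then have "?S = (\<Sum>\<omega> | \<omega> ^ N = (1::complex). (\<eta> * \<omega>) ^ n)"
    by (rule sum.reindex_bij_betw[symmetric])
  also have "\<dots> = \<eta> ^ n * ?S" by (simp add: power_mult_distrib sum_distrib_left)
  finally have "?S = 0" using \<eta>(2) by simp
  then show ?thesis by simp
qed

text \<open>An inverse discrete Fourier transform over the \<open>N\<close>-th roots of unity: integrality comes from
  \<open>sum_power_roots_unity\<close>, boundedness from the explicit formula.\<close>

lemma fourier_coefficients:
  assumes N: "N > 0" and f: "int_coeffs f" and \<zeta>: "\<zeta> ^ N = 1"
    and C: "\<And>\<omega>. \<omega> ^ N = 1 \<Longrightarrow> norm (rat_eval \<omega> f) \<le> C"
  obtains F :: "nat \<Rightarrow> int" where "rat_eval \<zeta> f = (\<Sum>k<N. of_int (F k) * \<zeta> ^ k)"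
    and "\<And>k. \<bar>of_int (F k)\<bar> \<le> C"
proof -
  define U where "U = {\<omega>::complex. \<omega> ^ N = 1}"
  have card: "card U = N" unfolding U_def by (rule card_roots_unity_eq[OF N])
  have fin: "finite U" using card N card_ge_0_finite by force
  have U0: "\<omega> \<noteq> 0" "norm \<omega> = 1" if "\<omega> \<in> U" for \<omega>
  proof -
    show "\<omega> \<noteq> 0" using that N by (auto simp: U_def power_0_left)
    have "norm \<omega> ^ N = 1" using that by (simp add: U_def flip: norm_power)
    then show "norm \<omega> = 1" using N power_eq_imp_eq_base[of "norm \<omega>" N 1] by simp
  qed
  \<comment> \<open>On \<open>N\<close>-th roots of unity the exponent \<open>(N - 1) * k\<close>
    acts as -k, so \<open>G k\<close> is the k-th Fourier coefficient of the values of
    \<open>f\<close>.\<close>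
  define G where "G k = (\<Sum>\<omega>\<in>U. rat_eval \<omega> f * \<omega> ^ ((N - 1) * k)) / of_nat N" for k
  have "G k \<in> \<int>" for k
  proof -
    have e: "(\<Sum>\<omega>\<in>U. rat_eval \<omega> f * \<omega> ^ ((N - 1) * k)) =
          (\<Sum>i\<le>degree f. of_rat (coeff f i) * (\<Sum>\<omega>\<in>U. \<omega> ^ (i + (N - 1) * k)))"
      unfolding rat_eval_altdef sum_distrib_right sum_distrib_left
      by (subst sum.swap) (simp add: power_add mult.assoc)
    have "G k = (\<Sum>i\<le>degree f. of_rat (coeff f i) * ((\<Sum>\<omega>\<in>U. \<omega> ^ (i + (N - 1) * k)) / of_nat N))"
      unfolding G_def e by (subst sum_divide_distrib) simp
    also have "\<dots> \<in> \<int>"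
    proof (intro Ints_sum Ints_mult)
      fix i
      show "of_rat (coeff f i) \<in> (\<int> :: complex set)"
        using f unfolding int_coeffs_def by (metis Ints_cases Ints_of_int of_rat_of_int_eq)
      have "(\<Sum>\<omega>\<in>U. \<omega> ^ (i + (N - 1) * k)) \<in> {0, of_nat N}"
        unfolding U_def by (rule sum_power_roots_unity[OF N])
      then show "(\<Sum>\<omega>\<in>U. \<omega> ^ (i + (N - 1) * k)) / of_nat N \<in> \<int>" using N by auto
    qed
    finally show ?thesis .
  qed
  then have "\<forall>k. \<exists>j. G k = of_int j" by (metis Ints_cases)
  then obtain F where F: "\<And>k. G k = of_int (F k)" by metis
  have "\<bar>of_int (F k)\<bar> \<le> C" for k
  proof -
    have "norm (\<Sum>\<omega>\<in>U. rat_eval \<omega> f * \<omega> ^ ((N - 1) * k)) \<le> (\<Sum>\<omega>\<in>U. C)"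
      by (rule sum_norm_le) (use C U0 in \<open>auto simp: U_def norm_mult norm_power\<close>)
    then have "norm (G k) \<le> C" using N by (simp add: G_def card norm_divide field_simps)
    then show ?thesis by (simp add: F)
  qed
  moreover have "rat_eval \<zeta> f = (\<Sum>k<N. of_int (F k) * \<zeta> ^ k)"
  proof -
    have zU: "\<zeta> \<in> U" using \<zeta> by (simp add: U_def)
    \<comment> \<open>Orthogonality: a geometric sum with ratio \<zeta> / \<omega>, written
      \<open>\<omega> ^ (N - 1) * \<zeta>\<close>.\<close>
    have inner: "(\<Sum>k<N. \<omega> ^ ((N - 1) * k) * \<zeta> ^ k) = (if \<omega> = \<zeta> then of_nat N else 0)"
      if w: "\<omega> \<in> U" for \<omega>
    proof -
      have "\<omega> ^ N = 1" using w by (simp add: U_def)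
      then have wi: "\<omega> * \<omega> ^ (N - 1) = 1" using N by (metis power_eq_if not_gr_zero)
      have "(\<Sum>k<N. \<omega> ^ ((N - 1) * k) * \<zeta> ^ k) = (\<Sum>k<N. (\<omega> ^ (N - 1) * \<zeta>) ^ k)"
        by (simp add: power_mult power_mult_distrib)
      also have "\<dots> = (if \<omega> = \<zeta> then of_nat N else 0)"
      proof (cases "\<omega> = \<zeta>")
        case True
        then show ?thesis using wi by (simp add: mult.commute)
      next
        case False
        have ne: "\<omega> ^ (N - 1) * \<zeta> \<noteq> 1"
        proof
          assume "\<omega> ^ (N - 1) * \<zeta> = 1"
          then have "\<omega> * \<omega> ^ (N - 1) * \<zeta> = \<omega>" by (simp only: mult.assoc mult_1_right)
          then show False using False unfolding wi by simp
        qed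
        have "(\<omega> ^ (N - 1) * \<zeta>) ^ N = (\<omega> ^ N) ^ (N - 1) * \<zeta> ^ N"
          by (simp add: power_mult_distrib mult.commute flip: power_mult)
        then have "(\<omega> ^ (N - 1) * \<zeta>) ^ N = 1" using w \<zeta> by (simp add: U_def)
        then show ?thesis using geometric_sum[OF ne, of N] False by simp
      qed
      finally show ?thesis .
    qed
    have "(\<Sum>k<N. of_int (F k) * \<zeta> ^ k) =
          (\<Sum>k<N. \<Sum>\<omega>\<in>U. rat_eval \<omega> f * (\<omega> ^ ((N - 1) * k) * \<zeta> ^ k) / of_nat N)"
      by (simp flip: F add: G_def sum_distrib_right sum_divide_distrib mult.assoc)
    also have "\<dots> = (\<Sum>\<omega>\<in>U. rat_eval \<omega> f * (\<Sum>k<N. \<omega> ^ ((N - 1) * k) * \<zeta> ^ k) / of_nat N)"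
      by (subst sum.swap) (simp add: sum_distrib_left sum_divide_distrib)
    also have "\<dots> = (\<Sum>\<omega>\<in>U. if \<omega> = \<zeta> then rat_eval \<omega> f else 0)"
      by (intro sum.cong refl) (use N inner in auto)
    also have "\<dots> = rat_eval \<zeta> f" using fin zU by simp
    finally show ?thesis by simp
  qed
  ultimately show ?thesis using that by blast
qed

text \<open>Multiplying by the cofactor \<open>\<nu>\<close> of the minimal polynomial in \<open>X\<^sup>N - 1\<close> kills all values at
  the roots of unity that are not conjugate to \<open>\<zeta>\<close>.\<close>

lemma finite_bounded_conjugates:
  assumes \<zeta>: "\<zeta> ^ N = 1" and N: "N > 0"
  shows "finite {z. \<exists>p. z = rat_eval \<zeta> p \<and> int_coeffs p \<and>
                        (\<forall>\<omega>\<in>rat_conjugates \<zeta>. norm (rat_eval \<omega> p) \<le> C)}" (is "finite ?S")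
proof -
  obtain \<mu> where \<mu>: "\<mu> \<noteq> 0" "\<And>q. rat_eval \<zeta> q = 0 \<longleftrightarrow> \<mu> dvd q"
    using minimal_polynomial[OF root_unity_poly[OF \<zeta> N]] by blast
  have "\<mu> dvd monom 1 N - 1" using \<mu>(2) root_unity_poly(2)[OF \<zeta> N] by blast
  then obtain \<nu>\<^sub>0 where \<nu>\<^sub>0: "monom 1 N - 1 = \<mu> * \<nu>\<^sub>0" by blast
  obtain E :: int where E: "E > 0" "int_coeffs (smult (of_int E) \<nu>\<^sub>0)"
    using clear_denominators by blast
  define \<nu> where "\<nu> = smult (of_int E) \<nu>\<^sub>0"
  \<comment> \<open>Separability of X^N - 1: a zero of the cofactor at \<zeta> would make the square
    of \<mu> a divisor, and the derivative N X^(N-1) would vanish at \<zeta>.\<close>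
  have nz: "rat_eval \<zeta> \<nu> \<noteq> 0"
  proof
    assume "rat_eval \<zeta> \<nu> = 0"
    then have "\<mu> dvd \<nu>\<^sub>0" using E(1) \<mu>(2) by (simp add: \<nu>_def)
    then obtain \<kappa> where "\<nu>\<^sub>0 = \<mu> * \<kappa>" by blast
    then have e: "monom 1 N - 1 = \<mu> * (\<mu> * \<kappa>)" using \<nu>\<^sub>0 by simp
    have "pderiv (monom 1 N - 1 :: rat poly) = \<mu> * (pderiv (\<mu> * \<kappa>) + pderiv \<mu> * \<kappa>)"
      unfolding e by (simp add: pderiv_mult algebra_simps)
    then have "rat_eval \<zeta> (pderiv (monom 1 N - 1)) = 0" using \<mu>(2)[of \<mu>] by simp
    then have "of_nat N * \<zeta> ^ (N - 1) = 0" by (simp add: pderiv_diff pderiv_monom pderiv_1)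
    moreover have "\<zeta> \<noteq> 0" using \<zeta> N by (auto simp: power_0_left)
    ultimately show False using N by simp
  qed
  have conj: "rat_eval \<omega> \<nu> = 0 \<or> \<omega> \<in> rat_conjugates \<zeta>" if "\<omega> ^ N = 1" for \<omega>
  proof -
    have "rat_eval \<omega> (\<mu> * \<nu>\<^sub>0) = 0" using that unfolding \<nu>\<^sub>0[symmetric] by simp
    then have "rat_eval \<omega> \<mu> = 0 \<or> rat_eval \<omega> \<nu> = 0" by (auto simp: \<nu>_def)
    moreover have "\<omega> \<in> rat_conjugates \<zeta>" if "rat_eval \<omega> \<mu> = 0"
      unfolding rat_conjugates_def using \<mu>(2) that by (auto elim!: dvdE)
    ultimately show ?thesis by blast
  qed
  have finU: "finite {\<omega>::complex. \<omega> ^ N = 1}" using N by (intro finite_roots_unity) simp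
  \<comment> \<open>\<open>M\<close> bounds the cofactor at every \<open>N\<close>-th root of unity,
    hence \<open>\<bar>C\<bar> * M\<close> bounds the product with \<open>p\<close> there. Its
    rounding \<open>K\<close> leaves finitely many integer coefficient vectors.\<close>
  define M where "M = (\<Sum>\<omega> | \<omega> ^ N = (1::complex). norm (rat_eval \<omega> \<nu>))"
  define K where "K = \<lceil>\<bar>C\<bar> * M\<rceil>"
  define T where "T = (\<lambda>F. (\<Sum>k<N. of_int (F k) * \<zeta> ^ k) / rat_eval \<zeta> \<nu>) ` (PiE {..<N} (\<lambda>_. {-K..K}))"
  have "finite T" unfolding T_def by (intro finite_imageI finite_PiE) auto
  moreover have "?S \<subseteq> T"
  proof
    fix z assume "z \<in> ?S"
    then obtain p where p: "z = rat_eval \<zeta> p" "int_coeffs p"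
      "\<And>\<omega>. \<omega> \<in> rat_conjugates \<zeta> \<Longrightarrow> norm (rat_eval \<omega> p) \<le> C" by blast
    have i: "int_coeffs (p * \<nu>)" using int_coeffs_mult[OF p(2) E(2)] by (simp only: \<nu>_def)
    have b: "norm (rat_eval \<omega> (p * \<nu>)) \<le> \<bar>C\<bar> * M" if w: "\<omega> ^ N = 1" for \<omega>
    proof (cases "rat_eval \<omega> \<nu> = 0")
      case True
      then show ?thesis by (simp add: M_def sum_nonneg)
    next
      case False
      then have "norm (rat_eval \<omega> p) \<le> \<bar>C\<bar>" using conj[OF w] p(3)[of \<omega>] by auto
      moreover have "norm (rat_eval \<omega> \<nu>) \<le> M"
        unfolding M_def by (rule member_le_sum) (use w finU in auto)
      ultimately show ?thesis by (simp add: norm_mult mult_mono)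
    qed
    obtain F where F: "rat_eval \<zeta> (p * \<nu>) = (\<Sum>k<N. of_int (F k) * \<zeta> ^ k)"
      "\<And>k. \<bar>of_int (F k)\<bar> \<le> \<bar>C\<bar> * M"
      using fourier_coefficients[OF N i \<zeta> b] by metis
    have "F k \<in> {-K..K}" for k
    proof -
      have "of_int \<bar>F k\<bar> \<le> \<bar>C\<bar> * M" using F(2) by simp
      then have "\<bar>F k\<bar> \<le> K" unfolding K_def by linarith
      then show ?thesis by auto
    qed
    then have "restrict F {..<N} \<in> PiE {..<N} (\<lambda>_. {-K..K})" by auto
    moreover have "z = (\<Sum>k<N. of_int (restrict F {..<N} k) * \<zeta> ^ k) / rat_eval \<zeta> \<nu>"
      using F(1) nz p(1) by (simp add: field_simps)
    ultimately show "z \<in> T" unfolding T_def by blast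
  qed
  ultimately show ?thesis using finite_subset by blast
qed


section \<open>Two by two matrices and traces\<close>

definition mat22 :: "complex \<Rightarrow> complex \<Rightarrow> complex \<Rightarrow> complex \<Rightarrow> mat2" where
  "mat22 a b c d = vector [vector [a, b], vector [c, d]]"

lemma mat22_nth [simp]:
  "mat22 a b c d $ 1 $ 1 = a" "mat22 a b c d $ 1 $ 2 = b"
  "mat22 a b c d $ 2 $ 1 = c" "mat22 a b c d $ 2 $ 2 = d"
  by (simp_all add: mat22_def)

lemma mat2_eq_iff:
  "X = Y \<longleftrightarrow> X$1$1 = Y$1$1 \<and> X$1$2 = Y$1$2 \<and> X$2$1 = Y$2$1 \<and> X$2$2 = (Y::mat2)$2$2"
  by (auto simp: vec_eq_iff forall_2)

lemma mat2_mult_nth: "(X ** Y) $ i $ j = X$i$1 * Y$1$j + X$i$2 * (Y::mat2)$2$j"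
  by (simp add: matrix_matrix_mult_def sum_2)

lemma mat2_mat_nth [simp]:
  "(mat c :: mat2)$1$1 = c" "(mat c :: mat2)$1$2 = 0" "(mat c :: mat2)$2$1 = 0" "(mat c :: mat2)$2$2 = c"
  by (simp_all add: mat_def)

lemma trace_mat2: "trace (X::mat2) = X$1$1 + X$2$2"
  by (simp add: trace_def sum_2)

lemmas mat2_simps = mat2_eq_iff mat2_mult_nth trace_mat2 det_2

lemma trace_mult_commute: "trace (X ** Y) = trace (Y ** (X::mat2))"
  by (simp add: mat2_simps)

lemma SL2_sel [simp]:
  "\<one>\<^bsub>SL2\<^esub> = mat 1" "X \<otimes>\<^bsub>SL2\<^esub> Y = X ** Y" "X \<in> carrier SL2 \<longleftrightarrow> det X = 1"
  by (simp_all add: SL2_def)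

lemma SL2_inv:
  assumes "det X = 1"
  shows "inv\<^bsub>SL2\<^esub> X = mat22 (X$2$2) (- X$1$2) (- X$2$1) (X$1$1)"
proof -
  interpret group SL2 by (rule group_SL2)
  show ?thesis
    by (rule inv_equality) (use assms in \<open>simp_all add: mat2_simps algebra_simps\<close>)
qed

lemma SL2_cancel:
  fixes X Y :: mat2
  assumes "det X = 1"
  shows "inv\<^bsub>SL2\<^esub> X ** X = mat 1" "X ** inv\<^bsub>SL2\<^esub> X = mat 1"
    "inv\<^bsub>SL2\<^esub> X ** (X ** Y) = Y" "X ** (inv\<^bsub>SL2\<^esub> X ** Y) = Y"
proof -
  interpret group SL2 by (rule group_SL2)
  show 1: "inv\<^bsub>SL2\<^esub> X ** X = mat 1" "X ** inv\<^bsub>SL2\<^esub> X = mat 1"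
    using l_inv[of X] r_inv[of X] assms by simp_all
  then show "inv\<^bsub>SL2\<^esub> X ** (X ** Y) = Y" "X ** (inv\<^bsub>SL2\<^esub> X ** Y) = Y"
    by (simp_all add: matrix_mul_assoc)
qed

lemma SL2_cayley_hamilton: "det (X::mat2) = 1 \<Longrightarrow> X ** X = mat22 (trace X) 0 0 (trace X) ** X - mat 1"
  by (simp add: mat2_simps) (simp add: algebra_simps)

lemma bounded_mat2_iff:
  fixes S :: "mat2 set"
  shows "bounded S \<longleftrightarrow> (\<exists>C. \<forall>X\<in>S. \<forall>i j. norm (X$i$j) \<le> C)"
proof
  assume "bounded S"
  then obtain C where "\<forall>X\<in>S. norm X \<le> C" by (auto simp: bounded_iff)
  then show "\<exists>C. \<forall>X\<in>S. \<forall>i j. norm (X$i$j) \<le> C"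
    by (meson Finite_Cartesian_Product.norm_nth_le order_trans)
next
  assume "\<exists>C. \<forall>X\<in>S. \<forall>i j. norm (X$i$j) \<le> C"
  then obtain C where C: "\<And>X i j. X \<in> S \<Longrightarrow> norm (X$i$j) \<le> C" by blast
  have "norm X \<le> 4 * C" if "X \<in> S" for X
  proof -
    have r: "norm v \<le> norm (v$1) + norm (v$2)" for v :: "'c::real_normed_vector ^ 2"
      unfolding norm_vec_def using L2_set_le_sum[of UNIV "\<lambda>i. norm (v$i)"] by (simp add: sum_2)
    show ?thesis
      using r[of X] r[of "X$1"] r[of "X$2"] C[OF that, of 1 1] C[OF that, of 1 2]
        C[OF that, of 2 1] C[OF that, of 2 2] by linarith
  qed
  then show "bounded S" by (auto simp: bounded_iff)
qed

lemma bounded_SL2_inv_mult: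
  fixes Y :: mat2 and S :: "mat2 set"
  assumes "det Y = 1" "bounded ((\<lambda>X. Y ** X) ` S)"
  shows "bounded S"
proof -
  obtain C where C: "\<And>X i j. X \<in> S \<Longrightarrow> norm ((Y ** X)$i$j) \<le> C"
    using assms(2) unfolding bounded_mat2_iff by blast
  obtain D where D: "\<And>i j. norm ((inv\<^bsub>SL2\<^esub> Y)$i$j) \<le> D"
    using bounded_mat2_iff[of "{inv\<^bsub>SL2\<^esub> Y}"] by auto
  have "norm (X$i$j) \<le> D * C + D * C" if "X \<in> S" for X i j
  proof -
    have "X$i$j = (inv\<^bsub>SL2\<^esub> Y ** (Y ** X))$i$j" unfolding SL2_cancel(3)[OF assms(1)] by (rule refl)
    also have "\<dots> = (inv\<^bsub>SL2\<^esub> Y)$i$1 * (Y ** X)$1$j + (inv\<^bsub>SL2\<^esub> Y)$i$2 * (Y ** X)$2$j"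
      by (rule mat2_mult_nth)
    also have "norm \<dots> \<le> norm ((inv\<^bsub>SL2\<^esub> Y)$i$1) * norm ((Y ** X)$1$j) +
        norm ((inv\<^bsub>SL2\<^esub> Y)$i$2) * norm ((Y ** X)$2$j)"
      by (rule order_trans[OF norm_triangle_ineq]) (simp add: norm_mult)
    also have "\<dots> \<le> D * C + D * C"
      using C[OF that] D order_trans[OF norm_ge_zero D] by (intro add_mono mult_mono) simp_all
    finally show ?thesis .
  qed
  then show ?thesis unfolding bounded_mat2_iff by blast
qed

section \<open>Recovering a matrix from traces\<close>

text \<open>An irreducible pair written in the eigenbasis of \<open>X\<close>: neither of the two
  eigenlines of \<open>X\<close> is invariant under \<open>Y\<close>. Stated by entries, it passes
  directly to Galois conjugates.\<close>

definition normal_pair :: "mat2 \<Rightarrow> mat2 \<Rightarrow> bool" where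
  "normal_pair X Y \<longleftrightarrow> X$1$2 = 0 \<and> X$2$1 = 0 \<and> X$1$1 \<noteq> X$2$2 \<and> Y$1$2 \<noteq> 0 \<and> Y$2$1 \<noteq> 0"

text \<open>Since 1 and \<open>X\<close> span the diagonal matrices, the traces of \<open>W\<close>
  and \<open>X ** W\<close> determine the diagonal of \<open>W\<close>. Used for \<open>Z\<close>
  and for \<open>Y ** Z\<close>, this also gives the off-diagonal entries of \<open>Z\<close>. The
  explicit formulas serve boundedness, finiteness and the field of definition alike.\<close>

lemma normal_pair_reconstruct:
  assumes "normal_pair X Y"
  defines "\<delta> \<equiv> X$1$1 - X$2$2"
  shows "Z$1$1 = (trace (X ** Z) - X$2$2 * trace Z) / \<delta>" (is ?p)
    and "Z$2$2 = (X$1$1 * trace Z - trace (X ** Z)) / \<delta>" (is ?s)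
    and "Z$2$1 = ((trace (X ** (Y ** Z)) - X$2$2 * trace (Y ** Z)) / \<delta> - Y$1$1 * Z$1$1) / Y$1$2" (is ?r)
    and "Z$1$2 = ((X$1$1 * trace (Y ** Z) - trace (X ** (Y ** Z))) / \<delta> - Y$2$2 * Z$2$2) / Y$2$1" (is ?q)
proof -
  have \<delta>: "\<delta> \<noteq> 0" and X: "X$1$2 = 0" "X$2$1 = 0" and Y: "Y$1$2 \<noteq> 0" "Y$2$1 \<noteq> 0"
    using assms by (auto simp: normal_pair_def)
  have ps: "W$1$1 = (trace (X ** W) - X$2$2 * trace W) / \<delta>"
    "W$2$2 = (X$1$1 * trace W - trace (X ** W)) / \<delta>" for W
    using \<delta> by (simp_all add: eq_divide_eq, simp_all add: mat2_simps X \<delta>_def algebra_simps)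
  show ?p ?s by (rule ps)+
  show ?r unfolding ps(1)[of "Y ** Z", symmetric] using Y by (simp add: mat2_simps)
  show ?q unfolding ps(2)[of "Y ** Z", symmetric] using Y by (simp add: mat2_simps)
qed

lemma bounded_by_traces:
  assumes XY: "normal_pair X Y"
    and T: "bounded ((\<lambda>Z. trace Z) ` S)" "bounded ((\<lambda>Z. trace (X ** Z)) ` S)"
      "bounded ((\<lambda>Z. trace (Y ** Z)) ` S)" "bounded ((\<lambda>Z. trace (X ** (Y ** Z))) ` S)"
  shows "bounded S"
proof -
  define \<delta> where "\<delta> = X$1$1 - X$2$2"
  note r = normal_pair_reconstruct[OF XY, folded \<delta>_def]
  have cm: "bounded ((\<lambda>Z. c * f Z) ` S)" if "bounded (f ` S)" for c :: complex and f :: "mat2 \<Rightarrow> complex"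
    using bounded_linear_image[OF that bounded_linear_mult_right[of c]] by (simp add: image_image)
  have cd: "bounded ((\<lambda>Z. f Z / c) ` S)" if "bounded (f ` S)" for c :: complex and f :: "mat2 \<Rightarrow> complex"
    using cm[OF that, of "inverse c"] by (simp add: divide_inverse mult.commute)
  have p: "bounded ((\<lambda>Z. Z$1$1) ` S)" unfolding r(1)
    by (intro cd bounded_minus_comp cm T)
  have s: "bounded ((\<lambda>Z. Z$2$2) ` S)" unfolding r(2)
    by (intro cd bounded_minus_comp cm T)
  have t: "bounded ((\<lambda>Z. Z$2$1) ` S)" unfolding r(3)
    by (intro cd bounded_minus_comp cm T p)
  have q: "bounded ((\<lambda>Z. Z$1$2) ` S)" unfolding r(4)
    by (intro cd bounded_minus_comp cm T s)
  obtain C1 C2 C3 C4 where C: "\<And>Z. Z \<in> S \<Longrightarrow> norm (Z$1$1) \<le> C1" "\<And>Z. Z \<in> S \<Longrightarrow> norm (Z$2$2) \<le> C2"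
     "\<And>Z. Z \<in> S \<Longrightarrow> norm (Z$2$1) \<le> C3" "\<And>Z. Z \<in> S \<Longrightarrow> norm (Z$1$2) \<le> C4"
    using p s t q unfolding bounded_iff by (metis imageI)
  have "\<forall>Z\<in>S. \<forall>i j. norm (Z$i$j) \<le> max (max C1 C2) (max C3 C4)"
    unfolding forall_2 using C by (simp add: le_max_iff_disj)
  then show ?thesis unfolding bounded_mat2_iff by blast
qed

lemma finite_by_traces:
  assumes XY: "normal_pair X Y"
    and T: "finite ((\<lambda>Z. trace Z) ` S)" "finite ((\<lambda>Z. trace (X ** Z)) ` S)"
      "finite ((\<lambda>Z. trace (Y ** Z)) ` S)" "finite ((\<lambda>Z. trace (X ** (Y ** Z))) ` S)"
  shows "finite S"
proof (rule finite_imageD)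
  let ?f = "\<lambda>Z. (trace Z, trace (X ** Z), trace (Y ** Z), trace (X ** (Y ** Z)))"
  have "?f ` S \<subseteq> (\<lambda>Z. trace Z) ` S \<times> (\<lambda>Z. trace (X ** Z)) ` S \<times> (\<lambda>Z. trace (Y ** Z)) ` S \<times>
          (\<lambda>Z. trace (X ** (Y ** Z))) ` S" by auto
  then show "finite (?f ` S)" using T by (meson finite_SigmaI finite_subset)
  show "inj_on ?f S"
  proof (rule inj_onI)
    fix Z W assume f: "?f Z = ?f W"
    show "Z = W"
      using f normal_pair_reconstruct(1,2)[OF XY, of Z] normal_pair_reconstruct(1,2)[OF XY, of W]
        normal_pair_reconstruct(3,4)[OF XY, of Z] normal_pair_reconstruct(3,4)[OF XY, of W]
      unfolding mat2_eq_iff by simp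
  qed
qed

text \<open>These are the traces of the images of the generator \<open>k\<close> under
  transvections. Indexing by generators, not by matrices, keeps generators with equal images
  apart.\<close>

definition tr_set :: "('i \<Rightarrow> mat2) \<Rightarrow> 'i set \<Rightarrow> 'i \<Rightarrow> complex set" where
  "tr_set A B k = {trace (A k ** h) | h. h \<in> generate SL2 (A ` (B - {k}))}"

abbreviation sub_gen :: "('i \<Rightarrow> mat2) \<Rightarrow> 'i set \<Rightarrow> 'i \<Rightarrow> mat2 set" where
  "sub_gen A B k \<equiv> generate SL2 (A ` (B - {k}))"

lemma generate_SL2:
  assumes "\<forall>X\<in>S. det X = 1"
  shows "mat 1 \<in> generate SL2 S"
    and "X \<in> S \<Longrightarrow> X \<in> generate SL2 S"
    and "X \<in> generate SL2 S \<Longrightarrow> Y \<in> generate SL2 S \<Longrightarrow> X ** Y \<in> generate SL2 S"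
    and "X \<in> generate SL2 S \<Longrightarrow> inv\<^bsub>SL2\<^esub> X \<in> generate SL2 S"
    and "X \<in> generate SL2 S \<Longrightarrow> det X = 1"
proof -
  interpret group SL2 by (rule group_SL2)
  have S: "S \<subseteq> carrier SL2" using assms by auto
  show "mat 1 \<in> generate SL2 S" using generate.one[of SL2 S] by simp
  show "X \<in> S \<Longrightarrow> X \<in> generate SL2 S" by (rule generate.incl)
  show "X \<in> generate SL2 S \<Longrightarrow> Y \<in> generate SL2 S \<Longrightarrow> X ** Y \<in> generate SL2 S"
    using generate.eng[of X SL2 S Y] by simp
  show "X \<in> generate SL2 S \<Longrightarrow> inv\<^bsub>SL2\<^esub> X \<in> generate SL2 S"
    by (rule generate_m_inv_closed[OF S])
  show "X \<in> generate SL2 S \<Longrightarrow> det X = 1"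
    using generate_in_carrier[OF S, of X] by simp
qed

text \<open>By cyclicity of the trace, a factor from \<open>sub_gen A B k\<close> in front of
  \<open>A k ** h\<close> can be moved behind it and absorbed into \<open>h\<close>. So all four
  coordinates of the elements of the coset lie in one trace set.\<close>

lemma tr_set_traces:
  assumes A: "\<forall>b\<in>B. det (A b) = 1" and "b1 \<in> B - {k}" "b2 \<in> B - {k}"
  defines "S \<equiv> (\<lambda>h. A k ** h) ` sub_gen A B k"
  shows "(\<lambda>Z. trace Z) ` S \<subseteq> tr_set A B k" "(\<lambda>Z. trace (A b1 ** Z)) ` S \<subseteq> tr_set A B k"
    "(\<lambda>Z. trace (A b2 ** Z)) ` S \<subseteq> tr_set A B k" "(\<lambda>Z. trace (A b1 ** (A b2 ** Z))) ` S \<subseteq> tr_set A B k"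
proof -
  have "\<forall>X\<in>A ` (B - {k}). det X = 1" using A by auto
  note g = generate_SL2[OF this]
  have b: "A b1 \<in> sub_gen A B k" "A b2 \<in> sub_gen A B k" using assms(2,3) by (auto intro!: g(2))
  have m: "trace (g ** (A k ** h)) \<in> tr_set A B k"
    if "g \<in> sub_gen A B k" "h \<in> sub_gen A B k" for g h
  proof -
    have "trace (g ** (A k ** h)) = trace (A k ** (h ** g))"
      by (subst trace_mult_commute) (simp add: matrix_mul_assoc)
    then show ?thesis unfolding tr_set_def using g(3)[OF that(2,1)] by blast
  qed
  show "(\<lambda>Z. trace Z) ` S \<subseteq> tr_set A B k" unfolding S_def tr_set_def by auto
  show "(\<lambda>Z. trace (A b1 ** Z)) ` S \<subseteq> tr_set A B k" unfolding S_def using m b by auto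
  show "(\<lambda>Z. trace (A b2 ** Z)) ` S \<subseteq> tr_set A B k" unfolding S_def using m b by auto
  show "(\<lambda>Z. trace (A b1 ** (A b2 ** Z))) ` S \<subseteq> tr_set A B k"
    unfolding S_def using m[OF g(3)[OF b]] by (auto simp: matrix_mul_assoc)
qed

text \<open>The traces control the coset of \<open>A k\<close>; translating back by
  \<open>A k\<close> controls the group itself.\<close>

lemma bounded_sub_gen:
  assumes A: "\<forall>b\<in>B. det (A b) = 1" and "b1 \<in> B - {k}" "b2 \<in> B - {k}" "k \<in> B"
    and "normal_pair (A b1) (A b2)" and b: "bounded (tr_set A B k)"
  shows "bounded (sub_gen A B k)"
proof (rule bounded_SL2_inv_mult)
  show "det (A k) = 1" using A assms(4) by blast
  note t = tr_set_traces[of B A b1 k b2, OF A assms(2,3)]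
  show "bounded ((\<lambda>h. A k ** h) ` sub_gen A B k)"
    by (rule bounded_by_traces[OF assms(5)]; rule bounded_subset[OF b]; rule t)
qed

lemma finite_sub_gen:
  assumes A: "\<forall>b\<in>B. det (A b) = 1" and "b1 \<in> B - {k}" "b2 \<in> B - {k}" "k \<in> B"
    and "normal_pair (A b1) (A b2)" and b: "finite (tr_set A B k)"
  shows "finite (sub_gen A B k)"
proof (rule finite_imageD)
  have k: "det (A k) = 1" using A assms(4) by blast
  note t = tr_set_traces[of B A b1 k b2, OF A assms(2,3)]
  show "finite ((\<lambda>h. A k ** h) ` sub_gen A B k)"
    by (rule finite_by_traces[OF assms(5)]; rule finite_subset[OF _ b]; rule t)
  show "inj_on (\<lambda>h. A k ** h) (sub_gen A B k)"
    by (rule inj_onI) (metis SL2_cancel(3)[OF k])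
qed

section \<open>Eigenvalues in bounded groups\<close>

lemma ex_trace_root: "\<exists>z. z \<noteq> 0 \<and> t = z + 1 / (z::complex)"
proof -
  define z where "z = (t + csqrt (t\<^sup>2 - 4)) / 2"
  have "2 * z - t = csqrt (t\<^sup>2 - 4)" by (simp add: z_def field_simps)
  then have "(2 * z - t)\<^sup>2 = t\<^sup>2 - 4" by simp
  then have "4 * (z * (t - z)) = 4 * 1" by (simp add: power2_eq_square algebra_simps)
  then have e: "z * (t - z) = 1" by (simp only: mult_cancel_left) simp
  then have "z \<noteq> 0" by auto
  with e show ?thesis by (intro exI[of _ z]) (simp add: field_simps)
qed

text \<open>By Cayley-Hamilton both sides satisfy the recursion t(n+2) = (z + 1/z) t(n+1) -
  t(n).\<close>

lemma trace_SL2_pow: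
  assumes "det h = 1" "trace h = z + 1 / z" "z \<noteq> 0"
  shows "trace (h [^]\<^bsub>SL2\<^esub> (n::nat)) = z ^ n + 1 / z ^ n"
proof (induction n rule: induct_nat_012)
  case 0
  then show ?case by (simp add: trace_mat2)
next
  case 1
  then show ?case using assms by simp
next
  case (ge2 n)
  let ?P = "h [^]\<^bsub>SL2\<^esub> n"
  have "trace (h [^]\<^bsub>SL2\<^esub> Suc (Suc n)) = trace (?P ** (h ** h))"
    by (simp add: matrix_mul_assoc)
  also have "\<dots> = trace h * trace (?P ** h) - trace ?P"
    unfolding SL2_cayley_hamilton[OF assms(1)] by (simp add: mat2_simps algebra_simps)
  also have "trace (?P ** h) = trace (h [^]\<^bsub>SL2\<^esub> Suc n)" by simp
  also have "\<dots> = z ^ Suc n + 1 / z ^ Suc n" by (rule ge2)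
  finally have "trace (h [^]\<^bsub>SL2\<^esub> Suc (Suc n)) =
      (z + 1 / z) * (z ^ Suc n + 1 / z ^ Suc n) - (z ^ n + 1 / z ^ n)"
    using ge2(1) assms(2) by simp
  also have "\<dots> = z ^ Suc (Suc n) + 1 / z ^ Suc (Suc n)"
    using assms(3) by (simp add: field_simps)
  finally show ?case .
qed

text \<open>If |z| > 1 then z^n grows without bound while its inverse stays below 1. The hypothesis
  is symmetric in z and 1/z, which excludes |z| < 1 as well.\<close>

lemma unimodular_of_bounded_powers:
  assumes "\<And>n. norm (z ^ n + 1 / z ^ n) \<le> C" "z \<noteq> (0::complex)"
  shows "norm z = 1"
proof -
  have main: "norm z \<le> 1" if C: "\<And>n. norm (z ^ n + 1 / z ^ n) \<le> C" "z \<noteq> 0" for z :: complex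
  proof (rule ccontr)
    assume "\<not> norm z \<le> 1"
    then have z: "norm z > 1" by simp
    then obtain n where n: "C + 1 < norm z ^ n" using real_arch_pow by blast
    have "1 \<le> norm (z ^ n)" using z by (simp add: norm_power one_le_power)
    then have "norm (1 / z ^ n) \<le> 1"
      using le_imp_inverse_le[of 1 "norm (z ^ n)"] by (simp add: norm_divide inverse_eq_divide)
    then have "norm (z ^ n) \<le> norm (z ^ n + 1 / z ^ n) + 1"
      using norm_triangle_ineq4[of "z ^ n + 1 / z ^ n" "1 / z ^ n"] by simp
    then show False using C(1)[of n] n by (simp add: norm_power)
  qed
  have "norm z \<le> 1" using main assms by blast
  moreover have "norm (1 / z) \<le> 1"
    by (rule main[of "1 / z"]) (use assms in \<open>auto simp: power_divide add.commute\<close>)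
  ultimately show ?thesis using assms(2) by (simp add: norm_divide)
qed

lemma generate_SL2_pow:
  assumes "\<forall>X\<in>S. det X = 1" "h \<in> generate SL2 S"
  shows "h [^]\<^bsub>SL2\<^esub> (n::nat) \<in> generate SL2 S"
  by (induction n) (use generate_SL2[OF assms(1)] assms(2) in auto)

lemma bounded_trace: "bounded S \<Longrightarrow> bounded (trace ` (S :: mat2 set))"
proof -
  assume "bounded S"
  then obtain C where C: "\<And>X i j. X \<in> S \<Longrightarrow> norm (X$i$j) \<le> C" unfolding bounded_mat2_iff by blast
  have "norm (trace X) \<le> C + C" if "X \<in> S" for X
    unfolding trace_mat2 by (rule order_trans[OF norm_triangle_ineq add_mono]) (use C that in auto)
  then show ?thesis by (auto simp: bounded_iff)
qed

lemma unimodular_eigenvalue: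
  assumes S: "\<forall>X\<in>S. det X = 1" and b: "bounded (generate SL2 S)" and h: "h \<in> generate SL2 S"
    and z: "trace h = z + 1 / z" "z \<noteq> 0"
  shows "norm z = 1"
proof -
  obtain C where C: "\<And>X. X \<in> generate SL2 S \<Longrightarrow> norm (trace X) \<le> C"
    using bounded_trace[OF b] by (auto simp: bounded_iff)
  have "norm (z ^ n + 1 / z ^ n) \<le> C" for n
    using C[OF generate_SL2_pow[OF S h, of n]] trace_SL2_pow[OF generate_SL2(5)[OF S h] z] by simp
  then show ?thesis using unimodular_of_bounded_powers z(2) by blast
qed

lemma bounded_group_trace:
  assumes S: "\<forall>X\<in>S. det X = 1" and b: "bounded (generate SL2 S)" and h: "h \<in> generate SL2 S"
  shows "Im (trace h) = 0" "Re (trace h) \<le> 2"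
proof -
  obtain z where z: "z \<noteq> 0" "trace h = z + 1 / z" using ex_trace_root by blast
  have n: "norm z = 1" by (rule unimodular_eigenvalue[OF S b h z(2,1)])
  then have "1 / z = cnj z" using complex_norm_square[of z] z(1) by (simp add: field_simps)
  then have t: "trace h = of_real (2 * Re z)" using z(2) by (simp add: complex_add_cnj)
  show "Im (trace h) = 0" unfolding t by simp
  show "Re (trace h) \<le> 2" unfolding t using complex_Re_le_cmod[of z] n by simp
qed


section \<open>Bounded trace sets\<close>

text \<open>For \<open>\<kappa> = 1\<close> this is \<open>SU\<^sub>2\<close>; for \<open>\<kappa> > 0\<close> it is the unitary group of a diagonal Hermitian form.\<close>

definition twisted_SU2 :: "real \<Rightarrow> mat2 set" where
  "twisted_SU2 \<kappa> = {X. det X = 1 \<and> X$2$2 = cnj (X$1$1) \<and> X$2$1 = - of_real \<kappa> * cnj (X$1$2)}"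

text \<open>The determinant condition reads |X11|^2 + \<kappa> |X12|^2 = 1.\<close>

lemma bounded_twisted_SU2:
  assumes "\<kappa> > 0"
  shows "bounded (twisted_SU2 \<kappa>)"
proof -
  have "norm (X$i$j) \<le> 1 + 1 / \<kappa> + \<kappa> * (1 + 1 / \<kappa>)" if X: "X \<in> twisted_SU2 \<kappa>" for X i j
  proof -
    have "det X = 1" "X$2$2 = cnj (X$1$1)" "X$2$1 = - of_real \<kappa> * cnj (X$1$2)"
      using X by (auto simp: twisted_SU2_def)
    then have "X$1$1 * cnj (X$1$1) + of_real \<kappa> * (X$1$2 * cnj (X$1$2)) = 1"
      by (simp add: det_2 mult_ac)
    then have "complex_of_real ((norm (X$1$1))\<^sup>2 + \<kappa> * (norm (X$1$2))\<^sup>2) = of_real 1"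
      by (simp only: complex_norm_square[symmetric] of_real_add of_real_mult of_real_1)
    then have e: "(norm (X$1$1))\<^sup>2 + \<kappa> * (norm (X$1$2))\<^sup>2 = 1" by (simp only: of_real_eq_iff)
    moreover have "\<kappa> * (norm (X$1$2))\<^sup>2 \<ge> 0" using assms by simp
    ultimately have "(norm (X$1$1))\<^sup>2 \<le> 1" by linarith
    then have p: "norm (X$1$1) \<le> 1" using power2_le_imp_le[of "norm (X$1$1)" 1] by simp
    have "\<kappa> * (norm (X$1$2))\<^sup>2 \<le> 1" using e zero_le_power2[of "norm (X$1$1)"] by linarith
    then have "(norm (X$1$2))\<^sup>2 \<le> 1 / \<kappa>" using assms by (simp add: field_simps)
    \<comment> \<open>This replaces the square root of 1/\<kappa> by the cruder bound 1 +
      1/\<kappa>.\<close>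
    moreover have "y \<le> (1 + y)\<^sup>2" if "y \<ge> 0" for y :: real
      using that zero_le_power2[of y] by (simp add: power2_eq_square algebra_simps)
    then have "1 / \<kappa> \<le> (1 + 1 / \<kappa>)\<^sup>2" using assms by simp
    ultimately have "(norm (X$1$2))\<^sup>2 \<le> (1 + 1 / \<kappa>)\<^sup>2" by linarith
    then have q: "norm (X$1$2) \<le> 1 + 1 / \<kappa>"
      by (rule power2_le_imp_le) (use assms in simp)
    have "norm (X$2$1) = \<kappa> * norm (X$1$2)"
      using \<open>X$2$1 = _\<close> assms by (simp add: norm_mult)
    then have r: "norm (X$2$1) \<le> \<kappa> * (1 + 1 / \<kappa>)" using q assms by simp
    have "norm (X$2$2) = norm (X$1$1)" using \<open>X$2$2 = _\<close> by simp
    moreover have "0 \<le> 1 / \<kappa>" "0 \<le> \<kappa> * (1 + 1 / \<kappa>)" using assms by simp_all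
    ultimately have "\<forall>i j. norm (X$i$j) \<le> 1 + 1 / \<kappa> + \<kappa> * (1 + 1 / \<kappa>)"
      unfolding forall_2 using p q r by linarith
    then show ?thesis by blast
  qed
  then show ?thesis unfolding bounded_mat2_iff by blast
qed

lemma generate_twisted_SU2:
  assumes "S \<subseteq> twisted_SU2 \<kappa>"
  shows "generate SL2 S \<subseteq> twisted_SU2 \<kappa>"
proof
  fix X assume "X \<in> generate SL2 S"
  then show "X \<in> twisted_SU2 \<kappa>"
  proof (induction rule: generate.induct)
    case one
    then show ?case by (simp add: twisted_SU2_def det_2)
  next
    case (incl h)
    then show ?case using assms by blast
  next
    case (inv h)
    then have "h \<in> twisted_SU2 \<kappa>" using assms by blast
    then show ?case unfolding twisted_SU2_def
      by (simp add: SL2_inv) (auto simp: det_2 mult_ac)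
  next
    case (eng h1 h2)
    then show ?case unfolding twisted_SU2_def
      by (simp add: det_mul) (simp add: mat2_mult_nth algebra_simps)
  qed
qed

text \<open>The two hypotheses are the reality of the traces against 1 and against diag(l, cnj l);
  they are independent because \<open>l\<close> is not real.\<close>

lemma cnj_entries:
  assumes "Im (p + s) = 0" "Im (l * p + cnj l * s) = 0" "Im l \<noteq> 0"
  shows "s = cnj p"
proof -
  have 1: "Im s = - Im p" using assms(1) by simp
  then have "Im l * (Re p - Re s) = 0" using assms(2) by (simp add: algebra_simps)
  then have "Re s = Re p" using assms(3) by simp
  then show ?thesis using 1 by (simp add: complex_eq_iff)
qed

text \<open>Distinct unimodular eigenvalues have orthogonal eigenlines, so in the eigenbasis of
  \<open>A b1\<close> an invariant Hermitian form is diagonal and, up to scale, depends on one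
  parameter \<kappa>, which \<open>A b2\<close> determines. The hypothesis \<open>fresh\<close>
  provides for every \<open>x\<close> an index \<open>k\<close> different from \<open>b1\<close>,
  \<open>b2\<close> and \<open>x\<close>, so that \<open>A x\<close>, \<open>A b1\<close> and
  \<open>A b2\<close> lie together in one bounded group.\<close>

lemma bounded_core:
  assumes fresh: "\<And>x y z. \<exists>k\<in>B. k \<notin> {x, y, z}" and A: "\<forall>b\<in>B. det (A b) = 1"
    and b: "b1 \<in> B" "b2 \<in> B" and np: "normal_pair (A b1) (A b2)"
    and bd: "\<forall>k\<in>B - {b1, b2}. bounded (tr_set A B k)"
  shows "bounded (generate SL2 (A ` B))"
proof -
  define l where "l = A b1 $ 1 $ 1"
  have A1: "A b1 $ 1 $ 2 = 0" "A b1 $ 2 $ 1 = 0" "A b1 $ 1 $ 1 \<noteq> A b1 $ 2 $ 2" "A b2 $ 1 $ 2 \<noteq> 0" "A b2 $ 2 $ 1 \<noteq> 0"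
    using np by (auto simp: normal_pair_def)
  have det1: "l * A b1 $ 2 $ 2 = 1" using bspec[OF A b(1)] A1 by (simp add: l_def det_2)
  then have l0: "l \<noteq> 0" by auto
  have sub: "\<forall>X\<in>A ` (B - {k}). det X = 1" for k using A by auto
  have fam: "\<exists>k\<in>B - {b1, b2}. x \<noteq> k" for x
    using fresh[of b1 b2 x] by auto
  have inb: "bounded (sub_gen A B k)" if "k \<in> B - {b1, b2}" for k
    by (rule bounded_sub_gen[OF A _ _ _ np]) (use that b bd in auto)
  have gen: "A x \<in> sub_gen A B k" if "x \<in> B" "x \<noteq> k" for x k
    by (rule generate_SL2(2)[OF sub]) (use that in auto)
  have real: "Im (trace h) = 0" "Re (trace h) \<le> 2" if "h \<in> sub_gen A B k" "k \<in> B - {b1, b2}" for h k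
    using bounded_group_trace[OF sub inb[OF that(2)] that(1)] by auto
  obtain k0 where k0: "k0 \<in> B - {b1, b2}" using fam by blast
  have g12: "A b1 \<in> sub_gen A B k0" "A b2 \<in> sub_gen A B k0" using gen b k0 by auto
  have tr1: "trace (A b1) = l + 1 / l"
    using det1 l0 by (simp add: trace_mat2 l_def[symmetric] field_simps)
  have nl: "norm l = 1" by (rule unimodular_eigenvalue[OF sub inb[OF k0] g12(1) tr1 l0])
  have l2: "A b1 $ 2 $ 2 = cnj l"
    using det1 complex_norm_square[of l] nl l0 by (simp add: mult_left_cancel[OF l0, of "A b1 $ 2 $ 2", symmetric])
  have Iml: "Im l \<noteq> 0"
    using A1(3) l2 by (auto simp: l_def[symmetric] complex_eq_iff)
  have trX: "trace (A b1 ** X) = l * X$1$1 + cnj l * X$2$2" for X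
    by (simp add: mat2_simps A1 l2 l_def)
  define a bb c d where "a = A b2 $ 1 $ 1" and "bb = A b2 $ 1 $ 2" and "c = A b2 $ 2 $ 1" and "d = A b2 $ 2 $ 2"
  have nz: "bb \<noteq> 0" "c \<noteq> 0" using A1 by (auto simp: bb_def c_def)
  have det2: "a * d - bb * c = 1" using bspec[OF A b(2)] by (simp add: det_2 a_def bb_def c_def d_def)
  have da: "d = cnj a"
  proof (rule cnj_entries[of a d l])
    show "Im (a + d) = 0" using real(1)[OF g12(2) k0] by (simp add: trace_mat2 a_def d_def)
    show "Im (l * a + cnj l * d) = 0"
      using real(1)[OF generate_SL2(3)[OF sub g12] k0] unfolding trX by (simp add: a_def d_def)
  qed (rule Iml)
  \<comment> \<open>The trace of the commutator forces the Hermitian form to be definite.\<close>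
  define K where "K = A b1 ** A b2 ** inv\<^bsub>SL2\<^esub> (A b1) ** inv\<^bsub>SL2\<^esub> (A b2)"
  have "K \<in> sub_gen A B k0" unfolding K_def using g12 by (intro generate_SL2(3,4)[OF sub])
  then have "Re (trace K) \<le> 2" using real(2) k0 by blast
  moreover have "trace K = 2 - bb * c * (l - cnj l)\<^sup>2"
  proof -
    have "l * cnj l = 1" using det1 l2 by simp
    then have "trace K = 2 * (a * d) - bb * c * (l * l + cnj l * cnj l)"
      using A b unfolding K_def
      by (simp add: SL2_inv) (simp add: mat2_simps A1 l2 l_def[symmetric] a_def[symmetric] bb_def[symmetric]
          c_def[symmetric] d_def[symmetric] algebra_simps)
    also have "\<dots> = 2 - bb * c * (l * l + cnj l * cnj l - 2 * (l * cnj l))"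
      using det2 \<open>l * cnj l = 1\<close> by (simp add: algebra_simps)
    finally show ?thesis by (simp add: power2_eq_square algebra_simps)
  qed
  moreover have "(l - cnj l)\<^sup>2 = - of_real (4 * (Im l)\<^sup>2)"
    by (simp add: complex_eq_iff power2_eq_square)
  moreover have bc: "bb * c = of_real ((norm a)\<^sup>2 - 1)"
    using det2 complex_norm_square[of a] by (simp add: da algebra_simps)
  \<comment> \<open>The commutator trace equals 2 + 4 (Im l)^2 (|a|^2 - 1), so the bound 2 gives |a|
    \<le> 1. Equality is excluded because \<open>bb\<close> and \<open>c\<close> are
    nonzero.\<close>
  ultimately have "((norm a)\<^sup>2 - 1) * (4 * (Im l)\<^sup>2) \<le> 0"
    by (simp flip: of_real_mult of_real_power)
  then have "(norm a)\<^sup>2 - 1 \<le> 0" using Iml by (simp add: mult_le_0_iff)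
  moreover have "(norm a)\<^sup>2 - 1 \<noteq> 0" using bc nz by (metis mult_eq_0_iff of_real_0)
  ultimately have neg: "(norm a)\<^sup>2 - 1 < 0" by simp
  \<comment> \<open>The only value compatible with c = -\<kappa> cnj bb, given that bb c = |a|^2 -
    1.\<close>
  define \<kappa> where "\<kappa> = (1 - (norm a)\<^sup>2) / (norm bb)\<^sup>2"
  have \<kappa>: "\<kappa> > 0" using neg nz by (simp add: \<kappa>_def)
  have cb: "c = - of_real \<kappa> * cnj bb"
  proof -
    have "bb * (- of_real \<kappa> * cnj bb) = - of_real (\<kappa> * (norm bb)\<^sup>2)"
      using complex_norm_square[of bb] by simp
    also have "\<kappa> * (norm bb)\<^sup>2 = 1 - (norm a)\<^sup>2" using nz by (simp add: \<kappa>_def)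
    also have "- of_real (1 - (norm a)\<^sup>2) = bb * c" unfolding bc by simp
    finally show ?thesis using nz(1) by (simp only: mult_cancel_left) simp
  qed
  have "A x \<in> twisted_SU2 \<kappa>" if x: "x \<in> B" for x
  proof -
    obtain k where k: "k \<in> B - {b1, b2}" "x \<noteq> k" using fam by blast
    have g: "A x \<in> sub_gen A B k" "A b1 \<in> sub_gen A B k" "A b2 \<in> sub_gen A B k"
      using gen x k b by auto
    have s: "A x $ 2 $ 2 = cnj (A x $ 1 $ 1)"
    proof (rule cnj_entries[of _ _ l])
      show "Im (A x $ 1 $ 1 + A x $ 2 $ 2) = 0" using real(1)[OF g(1) k(1)] by (simp add: trace_mat2)
      show "Im (l * A x $ 1 $ 1 + cnj l * A x $ 2 $ 2) = 0"
        using real(1)[OF generate_SL2(3)[OF sub g(2,1)] k(1)] unfolding trX .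
    qed (rule Iml)
    \<comment> \<open>The diagonal of this product sees the off-diagonal entries of
      \<open>A x\<close>: once the known diagonal terms cancel, there remains a linear relation
      between one of them and the conjugate of the other.\<close>
    let ?Y = "A b2 ** A x"
    have Y: "?Y \<in> sub_gen A B k" by (rule generate_SL2(3)[OF sub g(3,1)])
    have "?Y $ 2 $ 2 = cnj (?Y $ 1 $ 1)"
    proof (rule cnj_entries[of _ _ l])
      show "Im (?Y $ 1 $ 1 + ?Y $ 2 $ 2) = 0" using real(1)[OF Y k(1)] by (simp add: trace_mat2)
      show "Im (l * ?Y $ 1 $ 1 + cnj l * ?Y $ 2 $ 2) = 0"
        using real(1)[OF generate_SL2(3)[OF sub g(2) Y] k(1)] unfolding trX .
    qed (rule Iml)
    then have "c * A x $ 1 $ 2 = cnj bb * cnj (A x $ 2 $ 1)"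
      using s da by (simp add: mat2_mult_nth a_def[symmetric] bb_def[symmetric] c_def[symmetric] d_def[symmetric])
    then have "cnj bb * cnj (A x $ 2 $ 1) = cnj bb * (- of_real \<kappa> * A x $ 1 $ 2)"
      by (simp add: cb mult_ac)
    then have "cnj (A x $ 2 $ 1) = - of_real \<kappa> * A x $ 1 $ 2"
      using nz(1) by (simp only: mult_cancel_left complex_cnj_zero_iff) simp
    then have "A x $ 2 $ 1 = - of_real \<kappa> * cnj (A x $ 1 $ 2)"
      by (metis complex_cnj_cnj complex_cnj_complex_of_real complex_cnj_minus complex_cnj_mult)
    then show ?thesis using s A x by (simp add: twisted_SU2_def)
  qed
  then have "A ` B \<subseteq> twisted_SU2 \<kappa>" by (rule image_subsetI)
  then show ?thesis
    by (intro bounded_subset[OF bounded_twisted_SU2[OF \<kappa>]] generate_twisted_SU2)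
qed


section \<open>Integrality and conjugate groups\<close>

text \<open>The span is given by closure rules instead of explicit sums, so that products and
  denominators can be treated by rule induction. Scalars act as scalar matrices.\<close>

inductive_set mat_span :: "complex set \<Rightarrow> mat2 set \<Rightarrow> mat2 set" for R W where
  base: "X \<in> W \<Longrightarrow> X \<in> mat_span R W"
| add: "X \<in> mat_span R W \<Longrightarrow> Y \<in> mat_span R W \<Longrightarrow> X + Y \<in> mat_span R W"
| scale: "r \<in> R \<Longrightarrow> X \<in> mat_span R W \<Longrightarrow> mat r ** X \<in> mat_span R W"

definition word_prod :: "('i \<Rightarrow> mat2) \<Rightarrow> 'i list \<Rightarrow> mat2" where
  "word_prod A l = foldr (\<lambda>b X. A b ** X) l (mat 1)"

lemma word_prod_simps [simp]:
  "word_prod A [] = mat 1" "word_prod A (x # l) = A x ** word_prod A l"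
  by (simp_all add: word_prod_def)

lemma word_prod_append: "word_prod A (l @ l') = word_prod A l ** word_prod A l'"
  by (induction l) (simp_all add: matrix_mul_assoc)

lemma mat2_add_rdistrib:
  fixes X Y Z :: mat2
  shows "(X + Y) ** Z = X ** Z + Y ** Z"
  by (simp add: mat2_simps algebra_simps)

text \<open>The polarised Cayley-Hamilton identity for X Y + Y X, placed between \<open>U\<close>
  and \<open>W\<close> so that it applies in the middle of a word.\<close>

lemma mat2_swap_identity:
  fixes U W X Y :: mat2
  shows "U ** (X ** (Y ** W)) = mat (trace X) ** (U ** (Y ** W)) +
    (mat (trace Y) ** (U ** (X ** W)) + (mat (trace (X ** Y) - trace X * trace Y) ** (U ** W) +
     mat (- 1) ** (U ** (Y ** (X ** W)))))"
proof -
  have "X ** Y = mat (trace X) ** Y + (mat (trace Y) ** X +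
      (mat (trace (X ** Y) - trace X * trace Y) + mat (- 1) ** (Y ** X)))"
    by (simp add: mat2_simps) (simp add: algebra_simps)
  moreover have c: "U ** (mat r ** Z) = mat r ** (U ** Z)" for r and Z :: mat2
    by (simp add: mat2_simps algebra_simps)
  ultimately have "U ** (X ** Y) = mat (trace X) ** (U ** Y) + (mat (trace Y) ** (U ** X) +
      (mat (trace (X ** Y) - trace X * trace Y) ** U + mat (- 1) ** (U ** (Y ** X))))"
    using c[of _ "mat 1"] by (metis matrix_add_ldistrib matrix_mul_rid)
  then have "U ** (X ** Y) ** W = (mat (trace X) ** (U ** Y) + (mat (trace Y) ** (U ** X) +
      (mat (trace (X ** Y) - trace X * trace Y) ** U + mat (- 1) ** (U ** (Y ** X))))) ** W"
    by simp
  then show ?thesis by (simp only: mat2_add_rdistrib matrix_mul_assoc)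
qed

lemma mat2_square_identity:
  fixes U W X :: mat2
  assumes "det X = 1"
  shows "U ** (X ** (X ** W)) = mat (trace X) ** (U ** (X ** W)) + mat (- 1) ** (U ** W)"
proof -
  have "X ** X = mat (trace X) ** X + mat (- 1)"
    unfolding SL2_cayley_hamilton[OF assms] by (simp add: mat2_simps)
  moreover have c: "U ** (mat r ** Z) = mat r ** (U ** Z)" for r and Z :: mat2
    by (simp add: mat2_simps algebra_simps)
  ultimately have "U ** (X ** X) = mat (trace X) ** (U ** X) + mat (- 1) ** U"
    using c[of _ "mat 1"] by (metis matrix_add_ldistrib matrix_mul_rid)
  then have "U ** (X ** X) ** W = (mat (trace X) ** (U ** X) + mat (- 1) ** U) ** W" by simp
  then show ?thesis by (simp only: mat2_add_rdistrib matrix_mul_assoc)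
qed

text \<open>By the two identities a repeated letter can be moved towards its other occurrence and
  cancelled there, at the cost of shorter words.\<close>

lemma word_prod_in_span:
  assumes R: "- 1 \<in> R" "\<And>r s. r \<in> R \<Longrightarrow> s \<in> R \<Longrightarrow> r - s \<in> R" "\<And>r s. r \<in> R \<Longrightarrow> s \<in> R \<Longrightarrow> r * s \<in> R"
    and A: "\<forall>b\<in>B. det (A b) = 1" and t: "\<And>b. b \<in> B \<Longrightarrow> trace (A b) \<in> R"
      "\<And>b c. b \<in> B \<Longrightarrow> c \<in> B \<Longrightarrow> trace (A b ** A c) \<in> R"
    and "set l \<subseteq> B"
  shows "word_prod A l \<in> mat_span R (word_prod A ` {l. set l \<subseteq> B \<and> distinct l})" (is "_ \<in> ?V")
  using \<open>set l \<subseteq> B\<close>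
proof (induction l rule: length_induct)
  case (1 l)
  \<comment> \<open>Of the four words produced by a swap only the swapped one keeps its length. Its
    gap between the two occurrences of \<open>x\<close> is shorter, so the inner induction on the
    gap \<open>v\<close> covers it, and the outer induction on the length covers the others.\<close>
  have main: "word_prod A (u @ x # v @ x # w) \<in> ?V"
    if "length (u @ x # v @ x # w) = length l" "set (u @ x # v @ x # w) \<subseteq> B" for u v w x
    using that
  proof (induction v arbitrary: u)
    case Nil
    have "word_prod A (u @ x # [] @ x # w) = mat (trace (A x)) ** word_prod A (u @ x # w) +
        mat (- 1) ** word_prod A (u @ w)"
      using mat2_square_identity[of "A x" "word_prod A u" "word_prod A w"] A Nil.prems
      by (simp add: word_prod_append)
    also have "\<dots> \<in> ?V"
      by (intro mat_span.add mat_span.scale R t 1(1)[rule_format]) (use Nil.prems in auto)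
    finally show ?case .
  next
    case (Cons y v)
    have "word_prod A (u @ x # (y # v) @ x # w) =
        mat (trace (A x)) ** word_prod A (u @ y # v @ x # w) +
        (mat (trace (A y)) ** word_prod A (u @ x # v @ x # w) +
         (mat (trace (A x ** A y) - trace (A x) * trace (A y)) ** word_prod A (u @ v @ x # w) +
          mat (- 1) ** word_prod A ((u @ [y]) @ x # v @ x # w)))"
      using mat2_swap_identity[of "word_prod A u" "A x" "A y" "word_prod A (v @ x # w)"]
      by (simp add: word_prod_append matrix_mul_assoc)
    also have "\<dots> \<in> ?V"
    proof (intro mat_span.add mat_span.scale R t)
      show "word_prod A ((u @ [y]) @ x # v @ x # w) \<in> ?V"
        by (rule Cons.IH) (use Cons.prems in auto)
    qed (use Cons.prems in \<open>auto intro!: 1(1)[rule_format]\<close>)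
    finally show ?case .
  qed
  show ?case
  proof (cases "distinct l")
    case True
    then show ?thesis using 1(2) by (intro mat_span.base) auto
  next
    case False
    then obtain u x v w where "l = u @ [x] @ v @ [x] @ w" using not_distinct_decomp by blast
    then show ?thesis using main[of u x v w] 1(2) by simp
  qed
qed

text \<open>The inverse of a letter is its trace minus the letter, and concatenation keeps products
  of words inside the span. For finite \<open>B\<close> there are only finitely many words without
  repetition, so the whole group lies in a finitely generated module.\<close>

lemma generate_in_word_span:
  assumes R: "- 1 \<in> R" "\<And>r s. r \<in> R \<Longrightarrow> s \<in> R \<Longrightarrow> r - s \<in> R" "\<And>r s. r \<in> R \<Longrightarrow> s \<in> R \<Longrightarrow> r * s \<in> R"
    and A: "\<forall>b\<in>B. det (A b) = 1" and t: "\<And>b. b \<in> B \<Longrightarrow> trace (A b) \<in> R"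
      "\<And>b c. b \<in> B \<Longrightarrow> c \<in> B \<Longrightarrow> trace (A b ** A c) \<in> R"
  shows "generate SL2 (A ` B) \<subseteq> mat_span R (word_prod A ` {l. set l \<subseteq> B \<and> distinct l})" (is "_ \<subseteq> ?V")
proof
  fix X assume "X \<in> generate SL2 (A ` B)"
  note words = word_prod_in_span[of R B A, OF R A t]
  have letter: "A b \<in> ?V" if "b \<in> B" for b using words[of "[b]"] that by simp
  from \<open>X \<in> _\<close> show "X \<in> ?V"
  proof (induction rule: generate.induct)
    case one
    then show ?case using words[of "[]"] by simp
  next
    case (incl h)
    then show ?case using letter by auto
  next
    case (inv h)
    then obtain b where b: "b \<in> B" "h = A b" by blast
    have "inv\<^bsub>SL2\<^esub> (A b) = mat (trace (A b)) ** word_prod A [] + mat (- 1) ** A b"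
      using A b by (simp add: SL2_inv) (simp add: mat2_simps)
    also have "\<dots> \<in> ?V" by (intro mat_span.add mat_span.scale R t b letter words) auto
    finally show ?case using b by simp
  next
    case (eng X Y)
    have "X ** Y \<in> ?V"
      using eng.IH(1)
    proof (induction rule: mat_span.induct)
      case (base X)
      then obtain l where l: "X = word_prod A l" "set l \<subseteq> B" by blast
      show ?case
        using eng.IH(2)
      proof (induction rule: mat_span.induct)
        case (base Y)
        then obtain l' where "Y = word_prod A l'" "set l' \<subseteq> B" by blast
        then show ?case using l words[of "l @ l'"] by (simp add: word_prod_append)
      next
        case (add Y Z)
        then show ?case by (simp add: matrix_add_ldistrib mat_span.add)
      next
        case (scale r Y)
        have "X ** (mat r ** Y) = mat r ** (X ** Y)" by (simp add: mat2_simps algebra_simps)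
        then show ?case using scale by (simp add: mat_span.scale)
      qed
    next
      case (add X Z)
      then show ?case by (simp add: mat2_add_rdistrib mat_span.add)
    next
      case (scale r X)
      then show ?case by (simp add: mat_span.scale flip: matrix_mul_assoc)
    qed
    then show ?case by simp
  qed
qed

section \<open>Denominators and Galois conjugates of matrix groups\<close>

definition int_adjoin :: "complex \<Rightarrow> complex set" where
  "int_adjoin \<zeta> = rat_eval \<zeta> ` {p. int_coeffs p}"

lemma int_adjoin_closed:
  shows "x \<in> int_adjoin \<zeta> \<Longrightarrow> y \<in> int_adjoin \<zeta> \<Longrightarrow> x + y \<in> int_adjoin \<zeta>"
    and "x \<in> int_adjoin \<zeta> \<Longrightarrow> y \<in> int_adjoin \<zeta> \<Longrightarrow> x - y \<in> int_adjoin \<zeta>"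
    and "x \<in> int_adjoin \<zeta> \<Longrightarrow> y \<in> int_adjoin \<zeta> \<Longrightarrow> x * y \<in> int_adjoin \<zeta>"
    and "of_int k \<in> int_adjoin \<zeta>" and "\<zeta> ^ n \<in> int_adjoin \<zeta>"
proof -
  show "x + y \<in> int_adjoin \<zeta>" if "x \<in> int_adjoin \<zeta>" "y \<in> int_adjoin \<zeta>"
    using that unfolding int_adjoin_def
    by (elim imageE) (simp only: mem_Collect_eq imageI int_coeffs_add flip: rat_eval_add)
  show "x * y \<in> int_adjoin \<zeta>" if "x \<in> int_adjoin \<zeta>" "y \<in> int_adjoin \<zeta>"
    using that unfolding int_adjoin_def
    by (elim imageE) (simp only: mem_Collect_eq imageI int_coeffs_mult flip: rat_eval_mult)
  show "x - y \<in> int_adjoin \<zeta>" if xy: "x \<in> int_adjoin \<zeta>" "y \<in> int_adjoin \<zeta>"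
  proof -
    obtain p q where "x = rat_eval \<zeta> p" "y = rat_eval \<zeta> q" "int_coeffs p" "int_coeffs q"
      using xy unfolding int_adjoin_def by blast
    then have "x - y = rat_eval \<zeta> (p - q)" "int_coeffs (p - q)" by (simp_all add: int_coeffs_def)
    then show ?thesis unfolding int_adjoin_def by blast
  qed
  have "of_int k = rat_eval \<zeta> [:of_int k:]" by simp
  moreover have "int_coeffs [:of_int k:]" by (simp add: int_coeffs_def coeff_pCons split: nat.split)
  ultimately show "of_int k \<in> int_adjoin \<zeta>" unfolding int_adjoin_def by blast
  have "\<zeta> ^ n = rat_eval \<zeta> (monom 1 n)" by simp
  then show "\<zeta> ^ n \<in> int_adjoin \<zeta>" unfolding int_adjoin_def using int_coeffs_monom by blast
qed

lemma int_adjoin_subset: "int_adjoin \<zeta> \<subseteq> rat_adjoin \<zeta>"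
  by (auto simp: int_adjoin_def)

lemma common_denominator:
  assumes "finite F" "F \<subseteq> rat_adjoin \<zeta>"
  shows "\<exists>D::int. D > 0 \<and> (\<forall>x\<in>F. of_int D * x \<in> int_adjoin \<zeta>)"
  using assms
proof (induction F)
  case empty
  then show ?case by (intro exI[of _ 1]) simp
next
  case (insert x F)
  then obtain D :: int where D: "D > 0" "\<forall>x\<in>F. of_int D * x \<in> int_adjoin \<zeta>" by auto
  obtain p where p: "x = rat_eval \<zeta> p" using insert by blast
  obtain E :: int where E: "E > 0" "int_coeffs (smult (of_int E) p)" using clear_denominators by blast
  have "of_int E * x = rat_eval \<zeta> (smult (of_int E) p)" by (simp add: p)
  then have "of_int E * x \<in> int_adjoin \<zeta>" unfolding int_adjoin_def using E(2) by blast
  then have "of_int D * (of_int E * x) \<in> int_adjoin \<zeta>" by (rule int_adjoin_closed(3)[OF int_adjoin_closed(4)])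
  moreover have "of_int E * (of_int D * y) \<in> int_adjoin \<zeta>" if "y \<in> F" for y
    by (rule int_adjoin_closed(3)[OF int_adjoin_closed(4)]) (use D(2) that in auto)
  ultimately show ?case using D(1) E(1)
    by (intro exI[of _ "D * E"]) (auto simp: mult_ac)
qed

text \<open>A common denominator for the finitely many generating matrices serves the whole span,
  since the coefficients lie in Z[\<zeta>].\<close>

lemma bounded_denominators:
  assumes "finite W" "\<And>X i j. X \<in> W \<Longrightarrow> X$i$j \<in> rat_adjoin \<zeta>"
  shows "\<exists>D::int. D > 0 \<and> (\<forall>X\<in>mat_span (int_adjoin \<zeta>) W. \<forall>i j. of_int D * X$i$j \<in> int_adjoin \<zeta>)"
proof -
  have "finite (\<Union>X\<in>W. \<Union>i. \<Union>j. {X$i$j})" using assms(1) by auto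
  moreover have "(\<Union>X\<in>W. \<Union>i. \<Union>j. {X$i$j}) \<subseteq> rat_adjoin \<zeta>" using assms(2) by blast
  ultimately obtain D :: int where D: "D > 0" "\<forall>x\<in>(\<Union>X\<in>W. \<Union>i. \<Union>j. {X$i$j}). of_int D * x \<in> int_adjoin \<zeta>"
    using common_denominator by blast
  have "\<forall>i j. of_int D * X$i$j \<in> int_adjoin \<zeta>" if "X \<in> mat_span (int_adjoin \<zeta>) W" for X
    using that
  proof (induction rule: mat_span.induct)
    case (base X)
    then show ?case using D(2) by blast
  next
    case (add X Y)
    then show ?case by (simp add: distrib_left int_adjoin_closed)
  next
    case (scale r X)
    have "of_int D * (mat r ** X)$i$j = r * (of_int D * X$i$j)" for i j
      using exhaust_2[of i] by (auto simp: mat2_mult_nth)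
    then show ?case using scale int_adjoin_closed(3) by metis
  qed
  then show ?thesis using D(1) by blast
qed

definition map_mat2 :: "(complex \<Rightarrow> complex) \<Rightarrow> mat2 \<Rightarrow> mat2" where
  "map_mat2 f X = mat22 (f (X$1$1)) (f (X$1$2)) (f (X$2$1)) (f (X$2$2))"

lemma map_mat2_nth [simp]: "map_mat2 f X $ i $ j = f (X $ i $ j)"
  using exhaust_2[of i] exhaust_2[of j] by (auto simp: map_mat2_def)

lemma conj_hom_mat2:
  assumes \<omega>: "\<omega> \<in> rat_conjugates \<zeta>" and "\<And>i j. X$i$j \<in> rat_adjoin \<zeta>" "\<And>i j. Y$i$j \<in> rat_adjoin \<zeta>"
  shows "map_mat2 (conj_hom \<zeta> \<omega>) (X ** Y) = map_mat2 (conj_hom \<zeta> \<omega>) X ** map_mat2 (conj_hom \<zeta> \<omega>) Y"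
    and "trace (map_mat2 (conj_hom \<zeta> \<omega>) X) = conj_hom \<zeta> \<omega> (trace X)"
    and "det X = 1 \<Longrightarrow> det (map_mat2 (conj_hom \<zeta> \<omega>) X) = 1"
    and "det X = 1 \<Longrightarrow> map_mat2 (conj_hom \<zeta> \<omega>) (inv\<^bsub>SL2\<^esub> X) = inv\<^bsub>SL2\<^esub> (map_mat2 (conj_hom \<zeta> \<omega>) X)"
    and "\<And>i j. (X ** Y)$i$j \<in> rat_adjoin \<zeta>"
    and "\<And>i j. det X = 1 \<Longrightarrow> (inv\<^bsub>SL2\<^esub> X)$i$j \<in> rat_adjoin \<zeta>"
    and "trace X \<in> rat_adjoin \<zeta>"
proof -
  let ?s = "conj_hom \<zeta> \<omega>"
  note c = conj_hom_simps[OF \<omega>] rat_adjoin_closed assms(2,3)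
  show "map_mat2 ?s (X ** Y) = map_mat2 ?s X ** map_mat2 ?s Y"
    by (simp only: mat2_eq_iff mat2_mult_nth map_mat2_nth c simp_thms)
  show "trace (map_mat2 ?s X) = ?s (trace X)"
    by (simp only: trace_mat2 map_mat2_nth c)
  show d: "det (map_mat2 ?s X) = 1" if "det X = 1"
  proof -
    have "det (map_mat2 ?s X) = ?s (det X)" by (simp only: det_2 map_mat2_nth c)
    then show ?thesis using that c(2) by simp
  qed
  show "map_mat2 ?s (inv\<^bsub>SL2\<^esub> X) = inv\<^bsub>SL2\<^esub> (map_mat2 ?s X)" if "det X = 1"
    by (simp only: SL2_inv[OF that] SL2_inv[OF d[OF that]] mat2_eq_iff map_mat2_nth mat22_nth c simp_thms)
  show "\<And>i j. (X ** Y)$i$j \<in> rat_adjoin \<zeta>" by (simp only: mat2_mult_nth c)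
  show "(inv\<^bsub>SL2\<^esub> X)$i$j \<in> rat_adjoin \<zeta>" if "det X = 1" for i j
    using exhaust_2[of i] exhaust_2[of j] by (auto simp only: SL2_inv[OF that] mat22_nth c)
  show "trace X \<in> rat_adjoin \<zeta>" by (simp only: trace_mat2 c)
qed

lemma generate_rat_adjoin:
  assumes "\<omega> \<in> rat_conjugates \<zeta>" "\<forall>X\<in>S. det X = 1 \<and> (\<forall>i j. X$i$j \<in> rat_adjoin \<zeta>)" "X \<in> generate SL2 S"
  shows "(\<forall>i j. X$i$j \<in> rat_adjoin \<zeta>) \<and>
    map_mat2 (conj_hom \<zeta> \<omega>) X \<in> generate SL2 (map_mat2 (conj_hom \<zeta> \<omega>) ` S)"
  using assms(3)
proof (induction rule: generate.induct)
  case one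
  have "map_mat2 (conj_hom \<zeta> \<omega>) (mat 1) = mat 1"
    by (simp add: mat2_eq_iff conj_hom_simps(1,2)[OF assms(1)])
  then show ?case unfolding forall_2 SL2_sel mat2_mat_nth
    using generate.one[of SL2] rat_adjoin_closed(1,2) by simp
next
  case (incl h)
  then show ?case using assms(2) by (simp add: generate.incl)
next
  case (inv h)
  then have h: "det h = 1" "\<And>i j. h$i$j \<in> rat_adjoin \<zeta>" using assms(2) by auto
  show ?case using inv
    by (simp only: conj_hom_mat2[OF assms(1) h(2) h(2)] h(1) simp_thms) (blast intro: generate.inv)
next
  case (eng h1 h2)
  then have h: "\<And>i j. h1$i$j \<in> rat_adjoin \<zeta>" "\<And>i j. h2$i$j \<in> rat_adjoin \<zeta>" by auto
  show ?case using generate.eng[of _ SL2 _ _] eng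
    by (simp add: conj_hom_mat2[OF assms(1) h])
qed

text \<open>Entrywise conjugation is multiplicative only on matrices over Q(\<zeta>); lifting a
  product therefore relies on \<open>generate_rat_adjoin\<close>, which places the lifted factors
  there.\<close>

lemma generate_conj_hom:
  assumes "\<omega> \<in> rat_conjugates \<zeta>" "\<forall>X\<in>S. det X = 1 \<and> (\<forall>i j. X$i$j \<in> rat_adjoin \<zeta>)"
    "Y \<in> generate SL2 (map_mat2 (conj_hom \<zeta> \<omega>) ` S)"
  shows "\<exists>X\<in>generate SL2 S. Y = map_mat2 (conj_hom \<zeta> \<omega>) X"
  using assms(3)
proof (induction rule: generate.induct)
  case one
  have "map_mat2 (conj_hom \<zeta> \<omega>) (mat 1) = mat 1"
    by (simp add: mat2_eq_iff conj_hom_simps(1,2)[OF assms(1)])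
  then show ?case using generate.one[of SL2 S] by (intro bexI[of _ "mat 1"]) auto
next
  case (incl h)
  then show ?case by (auto intro: generate.incl)
next
  case (inv h)
  then obtain X where X: "X \<in> S" "h = map_mat2 (conj_hom \<zeta> \<omega>) X" by blast
  then have h: "det X = 1" "\<And>i j. X$i$j \<in> rat_adjoin \<zeta>" using assms(2) by auto
  show ?case using conj_hom_mat2(4)[OF assms(1) h(2) h(2) h(1)] X
    by (intro bexI[of _ "inv\<^bsub>SL2\<^esub> X"]) (auto intro: generate.inv)
next
  case (eng h1 h2)
  then obtain X1 X2 where X: "X1 \<in> generate SL2 S" "X2 \<in> generate SL2 S"
    "h1 = map_mat2 (conj_hom \<zeta> \<omega>) X1" "h2 = map_mat2 (conj_hom \<zeta> \<omega>) X2" by blast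
  have "\<And>i j. X1$i$j \<in> rat_adjoin \<zeta>" "\<And>i j. X2$i$j \<in> rat_adjoin \<zeta>"
    using generate_rat_adjoin[OF assms(1,2)] X by blast+
  then show ?case using conj_hom_mat2(1)[OF assms(1)] X generate.eng[OF X(1,2)]
    by (intro bexI[of _ "X1 ** X2"]) auto
qed

section \<open>The finite case for matrix families\<close>

text \<open>Two powers of \<open>h\<close> coincide, so some positive power is 1. Its trace 2 equals
  z^n + 1/z^n, and hence (z^n - 1)^2 = 0.\<close>

lemma torsion_eigenvalue:
  assumes S: "\<forall>X\<in>S. det X = 1" and fin: "finite (generate SL2 S)" and h: "h \<in> generate SL2 S"
    and z: "trace h = z + 1 / z" "z \<noteq> 0"
  shows "\<exists>n>0. z ^ n = 1"
proof -
  interpret group SL2 by (rule group_SL2)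
  have hc: "h \<in> carrier SL2" using generate_SL2(5)[OF S h] by simp
  have "finite (range (\<lambda>n::nat. h [^]\<^bsub>SL2\<^esub> n))"
    by (rule finite_subset[OF _ fin]) (use generate_SL2_pow[OF S h] in blast)
  then have "\<not> inj (\<lambda>n::nat. h [^]\<^bsub>SL2\<^esub> n)" using finite_imageD infinite_UNIV_nat by blast
  then obtain i j :: nat where "i \<noteq> j" "h [^]\<^bsub>SL2\<^esub> i = h [^]\<^bsub>SL2\<^esub> j" by (auto simp: inj_def)
  then obtain i j :: nat where ij: "i < j" "h [^]\<^bsub>SL2\<^esub> i = h [^]\<^bsub>SL2\<^esub> j"
    by (metis nat_neq_iff)
  define n where "n = j - i"
  have "n > 0" using ij(1) by (simp add: n_def)
  have "h [^]\<^bsub>SL2\<^esub> i \<otimes>\<^bsub>SL2\<^esub> h [^]\<^bsub>SL2\<^esub> n = h [^]\<^bsub>SL2\<^esub> i \<otimes>\<^bsub>SL2\<^esub> \<one>\<^bsub>SL2\<^esub>"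
    using nat_pow_mult[OF hc, of i n] ij hc by (simp add: n_def del: SL2_sel)
  then have "h [^]\<^bsub>SL2\<^esub> n = \<one>\<^bsub>SL2\<^esub>" using hc by (simp del: SL2_sel)
  then have "h [^]\<^bsub>SL2\<^esub> n = mat 1" by simp
  then have "z ^ n + 1 / z ^ n = 2"
    using trace_SL2_pow[OF generate_SL2(5)[OF S h] z, of n] by (simp add: trace_mat2)
  then have "(z ^ n - 1)\<^sup>2 = 0" using z(2) by (simp add: field_simps power2_eq_square)
  then have "z ^ n = 1" by simp
  with \<open>n > 0\<close> show ?thesis by blast
qed

lemma finite_core_field:
  assumes \<zeta>: "\<zeta> ^ N = 1" and N: "N > 0" and finB: "finite B"
    and fresh: "\<And>x y z. \<exists>k\<in>B. k \<notin> {x, y, z}" and A: "\<forall>b\<in>B. det (A b) = 1"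
    and b: "b1 \<in> B" "b2 \<in> B" and np: "normal_pair (A b1) (A b2)"
    and fin: "\<forall>k\<in>B - {b1, b2}. finite (tr_set A B k)"
    and L: "\<And>x i j. x \<in> B \<Longrightarrow> A x $ i $ j \<in> rat_adjoin \<zeta>"
    and R: "\<And>x. x \<in> B \<Longrightarrow> trace (A x) \<in> int_adjoin \<zeta>"
      "\<And>x y. x \<in> B \<Longrightarrow> y \<in> B \<Longrightarrow> trace (A x ** A y) \<in> int_adjoin \<zeta>"
  shows "finite (generate SL2 (A ` B))"
proof -
  have S: "\<forall>X\<in>A ` B'. det X = 1 \<and> (\<forall>i j. X$i$j \<in> rat_adjoin \<zeta>)" if "B' \<subseteq> B" for B'
    using A L that by blast
  have gL: "X$i$j \<in> rat_adjoin \<zeta>" if "X \<in> generate SL2 (A ` B')" "B' \<subseteq> B" for X i j B'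
  proof -
    have "\<zeta> \<in> rat_conjugates \<zeta>" by (simp add: rat_conjugates_def)
    then show ?thesis using generate_rat_adjoin[OF _ S[OF that(2)] that(1)] by blast
  qed
  have conj_bounded: "\<exists>C. \<forall>g\<in>generate SL2 (A ` B). \<forall>i j. norm (conj_hom \<zeta> \<omega> (g$i$j)) \<le> C"
    if w: "\<omega> \<in> rat_conjugates \<zeta>" for \<omega>
  proof -
    define A' where "A' b = map_mat2 (conj_hom \<zeta> \<omega>) (A b)" for b
    have im: "A' ` B' = map_mat2 (conj_hom \<zeta> \<omega>) ` A ` B'" for B' by (auto simp: A'_def)
    have "bounded (generate SL2 (A' ` B))"
    proof (rule bounded_core[OF fresh _ b])
      show "\<forall>b\<in>B. det (A' b) = 1" unfolding A'_def using conj_hom_mat2(3)[OF w L L] A by blast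
      have "conj_hom \<zeta> \<omega> (A b1 $ 1 $ 1 - A b1 $ 2 $ 2) \<noteq> 0"
        by (rule conj_hom_nonzero[OF \<zeta> N w])
           (use np b in \<open>auto simp: normal_pair_def intro!: rat_adjoin_closed L\<close>)
      then have "conj_hom \<zeta> \<omega> (A b1 $ 1 $ 1) \<noteq> conj_hom \<zeta> \<omega> (A b1 $ 2 $ 2)"
        using conj_hom_simps(4)[OF w L[OF b(1)] L[OF b(1)]] by auto
      then show "normal_pair (A' b1) (A' b2)"
        using np conj_hom_nonzero[OF \<zeta> N w L[OF b(2)]] conj_hom_simps(1)[OF w]
        by (auto simp: normal_pair_def A'_def)
      show "\<forall>k\<in>B - {b1, b2}. bounded (tr_set A' B k)"
      proof
        fix k assume k: "k \<in> B - {b1, b2}"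
        \<comment> \<open>Elements of the conjugate group lift to the original group, and so do
          their traces. Since \<open>conj_hom\<close> need not be continuous, it is finiteness of
          the trace set that carries over.\<close>
        have "tr_set A' B k \<subseteq> conj_hom \<zeta> \<omega> ` tr_set A B k"
        proof
          fix t assume "t \<in> tr_set A' B k"
          then obtain h' where h': "h' \<in> generate SL2 (A' ` (B - {k}))" "t = trace (A' k ** h')"
            unfolding tr_set_def by blast
          obtain h where h: "h \<in> sub_gen A B k" "h' = map_mat2 (conj_hom \<zeta> \<omega>) h"
            using generate_conj_hom[OF w S h'(1)[unfolded im]] by blast
          have hL: "\<And>i j. h$i$j \<in> rat_adjoin \<zeta>" using gL[OF h(1)] by blast
          have kL: "\<And>i j. A k $ i $ j \<in> rat_adjoin \<zeta>" using L k by blast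
          have "t = trace (map_mat2 (conj_hom \<zeta> \<omega>) (A k ** h))"
            unfolding h'(2) h(2) A'_def by (simp only: conj_hom_mat2(1)[OF w kL hL])
          also have "\<dots> = conj_hom \<zeta> \<omega> (trace (A k ** h))"
            by (intro conj_hom_mat2(2)[OF w _ hL] conj_hom_mat2(5)[OF w kL hL])
          finally show "t \<in> conj_hom \<zeta> \<omega> ` tr_set A B k" unfolding tr_set_def using h(1) by blast
        qed
        then have "finite (tr_set A' B k)" using fin k finite_subset by blast
        then show "bounded (tr_set A' B k)" by (rule finite_imp_bounded)
      qed
    qed
    then obtain C where C: "\<forall>X\<in>generate SL2 (A' ` B). \<forall>i j. norm (X$i$j) \<le> C"
      unfolding bounded_mat2_iff by blast
    have "norm (conj_hom \<zeta> \<omega> (g$i$j)) \<le> C" if "g \<in> generate SL2 (A ` B)" for g i j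
    proof -
      have "map_mat2 (conj_hom \<zeta> \<omega>) g \<in> generate SL2 (A' ` B)"
        using generate_rat_adjoin[OF w S[OF subset_refl] that] unfolding im by blast
      then show ?thesis using C map_mat2_nth by metis
    qed
    then show ?thesis by blast
  qed
  obtain Cf where Cf: "\<And>\<omega> g i j. \<omega> \<in> rat_conjugates \<zeta> \<Longrightarrow> g \<in> generate SL2 (A ` B) \<Longrightarrow>
      norm (conj_hom \<zeta> \<omega> (g$i$j)) \<le> Cf \<omega>"
    using conj_bounded by metis
  \<comment> \<open>A single bound valid for all of the finitely many conjugates.\<close>
  define C where "C = (\<Sum>\<omega>\<in>rat_conjugates \<zeta>. \<bar>Cf \<omega>\<bar>)"
  have finC: "finite (rat_conjugates \<zeta>)" by (rule finite_rat_conjugates[OF \<zeta> N])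
  have C: "norm (conj_hom \<zeta> \<omega> (g$i$j)) \<le> C"
    if "\<omega> \<in> rat_conjugates \<zeta>" "g \<in> generate SL2 (A ` B)" for \<omega> g i j
  proof -
    have "\<bar>Cf \<omega>\<bar> \<le> C" unfolding C_def by (rule member_le_sum) (use finC that in auto)
    then show ?thesis using Cf[OF that, of i j] by linarith
  qed
  let ?W = "word_prod A ` {l. set l \<subseteq> B \<and> distinct l}"
  have W: "finite ?W" using finite_subset_distinct[OF finB] by blast
  have WL: "X$i$j \<in> rat_adjoin \<zeta>" if "X \<in> ?W" for X i j
  proof -
    obtain l where l: "X = word_prod A l" "set l \<subseteq> B" using \<open>X \<in> ?W\<close> by auto
    have "word_prod A l \<in> generate SL2 (A ` B)"
      using l(2) by (induction l) (use generate_SL2(1-3)[of "A ` B"] A in auto)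
    then show ?thesis using gL l(1) by blast
  qed
  obtain D :: int where D: "D > 0"
    "\<forall>X\<in>mat_span (int_adjoin \<zeta>) ?W. \<forall>i j. of_int D * X$i$j \<in> int_adjoin \<zeta>"
    using bounded_denominators[OF W WL] by blast
  have m1: "- 1 \<in> int_adjoin \<zeta>" using int_adjoin_closed(4)[of "- 1" \<zeta>] by simp
  have span: "generate SL2 (A ` B) \<subseteq> mat_span (int_adjoin \<zeta>) ?W"
    by (rule generate_in_word_span[OF m1 int_adjoin_closed(2,3) A R])
  define F where "F = {z. \<exists>p. z = rat_eval \<zeta> p \<and> int_coeffs p \<and>
      (\<forall>\<omega>\<in>rat_conjugates \<zeta>. norm (rat_eval \<omega> p) \<le> of_int D * C)}"
  have finF: "finite F" unfolding F_def by (rule finite_bounded_conjugates[OF \<zeta> N])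
  have entry: "g$i$j \<in> (\<lambda>z. z / of_int D) ` F" if g: "g \<in> generate SL2 (A ` B)" for g i j
  proof -
    have "of_int D * g$i$j \<in> int_adjoin \<zeta>" using D(2) span g by blast
    then obtain p where p: "of_int D * g$i$j = rat_eval \<zeta> p" "int_coeffs p"
      unfolding int_adjoin_def by blast
    have "norm (rat_eval \<omega> p) \<le> of_int D * C" if w: "\<omega> \<in> rat_conjugates \<zeta>" for \<omega>
    proof -
      have Dr: "of_int D = rat_eval \<zeta> [:of_int D:]" by simp
      have "rat_eval \<omega> p = conj_hom \<zeta> \<omega> (of_int D * g$i$j)"
        unfolding p(1) by (rule conj_hom_rat_eval[OF w, symmetric])
      also have "\<dots> = conj_hom \<zeta> \<omega> (of_int D) * conj_hom \<zeta> \<omega> (g$i$j)"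
        by (rule conj_hom_simps(5)[OF w _ gL[OF g subset_refl]]) (simp only: Dr rangeI)
      also have "conj_hom \<zeta> \<omega> (of_int D) = of_int D"
        unfolding Dr conj_hom_rat_eval[OF w] by simp
      finally have "norm (rat_eval \<omega> p) = of_int D * norm (conj_hom \<zeta> \<omega> (g$i$j))"
        using D(1) by (simp add: norm_mult)
      then show ?thesis using C[OF w g] D(1) by (simp add: mult_left_mono)
    qed
    then have "of_int D * g$i$j \<in> F" unfolding F_def using p by blast
    moreover have "g$i$j = (of_int D * g$i$j) / of_int D" using D(1) by simp
    ultimately show ?thesis by blast
  qed
  let ?F = "(\<lambda>z. z / of_int D) ` F"
  have "generate SL2 (A ` B) \<subseteq> (\<lambda>(a, b, c, d). mat22 a b c d) ` (?F \<times> ?F \<times> ?F \<times> ?F)"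
  proof
    fix g assume g: "g \<in> generate SL2 (A ` B)"
    have "g = (\<lambda>(a, b, c, d). mat22 a b c d) (g$1$1, g$1$2, g$2$1, g$2$2)" by (simp add: mat2_eq_iff)
    then show "g \<in> (\<lambda>(a, b, c, d). mat22 a b c d) ` (?F \<times> ?F \<times> ?F \<times> ?F)"
      by (rule image_eqI) (intro SigmaI entry[OF g])
  qed
  moreover have "finite \<dots>" by (intro finite_imageI finite_cartesian_product finF)
  ultimately show ?thesis by (rule finite_subset)
qed

text \<open>The product of the individual exponents is a common exponent \<open>N\<close>, and a
  primitive \<open>N\<close>-th root of unity has all the required roots among its powers.\<close>

lemma common_root_of_unity:
  assumes "finite T" "\<And>t. t \<in> T \<Longrightarrow> \<exists>n>0. \<exists>z. z ^ n = 1 \<and> t = z + 1 / (z::complex)"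
  obtains N \<zeta> where "N > 0" "\<zeta> ^ N = 1" "\<And>t. t \<in> T \<Longrightarrow> \<exists>k. t = \<zeta> ^ k + 1 / \<zeta> ^ k"
proof -
  have "\<exists>N>0. \<forall>t\<in>T. \<exists>z. z ^ N = 1 \<and> t = z + 1 / z"
    using assms
  proof (induction T)
    case empty
    then show ?case by auto
  next
    case (insert t T)
    then obtain N where N: "N > 0" "\<forall>t\<in>T. \<exists>z. z ^ N = 1 \<and> t = z + 1 / z" by auto
    obtain n z where n: "n > 0" "z ^ n = 1" "t = z + 1 / z" using insert.prems by blast
    have "w ^ (n * N) = 1" if "w ^ N = 1" for w :: complex
      using that by (metis mult.commute power_mult power_one)
    moreover have "z ^ (n * N) = 1" using n(2) by (simp add: power_mult)
    ultimately have "\<forall>t\<in>insert t T. \<exists>z. z ^ (n * N) = 1 \<and> t = z + 1 / z"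
      using N(2) n(3) by (metis insert_iff)
    then show ?case using N(1) n(1) by (intro exI[of _ "n * N"]) simp
  qed
  then obtain N where N: "N > 0" "\<And>t. t \<in> T \<Longrightarrow> \<exists>z. z ^ N = 1 \<and> t = z + 1 / z" by blast
  define \<zeta> where "\<zeta> = cis (2 * pi / real N)"
  have pow: "\<zeta> ^ k = cis (2 * pi * real k / real N)" for k
  proof -
    have "real k * (2 * pi / real N) = 2 * pi * real k / real N" by simp
    then show ?thesis using Complex.DeMoivre[of "2 * pi / real N" k] by (simp only: \<zeta>_def)
  qed
  have "\<zeta> ^ N = 1" using N(1) by (simp add: pow)
  moreover have "\<exists>k. t = \<zeta> ^ k + 1 / \<zeta> ^ k" if t: "t \<in> T" for t
  proof -
    obtain z where z: "z ^ N = 1" "t = z + 1 / z" using N(2)[OF t] by blast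
    then have "z \<in> (\<lambda>k. cis (2 * pi * real k / real N)) ` {..<N}"
      using Complex.bij_betw_roots_unity[OF N(1)] by (auto simp: bij_betw_def)
    then show ?thesis using z(2) pow by auto
  qed
  ultimately show ?thesis using that[of N \<zeta>] N(1) by blast
qed

text \<open>The reconstruction formulas involve entries of the pair itself, so these must be
  cyclotomic too. The hypothesis \<open>one\<close> removes the remaining freedom to rescale the
  eigenbasis, and the determinant then gives the other off-diagonal entry of \<open>A b2\<close>.
  The hypothesis \<open>fin2\<close> covers products of two generators outside the pair.\<close>

lemma finite_core:
  assumes finB: "finite B"
    and fresh: "\<And>x y z. \<exists>k\<in>B. k \<notin> {x, y, z}" and A: "\<forall>b\<in>B. det (A b) = 1"
    and b: "b1 \<in> B" "b2 \<in> B" and np: "normal_pair (A b1) (A b2)" and one: "A b2 $ 1 $ 2 = 1"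
    and fin: "\<forall>k\<in>B - {b1, b2}. finite (tr_set A B k)"
    and fin2: "\<And>k x j. k \<in> B - {b1, b2} \<Longrightarrow> x \<in> B - {k} \<Longrightarrow> j \<in> B - {b1, b2} \<Longrightarrow>
                 finite (tr_set (A(k := A k ** A x)) B j)"
  shows "finite (generate SL2 (A ` B))"
proof -
  define tors where "tors t \<longleftrightarrow> (\<exists>n>0. \<exists>z. z ^ n = 1 \<and> t = z + 1 / z)" for t :: complex
  have torsI: "tors (trace h)" if A': "\<forall>b\<in>B. det (A' b) = 1" and np': "normal_pair (A' b1) (A' b2)"
    and f: "finite (tr_set A' B k)" and k: "k \<in> B - {b1, b2}" and h: "h \<in> sub_gen A' B k" for A' k h
  proof -
    have fin': "finite (sub_gen A' B k)" by (rule finite_sub_gen[OF A' _ _ _ np' f]) (use k b in auto)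
    obtain z where z: "z \<noteq> 0" "trace h = z + 1 / z" using ex_trace_root by blast
    have "\<forall>X\<in>A' ` (B - {k}). det X = 1" using A' by blast
    from torsion_eigenvalue[OF this fin' h z(2,1)] show ?thesis using z unfolding tors_def by blast
  qed
  have sub: "\<forall>X\<in>A ` (B - {k}). det X = 1" for k using A by auto
  have gen: "A x \<in> sub_gen A B k" if "x \<in> B" "x \<noteq> k" for x k
    by (rule generate_SL2(2)[OF sub]) (use that in auto)
  have fam: "\<exists>k\<in>B - {b1, b2}. x \<noteq> k" for x
    using fresh[of b1 b2 x] by auto
  have tA: "tors (trace h)" if "k \<in> B - {b1, b2}" "h \<in> sub_gen A B k" for h k
    using torsI[OF A np] fin that by blast
  have t1: "tors (trace (A x))" "tors (trace (A b1 ** A x))" "tors (trace (A b2 ** A x))"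
    "tors (trace (A b1 ** (A b2 ** A x)))" if x: "x \<in> B" for x
  proof -
    obtain k where k: "k \<in> B - {b1, b2}" "x \<noteq> k" using fam by blast
    have g: "A x \<in> sub_gen A B k" "A b1 \<in> sub_gen A B k" "A b2 \<in> sub_gen A B k"
      using gen x k b by auto
    show "tors (trace (A x))" "tors (trace (A b1 ** A x))" "tors (trace (A b2 ** A x))"
      "tors (trace (A b1 ** (A b2 ** A x)))"
      using g by (auto intro!: tA[OF k(1)] generate_SL2(3)[OF sub])
  qed
  \<comment> \<open>If \<open>k\<close> and \<open>x\<close> are the only generators besides
    \<open>b1\<close> and \<open>b2\<close>, no group \<open>sub_gen A B j\<close> with
    \<open>j\<close> outside the pair contains both. In the modified family their product is one
    letter, available once \<open>j\<close> differs from \<open>k\<close>.\<close>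
  have t2': "tors (trace (A k ** A x))" if k: "k \<in> B - {b1, b2}" and x: "x \<in> B" "x \<noteq> k" for k x
  proof -
    let ?A = "A(k := A k ** A x)"
    obtain j where j: "j \<in> B - {b1, b2}" "k \<noteq> j" using fam by blast
    have A': "\<forall>b\<in>B. det (?A b) = 1" using A k x by (simp add: det_mul)
    then have "\<forall>X\<in>?A ` (B - {j}). det X = 1" by blast
    then have "?A k \<in> sub_gen ?A B j" by (rule generate_SL2(2)) (use k j in auto)
    moreover have "normal_pair (?A b1) (?A b2)" using np k by auto
    moreover have "finite (tr_set ?A B j)" using fin2[of k x j] k x j by blast
    ultimately have "tors (trace (?A k))" using torsI[OF A' _ _ j(1)] by blast
    then show ?thesis by simp
  qed
  have t2: "tors (trace (A x ** A y))" if "x \<in> B" "y \<in> B" "x \<noteq> y" for x y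
  proof -
    consider "x = b1" | "x = b2" | "x \<in> B - {b1, b2}" using \<open>x \<in> B\<close> by blast
    then show ?thesis using t1(2,3)[OF \<open>y \<in> B\<close>] t2'[of x y] that by cases auto
  qed
  define T where "T = (\<lambda>x. trace (A x)) ` B \<union> (\<lambda>x. trace (A b1 ** A x)) ` B \<union> (\<lambda>x. trace (A b2 ** A x)) ` B \<union>
     (\<lambda>x. trace (A b1 ** (A b2 ** A x))) ` B \<union> (\<lambda>(x, y). trace (A x ** A y)) ` {(x, y). (x, y) \<in> B \<times> B \<and> x \<noteq> y}"
  have "finite {(x, y). (x, y) \<in> B \<times> B \<and> x \<noteq> y}"
    by (rule finite_subset[of _ "B \<times> B"]) (use finB in auto)
  then have finT: "finite T" unfolding T_def using finB by blast
  have "tors t" if "t \<in> T" for t using that t1 t2 unfolding T_def by auto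
  then obtain N \<zeta> where N: "N > 0" and \<zeta>: "\<zeta> ^ N = 1" and k: "\<And>t. t \<in> T \<Longrightarrow> \<exists>k. t = \<zeta> ^ k + 1 / \<zeta> ^ k"
    using common_root_of_unity[OF finT] unfolding tors_def by metis
  have z0: "\<zeta> \<noteq> 0" using \<zeta> N by (auto simp: power_0_left)
  \<comment> \<open>Negative powers become nonnegative ones, because Z[\<zeta>] is described by
    polynomials.\<close>
  have inv: "1 / \<zeta> ^ k = \<zeta> ^ ((N - 1) * k)" for k
  proof -
    have "k + (N - 1) * k = N * k" using N by (cases N) auto
    then have "\<zeta> ^ k * \<zeta> ^ ((N - 1) * k) = 1" using \<zeta> by (metis power_add power_mult power_one)
    then show ?thesis using z0 by (simp add: field_simps)
  qed
  have TR: "t \<in> int_adjoin \<zeta>" if "t \<in> T" for t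
    using k[OF that] unfolding inv by (auto intro!: int_adjoin_closed)
  note RL = subsetD[OF int_adjoin_subset]
  have R1: "trace (A x) \<in> int_adjoin \<zeta>" if "x \<in> B" for x using TR that unfolding T_def by blast
  have R2: "trace (A x ** A y) \<in> int_adjoin \<zeta>" if xy: "x \<in> B" "y \<in> B" for x y
  proof (cases "x = y")
    case True
    have "trace (A x ** A x) = trace (A x) * trace (A x) - of_int 2"
      unfolding SL2_cayley_hamilton[OF bspec[OF A xy(1)]] by (simp add: trace_mat2 mat2_mult_nth algebra_simps)
    also have "\<dots> \<in> int_adjoin \<zeta>" by (intro int_adjoin_closed R1 xy)
    finally show ?thesis using True by simp
  next
    case False
    then show ?thesis using TR xy unfolding T_def by blast
  qed
  have R3: "trace (A b1 ** (A b2 ** A x)) \<in> int_adjoin \<zeta>" if "x \<in> B" for x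
    using TR that unfolding T_def by blast
  have npe: "A b1 $ 1 $ 2 = 0" "A b1 $ 2 $ 1 = 0" using np by (auto simp: normal_pair_def)
  define l where "l = A b1 $ 1 $ 1"
  have det1: "l * A b1 $ 2 $ 2 = 1" using bspec[OF A b(1)] npe by (simp add: l_def det_2)
  then have l0: "l \<noteq> 0" by auto
  then have l22: "A b1 $ 2 $ 2 = 1 / l" using det1 by (simp add: field_simps)
  have "trace (A b1) \<in> T" unfolding T_def using b by blast
  then obtain j where "l + 1 / l = \<zeta> ^ j + 1 / \<zeta> ^ j"
    using k l22 by (auto simp: trace_mat2 l_def[symmetric])
  \<comment> \<open>A number and its inverse are the two roots of the quadratic equation with their
    sum as trace; hence \<open>l\<close> is itself a power of \<zeta> or the inverse of one.\<close>
  then have "(l - \<zeta> ^ j) * (l - 1 / \<zeta> ^ j) = 0" using l0 z0 by (simp add: field_simps)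
  then have "l = \<zeta> ^ j \<or> l = 1 / \<zeta> ^ j" by auto
  then have lR: "l \<in> rat_adjoin \<zeta>"
    unfolding inv using RL[OF int_adjoin_closed(5)] by auto
  have l22R: "A b1 $ 2 $ 2 \<in> rat_adjoin \<zeta>" unfolding l22
    by (rule rat_adjoin_divide[OF \<zeta> N rat_adjoin_closed(2) lR])
  note clo = rat_adjoin_divide[OF \<zeta> N] rat_adjoin_closed
  have diag': "A x $ 1 $ 1 \<in> rat_adjoin \<zeta> \<and> A x $ 2 $ 2 \<in> rat_adjoin \<zeta>" if x: "x \<in> B" for x
    unfolding normal_pair_reconstruct(1,2)[OF np, of "A x"]
    using l22R lR[unfolded l_def] RL[OF R1[OF x]] RL[OF R2[OF b(1) x]] by (intro conjI clo)
  then have diag: "A x $ 1 $ 1 \<in> rat_adjoin \<zeta>" "A x $ 2 $ 2 \<in> rat_adjoin \<zeta>" if "x \<in> B" for x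
    using that by blast+
  have c: "A b2 $ 2 $ 1 \<in> rat_adjoin \<zeta>"
  proof -
    have "A b2 $ 2 $ 1 = A b2 $ 1 $ 1 * A b2 $ 2 $ 2 - 1"
      using bspec[OF A b(2)] one by (simp add: det_2 algebra_simps)
    then show ?thesis using diag[OF b(2)] by (simp add: clo)
  qed
  have L: "A x $ i $ j \<in> rat_adjoin \<zeta>" if x: "x \<in> B" for x i j
  proof -
    have o: "A b2 $ 1 $ 2 \<in> rat_adjoin \<zeta>" using one clo(3) by simp
    have "A x $ 2 $ 1 \<in> rat_adjoin \<zeta> \<and> A x $ 1 $ 2 \<in> rat_adjoin \<zeta>"
      unfolding normal_pair_reconstruct(3,4)[OF np, of "A x"]
      using l22R lR[unfolded l_def] RL[OF R2[OF b(2) x]] RL[OF R3[OF x]] diag[OF x] diag[OF b(2)] c o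
      by (intro conjI clo)
    then show ?thesis using diag[OF x] exhaust_2[of i] exhaust_2[of j] by auto
  qed
  show ?thesis by (rule finite_core_field[OF \<zeta> N finB fresh A b np fin L R1 R2])
qed


section \<open>Transvections of a free group\<close>

lemma hom_eq_on_generate:
  assumes "group G" "group H" "h \<in> hom G H" "k \<in> hom G H" "B \<subseteq> carrier G"
    and eq: "\<And>b. b \<in> B \<Longrightarrow> h b = k b" and x: "x \<in> generate G B"
  shows "h x = k x"
proof -
  interpret G: group G by fact
  interpret h: group_hom G H h using assms by (simp add: group_hom_def group_hom_axioms_def)
  interpret k: group_hom G H k using assms by (simp add: group_hom_def group_hom_axioms_def)
  show ?thesis using x
  proof (induction rule: generate.induct)
    case (inv b)
    then show ?case using eq assms(5) by (simp add: subset_iff)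
  next
    case (eng x y)
    then have "x \<in> carrier G" "y \<in> carrier G" using G.generate_in_carrier[OF assms(5)] by auto
    then show ?case using eng by simp
  qed (use eq in auto)
qed

context group begin

lemma letter_val_closed: "set w \<subseteq> carrier G \<times> UNIV \<Longrightarrow> l \<in> set w \<Longrightarrow> letter_val G l \<in> carrier G"
  by (auto simp: letter_val_def)

lemma word_val_Cons [simp]: "word_val G (l # w) = letter_val G l \<otimes> word_val G w"
  by (simp add: word_val_def)

lemma word_val_Nil [simp]: "word_val G [] = \<one>"
  by (simp add: word_val_def)

lemma word_val_closed: "set w \<subseteq> carrier G \<times> UNIV \<Longrightarrow> word_val G w \<in> carrier G"
  by (induction w) (auto simp: letter_val_def)

lemma word_val_append:
  "set u \<subseteq> carrier G \<times> UNIV \<Longrightarrow> set v \<subseteq> carrier G \<times> UNIV \<Longrightarrow>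
   word_val G (u @ v) = word_val G u \<otimes> word_val G v"
  by (induction u) (auto simp: letter_val_def word_val_closed m_assoc)

lemma word_val_inverse:
  "set w \<subseteq> carrier G \<times> UNIV \<Longrightarrow> word_val G (rev (map (\<lambda>(b, s). (b, \<not> s)) w)) = inv (word_val G w)"
proof (induction w)
  case (Cons l w)
  obtain b s where l: "l = (b, s)" by force
  have c: "set (rev (map (\<lambda>(b, s). (b, \<not> s)) w)) \<subseteq> carrier G \<times> UNIV" using Cons.prems by auto
  have "word_val G (rev (map (\<lambda>(b, s). (b, \<not> s)) (l # w))) =
      inv (word_val G w) \<otimes> word_val G [(b, \<not> s)]"
    using Cons c l by (simp add: word_val_append)
  also have "word_val G [(b, \<not> s)] = inv (letter_val G l)"
    using Cons.prems l by (auto simp: letter_val_def)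
  finally show ?case using Cons.prems
    by (simp add: inv_mult_group word_val_closed letter_val_closed[of "l # w"])
qed simp

end

lemma not_reduced_word:
  "\<not> reduced_word w \<Longrightarrow> \<exists>u b s v. w = u @ (b, s) # (b, \<not> s) # v"
proof (induction w rule: induct_list012)
  case (3 l l' w)
  obtain b s b' s' where l: "l = (b, s)" "l' = (b', s')" by (metis surj_pair)
  show ?case
  proof (cases "b = b' \<and> s \<noteq> s'")
    case True
    then show ?thesis using l by (intro exI[of _ "[]"]) auto
  next
    case False
    then have "\<not> reduced_word (l' # w)" using 3(3) l by (auto simp: reduced_word_def)
    then obtain u b s v where "l' # w = u @ (b, s) # (b, \<not> s) # v" using 3(2) by blast
    then show ?thesis by (metis append_Cons)
  qed
qed (simp_all add: reduced_word_def)

text \<open>By freeness a nonempty word with value 1 is not reduced, so it contains an adjacent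
  inverse pair. That pair also cancels after substitution, and the shorter word is covered by
  induction.\<close>

lemma free_basis_relation:
  assumes "group G" "free_basis G B" "f \<in> B \<rightarrow> carrier G" "set w \<subseteq> B \<times> UNIV" "word_val G w = \<one>\<^bsub>G\<^esub>"
  shows "word_val G (map (\<lambda>(b, s). (f b, s)) w) = \<one>\<^bsub>G\<^esub>"
  using assms(4,5)
proof (induction w rule: length_induct)
  case (1 w)
  interpret group G by fact
  have B: "B \<subseteq> carrier G" using assms(2) by (simp add: free_basis_def)
  show ?case
  proof (cases "reduced_word w")
    case True
    then have "w = []" using 1 assms(2) unfolding free_basis_def by blast
    then show ?thesis by simp
  next
    case False
    then obtain u b s v where w: "w = u @ (b, s) # (b, \<not> s) # v" using not_reduced_word by blast
    have cancel: "word_val G (u' @ (c, s) # (c, \<not> s) # v') = word_val G (u' @ v')"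
      if "set u' \<subseteq> carrier G \<times> UNIV" "set v' \<subseteq> carrier G \<times> UNIV" "c \<in> carrier G" for u' v' c
    proof -
      have "x \<otimes>\<^bsub>G\<^esub> (inv\<^bsub>G\<^esub> x \<otimes>\<^bsub>G\<^esub> y) = y" "inv\<^bsub>G\<^esub> x \<otimes>\<^bsub>G\<^esub> (x \<otimes>\<^bsub>G\<^esub> y) = y"
        if "x \<in> carrier G" "y \<in> carrier G" for x y
        using that by (simp_all flip: m_assoc)
      then show ?thesis using that by (simp add: word_val_append word_val_closed letter_val_def)
    qed
    have c: "set u \<subseteq> carrier G \<times> UNIV" "set v \<subseteq> carrier G \<times> UNIV" "b \<in> carrier G"
      using 1(2) w B by auto
    have "word_val G (u @ v) = \<one>\<^bsub>G\<^esub>" using cancel[OF c] 1(3) w by simp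
    then have IH: "word_val G (map (\<lambda>(b, s). (f b, s)) (u @ v)) = \<one>\<^bsub>G\<^esub>"
      using 1(1)[rule_format, of "u @ v"] 1(2) w by simp
    have c': "set (map (\<lambda>(b, s). (f b, s)) u) \<subseteq> carrier G \<times> UNIV"
      "set (map (\<lambda>(b, s). (f b, s)) v) \<subseteq> carrier G \<times> UNIV" "f b \<in> carrier G"
      using 1(2) w assms(3) by auto
    show ?thesis using cancel[OF c'] IH by (simp add: w)
  qed
qed

text \<open>The universal property for endomorphisms. The map is defined on words; two words with
  equal value differ by a relation, and relations survive the substitution, so the choice of word
  does not matter.\<close>

lemma free_basis_extend:
  assumes "group G" "free_basis G B" "f \<in> B \<rightarrow> carrier G"
  shows "\<exists>h\<in>hom G G. \<forall>b\<in>B. h b = f b"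
proof -
  interpret group G by fact
  have B: "B \<subseteq> carrier G" and gen: "generate G B = carrier G"
    using assms(2) by (auto simp: free_basis_def)
  define F where "F w = word_val G (map (\<lambda>(b, s). (f b, s)) w)" for w
  have car: "set w \<subseteq> carrier G \<times> UNIV" "set (map (\<lambda>(b, s). (f b, s)) w) \<subseteq> carrier G \<times> UNIV"
    if "set w \<subseteq> B \<times> UNIV" for w
    using that B assms(3) by (auto simp: subset_iff)
  have ex: "\<exists>w. set w \<subseteq> B \<times> UNIV \<and> word_val G w = x" if "x \<in> carrier G" for x
    using that unfolding gen[symmetric]
  proof (induction rule: generate.induct)
    case one
    then show ?case by (intro exI[of _ "[]"]) simp
  next
    case (incl b)
    then show ?case using B by (intro exI[of _ "[(b, True)]"]) (auto simp: letter_val_def)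
  next
    case (inv b)
    then show ?case using B by (intro exI[of _ "[(b, False)]"]) (auto simp: letter_val_def)
  next
    case (eng x y)
    then obtain u v where "set u \<subseteq> B \<times> UNIV" "word_val G u = x" "set v \<subseteq> B \<times> UNIV" "word_val G v = y"
      by blast
    then show ?case using word_val_append[OF car(1) car(1), of u v]
      by (intro exI[of _ "u @ v"]) simp
  qed
  have wd: "F u = F v" if uv: "set u \<subseteq> B \<times> UNIV" "set v \<subseteq> B \<times> UNIV" "word_val G u = word_val G v" for u v
  proof -
    let ?v = "rev (map (\<lambda>(b, s). (b, \<not> s)) v)"
    have v: "set ?v \<subseteq> B \<times> UNIV" using uv(2) by auto
    have "word_val G (u @ ?v) = word_val G u \<otimes>\<^bsub>G\<^esub> inv\<^bsub>G\<^esub> (word_val G v)"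
      using word_val_append[OF car(1)[OF uv(1)] car(1)[OF v]] word_val_inverse[OF car(1)[OF uv(2)]] by simp
    also have "\<dots> = \<one>\<^bsub>G\<^esub>" using uv(3) word_val_closed[OF car(1)[OF uv(2)]] by simp
    finally have "F (u @ ?v) = \<one>\<^bsub>G\<^esub>" unfolding F_def
      by (intro free_basis_relation[OF assms]) (use uv v in auto)
    moreover have "map (\<lambda>(b, s). (f b, s)) ?v = rev (map (\<lambda>(b, s). (b, \<not> s)) (map (\<lambda>(b, s). (f b, s)) v))"
      by (simp add: rev_map case_prod_beta comp_def)
    then have "F (u @ ?v) = F u \<otimes>\<^bsub>G\<^esub> inv\<^bsub>G\<^esub> (F v)"
      unfolding F_def map_append using word_val_append[OF car(2)[OF uv(1)] car(2)[OF v]]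
        word_val_inverse[OF car(2)[OF uv(2)]] by simp
    ultimately show ?thesis
      using word_val_closed[OF car(2)[OF uv(1)]] word_val_closed[OF car(2)[OF uv(2)]]
      unfolding F_def by (metis inv_closed inv_equality inv_inv)
  qed
  define W where "W x = (SOME w. set w \<subseteq> B \<times> UNIV \<and> word_val G w = x)" for x
  have W: "set (W x) \<subseteq> B \<times> UNIV" "word_val G (W x) = x" if "x \<in> carrier G" for x
    using someI_ex[OF ex[OF that]] unfolding W_def by auto
  have "(\<lambda>x. F (W x)) \<in> hom G G"
  proof (rule homI)
    fix x assume x: "x \<in> carrier G"
    show "F (W x) \<in> carrier G" unfolding F_def by (intro word_val_closed car W x)
    fix y assume y: "y \<in> carrier G"
    have "F (W (x \<otimes>\<^bsub>G\<^esub> y)) = F (W x @ W y)"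
      by (rule wd) (use W x y word_val_append[OF car(1) car(1), of "W x" "W y"] in simp_all)
    also have "\<dots> = F (W x) \<otimes>\<^bsub>G\<^esub> F (W y)" unfolding F_def map_append
      by (intro word_val_append car W x y)
    finally show "F (W (x \<otimes>\<^bsub>G\<^esub> y)) = F (W x) \<otimes>\<^bsub>G\<^esub> F (W y)" .
  qed
  moreover have "F (W b) = f b" if b: "b \<in> B" for b
  proof -
    have "F (W b) = F [(b, True)]" by (rule wd) (use W b B in \<open>auto simp: letter_val_def\<close>)
    also have "\<dots> = f b" using funcset_mem[OF assms(3) b] by (simp add: F_def letter_val_def)
    finally show ?thesis .
  qed
  ultimately show ?thesis by (intro bexI[of _ "\<lambda>x. F (W x)"]) auto
qed

text \<open>Both extensions, b \<mapsto> b w and b \<mapsto> b w^(-1), fix \<open>w\<close> because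
  \<open>w\<close> avoids \<open>b\<close>; hence they are inverse to each other.\<close>

lemma transvection_auto:
  assumes "group G" "free_basis G B" "b \<in> B" "w \<in> generate G (B - {b})"
  shows "\<exists>\<alpha>\<in>auto G. \<alpha> b = b \<otimes>\<^bsub>G\<^esub> w \<and> (\<forall>c\<in>B - {b}. \<alpha> c = c)"
proof -
  interpret group G by fact
  have B: "B \<subseteq> carrier G" and gen: "generate G B = carrier G"
    using assms(2) by (auto simp: free_basis_def)
  have B': "B - {b} \<subseteq> carrier G" using B by blast
  have wc: "w \<in> carrier G" "b \<in> carrier G" using generate_in_carrier[OF B' assms(4)] B assms(3) by auto
  have id: "(\<lambda>x. x) \<in> hom G G" by (simp add: hom_def)
  have ex: "\<exists>h\<in>hom G G. h b = b \<otimes>\<^bsub>G\<^esub> v \<and> (\<forall>c\<in>B - {b}. h c = c) \<and> (\<forall>x\<in>generate G (B - {b}). h x = x)"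
    if v: "v \<in> carrier G" for v
  proof -
    have "(\<lambda>c. if c = b then b \<otimes>\<^bsub>G\<^esub> v else c) \<in> B \<rightarrow> carrier G" using v wc B by auto
    then obtain h where h: "h \<in> hom G G" "\<forall>c\<in>B. h c = (if c = b then b \<otimes>\<^bsub>G\<^esub> v else c)"
      using free_basis_extend[OF assms(1,2)] by blast
    have "h x = x" if "x \<in> generate G (B - {b})" for x
      using hom_eq_on_generate[OF assms(1,1) h(1) id B' _ that] h(2) by auto
    then show ?thesis using h assms(3) by (intro bexI[of _ h]) auto
  qed
  obtain h where h: "h \<in> hom G G" "h b = b \<otimes>\<^bsub>G\<^esub> w" "\<forall>c\<in>B - {b}. h c = c"
    "\<forall>x\<in>generate G (B - {b}). h x = x" using ex[OF wc(1)] by blast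
  obtain k where k: "k \<in> hom G G" "k b = b \<otimes>\<^bsub>G\<^esub> inv\<^bsub>G\<^esub> w" "\<forall>c\<in>B - {b}. k c = c"
    "\<forall>x\<in>generate G (B - {b}). k x = x" using ex[of "inv\<^bsub>G\<^esub> w"] wc by blast
  interpret h: group_hom G G h using h(1) by (simp add: group_hom_def group_hom_axioms_def assms(1))
  interpret k: group_hom G G k using k(1) by (simp add: group_hom_def group_hom_axioms_def assms(1))
  have hk: "h (k x) = x" if "x \<in> carrier G" for x
  proof (rule hom_eq_on_generate[OF assms(1,1) _ id B])
    show "(\<lambda>x. h (k x)) \<in> hom G G" by (simp add: hom_def)
    show "x \<in> generate G B" using that gen by simp
    fix c assume c: "c \<in> B"
    show "h (k c) = c"
      using c wc h(2-4) k(2,3) assms(4) B by (cases "c = b") (auto simp: m_assoc)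
  qed
  have kh: "k (h x) = x" if "x \<in> carrier G" for x
  proof (rule hom_eq_on_generate[OF assms(1,1) _ id B])
    show "(\<lambda>x. k (h x)) \<in> hom G G" by (simp add: hom_def)
    show "x \<in> generate G B" using that gen by simp
    fix c assume c: "c \<in> B"
    show "k (h c) = c"
      using c wc k(2-4) h(2,3) assms(4) B by (cases "c = b") (auto simp: m_assoc)
  qed
  have "bij_betw h (carrier G) (carrier G)"
    by (rule bij_betw_byWitness[where f' = k]) (use hk kh in auto)
  then have "bij_betw (restrict h (carrier G)) (carrier G) (carrier G)"
    by (subst bij_betw_cong[of _ _ h]) auto
  then have "restrict h (carrier G) \<in> auto G"
    by (auto simp: auto_def Bij_def hom_def)
  then show ?thesis using h B assms(3) by (intro bexI[of _ "restrict h (carrier G)"]) auto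
qed


section \<open>Trace orbits and normal forms\<close>

text \<open>The values taken on the orbit by the coordinate function "trace at \<open>g\<close>".
  The passage from the orbit to the image uses the orbit only through these sets.\<close>

definition orbit_traces :: "('g, 'b) monoid_scheme \<Rightarrow> ('g \<Rightarrow> mat2) \<Rightarrow> 'g \<Rightarrow> complex set" where
  "orbit_traces G \<rho> g = (\<lambda>\<alpha>. trace (\<rho> (\<alpha> g))) ` auto G"

lemma auto_closed: "\<alpha> \<in> auto G \<Longrightarrow> x \<in> carrier G \<Longrightarrow> \<alpha> x \<in> carrier G"
  by (auto simp: auto_def hom_def)

lemma Reps_SL2:
  assumes "group G" "\<rho> \<in> Reps G"
  shows "group_hom G SL2 \<rho>" and "x \<in> carrier G \<Longrightarrow> det (\<rho> x) = 1"
    and "x \<in> carrier G \<Longrightarrow> y \<in> carrier G \<Longrightarrow> \<rho> (x \<otimes>\<^bsub>G\<^esub> y) = \<rho> x ** \<rho> y"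
  using assms group_SL2
  by (auto simp: group_hom_def group_hom_axioms_def Reps_def hom_def Pi_iff)

lemma image_generate_Reps:
  assumes "group G" "\<rho> \<in> Reps G" "S \<subseteq> carrier G"
  shows "\<rho> ` generate G S = generate SL2 (\<rho> ` S)"
  by (rule group_hom.generate_img[OF Reps_SL2(1)[OF assms(1,2)] assms(3), symmetric])

lemma tr_set_subset_orbit_traces:
  assumes G: "group G" and B: "free_basis G B" and \<rho>: "\<rho> \<in> Reps G" and b: "b \<in> B"
  shows "tr_set \<rho> B b \<subseteq> orbit_traces G \<rho> b"
proof
  fix t assume "t \<in> tr_set \<rho> B b"
  then obtain h where h: "h \<in> generate SL2 (\<rho> ` (B - {b}))" "t = trace (\<rho> b ** h)"
    unfolding tr_set_def by blast
  interpret group G by fact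
  have Bc: "B \<subseteq> carrier G" "B - {b} \<subseteq> carrier G" using B by (auto simp: free_basis_def)
  obtain w where w: "w \<in> generate G (B - {b})" "h = \<rho> w"
    using h(1) image_generate_Reps[OF G \<rho> Bc(2)] by blast
  obtain \<alpha> where \<alpha>: "\<alpha> \<in> auto G" "\<alpha> b = b \<otimes>\<^bsub>G\<^esub> w" using transvection_auto[OF G B b w(1)] by blast
  have "w \<in> carrier G" using generate_in_carrier[OF Bc(2) w(1)] .
  then have "t = trace (\<rho> (\<alpha> b))"
    using h(2) w(2) \<alpha>(2) Reps_SL2(3)[OF G \<rho>] b Bc(1) by auto
  then show "t \<in> orbit_traces G \<rho> b" unfolding orbit_traces_def using \<alpha>(1) by blast
qed

lemma orbit_traces_compose:
  assumes G: "group G" and \<beta>: "\<beta> \<in> auto G" and g: "g \<in> carrier G"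
  shows "orbit_traces G (compose (carrier G) \<rho> \<beta>) g \<subseteq> orbit_traces G \<rho> g"
proof
  fix t assume "t \<in> orbit_traces G (compose (carrier G) \<rho> \<beta>) g"
  then obtain \<alpha> where \<alpha>: "\<alpha> \<in> auto G" "t = trace (compose (carrier G) \<rho> \<beta> (\<alpha> g))"
    unfolding orbit_traces_def by blast
  interpret A: group "AutoGroup G" using group.AutoGroup[OF G] .
  have "\<beta> \<otimes>\<^bsub>AutoGroup G\<^esub> \<alpha> \<in> carrier (AutoGroup G)"
    by (rule A.m_closed) (use \<alpha> \<beta> in \<open>simp_all add: AutoGroup_def\<close>)
  then have "compose (carrier G) \<beta> \<alpha> \<in> auto G"
    using \<alpha> \<beta> by (auto simp: AutoGroup_def BijGroup_def auto_def)
  moreover have "t = trace (\<rho> (compose (carrier G) \<beta> \<alpha> g))"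
    using \<alpha> g auto_closed[OF \<alpha>(1) g] by (simp add: compose_eq)
  ultimately show "t \<in> orbit_traces G \<rho> g" unfolding orbit_traces_def by blast
qed

lemma conj_rep_eq: "x \<in> carrier G \<Longrightarrow> conj_rep G P \<rho> x = P ** \<rho> x ** inv\<^bsub>SL2\<^esub> P"
  by (simp add: conj_rep_def)

lemma trace_conj: "det P = 1 \<Longrightarrow> trace (P ** X ** inv\<^bsub>SL2\<^esub> P) = trace X"
  by (subst trace_mult_commute) (simp add: SL2_cancel)

lemma orbit_traces_conj_rep:
  assumes "det P = 1" "g \<in> carrier G"
  shows "orbit_traces G (conj_rep G P \<rho>) g = orbit_traces G \<rho> g"
  unfolding orbit_traces_def
  by (rule image_cong) (use assms in \<open>auto simp: conj_rep_eq auto_closed trace_conj\<close>)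

lemma image_compose_auto:
  assumes "\<alpha> \<in> auto G"
  shows "compose (carrier G) \<rho> \<alpha> ` carrier G = \<rho> ` carrier G"
proof -
  have "\<alpha> ` carrier G = carrier G" using assms by (auto simp: auto_def Bij_def bij_betw_def)
  then have "\<rho> ` carrier G = (\<lambda>x. \<rho> (\<alpha> x)) ` carrier G" by (metis image_image)
  then show ?thesis by (simp add: compose_def)
qed

section \<open>Normalising an irreducible representation\<close>

text \<open>An eigenvector makes the matrix triangular, and if the diagonal entries differ, a
  unipotent conjugation removes the remaining off-diagonal entry. The case of equal diagonal entries
  is left to \<open>normal_form\<close>, where bounded traces exclude it.\<close>

lemma ex_triangular_conj:
  assumes "det X = 1"
  obtains P where "det P = 1" "(P ** X ** inv\<^bsub>SL2\<^esub> P)$2$1 = 0"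
    "(P ** X ** inv\<^bsub>SL2\<^esub> P)$1$1 = (P ** X ** inv\<^bsub>SL2\<^esub> P)$2$2 \<or> (P ** X ** inv\<^bsub>SL2\<^esub> P)$1$2 = 0"
proof -
  have "\<exists>Q. det Q = 1 \<and> (Q ** X ** inv\<^bsub>SL2\<^esub> Q)$2$1 = 0"
  proof (cases "X$2$1 = 0")
    case True
    have "det (mat 1 :: mat2) = 1" by (simp add: det_2)
    moreover have "inv\<^bsub>SL2\<^esub> (mat 1 :: mat2) = mat 1"
      by (simp add: SL2_inv det_2 mat2_eq_iff)
    ultimately show ?thesis using True by (intro exI[of _ "mat 1"]) simp
  next
    case False
    obtain z where z: "z \<noteq> 0" "trace X = z + 1 / z" using ex_trace_root by blast
    let ?v = "z - X$2$2" and ?w = "X$2$1"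
    \<comment> \<open>The first column of the inverse of \<open>?Q\<close> is (z - X22, X21), an
      eigenvector of \<open>X\<close> for the eigenvalue \<open>z\<close>.\<close>
    let ?Q = "mat22 0 (1 / ?w) (- ?w) ?v"
    have d: "det ?Q = 1" using False by (simp add: det_2)
    have "z * z - trace X * z + 1 = 0" using z by (simp add: field_simps)
    then have "z * z - (X$1$1 + X$2$2) * z + (X$1$1 * X$2$2 - X$1$2 * X$2$1) = 0"
      using assms by (simp add: trace_mat2 det_2)
    moreover have "(?Q ** X ** inv\<^bsub>SL2\<^esub> ?Q)$2$1 =
        X$2$1 * (z * z - (X$1$1 + X$2$2) * z + (X$1$1 * X$2$2 - X$1$2 * X$2$1))"
      unfolding SL2_inv[OF d] by (simp add: mat2_mult_nth) (simp add: algebra_simps)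
    ultimately have "(?Q ** X ** inv\<^bsub>SL2\<^esub> ?Q)$2$1 = 0" by simp
    then show ?thesis using d by blast
  qed
  then obtain Q where Q: "det Q = 1" "(Q ** X ** inv\<^bsub>SL2\<^esub> Q)$2$1 = 0" by blast
  define Y where "Y = Q ** X ** inv\<^bsub>SL2\<^esub> Q"
  show ?thesis
  proof (cases "Y$1$1 = Y$2$2")
    case True
    then show ?thesis using that[of Q] Q by (simp add: Y_def)
  next
    case False
    let ?T = "mat22 1 (Y$1$2 / (Y$1$1 - Y$2$2)) 0 1"
    have dT: "det ?T = 1" by (simp add: det_2)
    have "(?T ** Y ** inv\<^bsub>SL2\<^esub> ?T)$2$1 = 0" "(?T ** Y ** inv\<^bsub>SL2\<^esub> ?T)$1$2 = 0"
      using Q(2) False unfolding SL2_inv[OF dT] Y_def[symmetric]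
      by (simp add: mat2_mult_nth, simp add: mat2_mult_nth field_simps)
    moreover interpret group SL2 by (rule group_SL2)
    have "inv\<^bsub>SL2\<^esub> (?T ** Q) = inv\<^bsub>SL2\<^esub> Q ** inv\<^bsub>SL2\<^esub> ?T"
      using inv_mult_group[of ?T Q] dT Q(1) by simp
    then have "?T ** Y ** inv\<^bsub>SL2\<^esub> ?T = (?T ** Q) ** X ** inv\<^bsub>SL2\<^esub> (?T ** Q)"
      by (simp add: Y_def matrix_mul_assoc)
    moreover have "det (?T ** Q) = 1" using dT Q(1) by (simp add: det_mul)
    ultimately show ?thesis using that[of "?T ** Q"] by simp
  qed
qed

text \<open>An off-diagonal entry vanishing on all generators would produce a common eigenvector.\<close>

lemma irreducible_conj_entry:
  assumes G: "group G" and gen: "generate G B = carrier G" "B \<subseteq> carrier G" and \<rho>: "\<rho> \<in> Reps G"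
    and irr: "irreducible_rep G \<rho>" and P: "det P = 1"
  shows "\<exists>b\<in>B. (P ** \<rho> b ** inv\<^bsub>SL2\<^esub> P)$2$1 \<noteq> 0" (is ?th1)
    and "\<exists>b\<in>B. (P ** \<rho> b ** inv\<^bsub>SL2\<^esub> P)$1$2 \<noteq> 0" (is ?th2)
proof -
  have main: "\<exists>b\<in>B. (P ** \<rho> b ** inv\<^bsub>SL2\<^esub> P)$2$1 \<noteq> 0" if P: "det P = 1" for P
  proof (rule ccontr)
    assume n: "\<not> ?thesis"
    \<comment> \<open>This is the first column of the inverse of \<open>P\<close>. A matrix
      \<open>X\<close> preserves its line exactly when the (2,1) entry of the conjugate by
      \<open>P\<close> vanishes; \<open>par\<close> is proportionality to \<open>v\<close>.\<close>
    define v :: "complex^2" where "v = vector [P$2$2, - P$2$1]"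
    have v: "v$1 = P$2$2" "v$2 = - P$2$1" by (simp_all add: v_def)
    have mv: "(X *v w)$i = X$i$1 * w$1 + X$i$2 * w$2" for X :: mat2 and w i
      by (simp add: matrix_vector_mult_def sum_2)
    define par where "par u \<longleftrightarrow> u$1 * v$2 = u$2 * v$1" for u :: "complex^2"
    define E where "E = {X. det X = 1 \<and> par (X *v v)}"
    have v0: "v$1 \<noteq> 0 \<or> v$2 \<noteq> 0" using P by (auto simp: v det_2)
    have par: "\<exists>c. u = c *s v" if "par u" for u
    proof -
      have "u = (if v$1 \<noteq> 0 then u$1 / v$1 else u$2 / v$2) *s v"
        using v0 that by (auto simp: vec_eq_iff forall_2 par_def field_simps)
      then show ?thesis by blast
    qed
    have E_par: "par (X *v u)" if "X \<in> E" "par u" for X u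
    proof -
      obtain c where "u = c *s v" using par \<open>par u\<close> by blast
      then have "(X *v u)$i = c * (X *v v)$i" for i by (simp add: mv algebra_simps)
      then show ?thesis using that(1) by (simp add: E_def par_def mult.assoc)
    qed
    have "\<rho> b \<in> E" if b: "b \<in> B" for b
    proof -
      have "(P ** \<rho> b ** inv\<^bsub>SL2\<^esub> P)$2$1 = 0" using n b by blast
      then have "P$2$1 * (\<rho> b *v v)$1 + P$2$2 * (\<rho> b *v v)$2 = 0"
        unfolding SL2_inv[OF P] by (simp add: mat2_mult_nth mv v algebra_simps)
      then have "(\<rho> b *v v)$2 * P$2$2 = - ((\<rho> b *v v)$1 * P$2$1)"
        by (simp add: eq_neg_iff_add_eq_0 mult.commute add.commute)
      then show ?thesis using Reps_SL2(2)[OF G \<rho>] b gen(2) by (auto simp: E_def par_def v)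
    qed
    moreover have "X \<in> E" if "X \<in> generate SL2 S" "S \<subseteq> E" for X S
      using that(1)
    proof (induction rule: generate.induct)
      case one
      then show ?case by (simp add: E_def par_def det_2)
    next
      case (incl h)
      then show ?case using that(2) by blast
    next
      case (inv h)
      then have h: "det h = 1" "par (h *v v)" using that(2) by (auto simp: E_def)
      have "det (inv\<^bsub>SL2\<^esub> h) = 1"
        using h(1) unfolding SL2_inv[OF h(1)] by (simp add: det_2 mult.commute)
      moreover have "par (inv\<^bsub>SL2\<^esub> h *v v)"
        using h(2) unfolding SL2_inv[OF h(1)] by (simp add: par_def mv algebra_simps)
      ultimately show ?case by (simp add: E_def)
    next
      case (eng h1 h2)
      have "par (h1 *v (h2 *v v))"
        by (rule E_par[OF eng.IH(1)]) (use eng.IH(2) in \<open>simp add: E_def\<close>)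
      then show ?case using eng.IH by (simp add: E_def det_mul matrix_vector_mul_assoc)
    qed
    ultimately have gE: "\<rho> g \<in> E" if "g \<in> carrier G" for g
      using image_generate_Reps[OF G \<rho> gen(2)] gen(1) that by blast
    have "vec.subspace {u. par u}"
      by (simp add: vec.subspace_def par_def algebra_simps)
    moreover have "\<forall>g\<in>carrier G. \<forall>u\<in>{u. par u}. \<rho> g *v u \<in> {u. par u}"
      using gE E_par by blast
    ultimately consider "{u. par u} = {0}" | "{u. par u} = UNIV"
      using irr unfolding irreducible_rep_def by blast
    then show False
    proof cases
      case 1
      have "par v" by (simp add: par_def)
      then have "v = 0" using 1 by blast
      then show False using v0 by simp
    next
      case 2
      then have "par (vector [1, 0])" "par (vector [0, 1])" by blast+
      then show False using v0 by (simp add: par_def)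
    qed
  qed
  show ?th1 by (rule main[OF P])
  \<comment> \<open>Conjugation by \<open>?J\<close> exchanges the two basis lines and so turns the
    entry (1,2) into (2,1), up to sign.\<close>
  let ?J = "mat22 0 1 (-1) 0"
  have J: "det ?J = 1" by (simp add: det_2)
  interpret group SL2 by (rule group_SL2)
  have inv: "inv\<^bsub>SL2\<^esub> (?J ** P) = inv\<^bsub>SL2\<^esub> P ** inv\<^bsub>SL2\<^esub> ?J"
    using inv_mult_group[of ?J P] J P by simp
  have "((?J ** P) ** X ** inv\<^bsub>SL2\<^esub> (?J ** P))$2$1 = - (P ** X ** inv\<^bsub>SL2\<^esub> P)$1$2" for X
  proof -
    have "(?J ** P) ** X ** inv\<^bsub>SL2\<^esub> (?J ** P) = ?J ** (P ** X ** inv\<^bsub>SL2\<^esub> P) ** inv\<^bsub>SL2\<^esub> ?J"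
      unfolding inv by (simp add: matrix_mul_assoc)
    then show ?thesis unfolding SL2_inv[OF J] by (simp add: mat2_mult_nth[of "?J ** _"] mat2_mult_nth[of ?J])
  qed
  moreover have "det (?J ** P) = 1" using J P by (simp add: det_mul)
  ultimately show ?th2 using main[of "?J ** P"] by simp
qed

text \<open>The characteristic polynomial is (t - e)^2, so e X - 1 squares to zero and X^n = e^n (1
  + n (e X - 1)). The trace therefore grows linearly in n, up to sign.\<close>

lemma trace_parabolic_pow:
  fixes W X :: mat2
  assumes "det X = 1" "trace X = 2 * e" "e * e = 1"
  shows "trace (W ** X [^]\<^bsub>SL2\<^esub> (n::nat)) = e ^ n * (trace W + of_nat n * (e * trace (W ** X) - trace W))"
proof (induction n rule: induct_nat_012)
  case 0
  then show ?case by simp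
next
  case 1
  have "trace (W ** X) = (e * e) * trace (W ** X)" using assms(3) by simp
  then show ?case by (simp add: algebra_simps)
next
  case (ge2 n)
  let ?V = "W ** X [^]\<^bsub>SL2\<^esub> n"
  have "trace (W ** X [^]\<^bsub>SL2\<^esub> Suc (Suc n)) = trace (?V ** (X ** X))"
    by (simp add: matrix_mul_assoc)
  also have "\<dots> = trace X * trace (?V ** X) - trace ?V"
    unfolding SL2_cayley_hamilton[OF assms(1)] by (simp add: mat2_simps algebra_simps)
  also have "trace (?V ** X) = trace (W ** X [^]\<^bsub>SL2\<^esub> Suc n)" by (simp add: matrix_mul_assoc)
  finally have "trace (W ** X [^]\<^bsub>SL2\<^esub> Suc (Suc n)) =
     2 * e * (e ^ Suc n * (trace W + of_nat (Suc n) * (e * trace (W ** X) - trace W)))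
      - e * e * (e ^ n * (trace W + of_nat n * (e * trace (W ** X) - trace W)))"
    unfolding ge2 assms(2) using assms(3) by simp
  also have "\<dots> = e ^ Suc (Suc n) * (trace W + of_nat (Suc (Suc n)) * (e * trace (W ** X) - trace W))"
    by (simp add: algebra_simps)
  finally show ?case .
qed

lemma bounded_trace_parabolic:
  fixes W X :: mat2
  assumes X: "det X = 1" "trace X = 2 * e" "e * e = 1"
    and C: "\<And>n. norm (trace (W ** X [^]\<^bsub>SL2\<^esub> (n::nat))) \<le> C"
  shows "e * trace (W ** X) = trace W"
proof (rule ccontr)
  assume ne: "\<not> ?thesis"
  let ?d = "e * trace (W ** X) - trace W"
  have d: "norm ?d > 0" using ne by simp
  have "norm e * norm e = 1" using X(3) by (metis norm_mult norm_one)
  then have e: "norm e = 1" by (metis abs_norm_cancel real_sqrt_abs2 real_sqrt_one)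
  obtain n where n: "C + norm (trace W) < of_nat n * norm ?d" using ex_less_of_nat_mult[OF d] by blast
  have "of_nat n * norm ?d = norm (of_nat n * ?d)" by (simp add: norm_mult)
  also have "\<dots> \<le> norm (trace W + of_nat n * ?d) + norm (trace W)"
    using norm_triangle_ineq4[of "trace W + of_nat n * ?d" "trace W"] by simp
  also have "norm (trace W + of_nat n * ?d) \<le> C"
    using C[of n] unfolding trace_parabolic_pow[OF X] by (simp add: norm_mult norm_power e)
  finally show False using n by linarith
qed

lemma SL2_inv_mult: "det X = 1 \<Longrightarrow> det Y = 1 \<Longrightarrow> inv\<^bsub>SL2\<^esub> (X ** Y) = inv\<^bsub>SL2\<^esub> Y ** inv\<^bsub>SL2\<^esub> X"
  using group.inv_mult_group[OF group_SL2, of X Y] by simp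

lemma SL2_conj_cancel: "det P = 1 \<Longrightarrow> inv\<^bsub>SL2\<^esub> P ** (P ** X ** inv\<^bsub>SL2\<^esub> P) ** P = X"
  by (metis SL2_cancel(1,3) matrix_mul_assoc matrix_mul_rid)

text \<open>Conjugation by diag(s, 1/s) fixes the diagonal and multiplies the upper off-diagonal
  entry by s^2, so s^2 is taken to be the inverse of that entry.\<close>

lemma normal_pair_rescale:
  assumes "det P = 1" "normal_pair (P ** X ** inv\<^bsub>SL2\<^esub> P) (P ** Y ** inv\<^bsub>SL2\<^esub> P)"
  obtains Q where "det Q = 1" "normal_pair (Q ** X ** inv\<^bsub>SL2\<^esub> Q) (Q ** Y ** inv\<^bsub>SL2\<^esub> Q)"
    "(Q ** Y ** inv\<^bsub>SL2\<^esub> Q)$1$2 = 1"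
proof -
  let ?Y = "P ** Y ** inv\<^bsub>SL2\<^esub> P"
  define s where "s = csqrt (1 / ?Y$1$2)"
  have ne: "?Y$1$2 \<noteq> 0" using assms(2) by (simp add: normal_pair_def)
  have "s\<^sup>2 = 1 / ?Y$1$2" by (simp add: s_def)
  then have s: "s * s * ?Y$1$2 = 1" using ne by (simp add: power2_eq_square)
  then have s0: "s \<noteq> 0" by auto
  let ?D = "mat22 s 0 0 (1 / s)"
  have d: "det ?D = 1" using s0 by (simp add: det_2)
  have conj: "(?D ** P) ** Z ** inv\<^bsub>SL2\<^esub> (?D ** P) =
      mat22 ((P ** Z ** inv\<^bsub>SL2\<^esub> P)$1$1) (s * s * (P ** Z ** inv\<^bsub>SL2\<^esub> P)$1$2)
            ((P ** Z ** inv\<^bsub>SL2\<^esub> P)$2$1 / (s * s)) ((P ** Z ** inv\<^bsub>SL2\<^esub> P)$2$2)" for Z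
  proof -
    have "(?D ** P) ** Z ** inv\<^bsub>SL2\<^esub> (?D ** P) = ?D ** (P ** Z ** inv\<^bsub>SL2\<^esub> P) ** inv\<^bsub>SL2\<^esub> ?D"
      by (simp add: SL2_inv_mult[OF d assms(1)] matrix_mul_assoc)
    moreover have "?D ** W ** inv\<^bsub>SL2\<^esub> ?D = mat22 (W$1$1) (s * s * W$1$2) (W$2$1 / (s * s)) (W$2$2)" for W
      unfolding SL2_inv[OF d] using s0 by (simp add: mat2_eq_iff mat2_mult_nth)
    ultimately show ?thesis by simp
  qed
  show ?thesis
  proof (rule that[of "?D ** P"])
    show "det (?D ** P) = 1" using d assms(1) by (simp add: det_mul)
    show "normal_pair (?D ** P ** X ** inv\<^bsub>SL2\<^esub> (?D ** P)) (?D ** P ** Y ** inv\<^bsub>SL2\<^esub> (?D ** P))"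
      using assms(2) s0 unfolding conj normal_pair_def by simp
    show "(?D ** P ** Y ** inv\<^bsub>SL2\<^esub> (?D ** P))$1$2 = 1" unfolding conj using s by simp
  qed
qed

text \<open>If no generator has both off-diagonal entries nonzero in the eigenbasis of \<open>b1\<close>, multiplying an
  upper triangular generator by a lower triangular one yields such an element.\<close>

lemma normal_form:
  assumes G: "group G" and B: "free_basis G B" and \<rho>: "\<rho> \<in> Reps G" and irr: "irreducible_rep G \<rho>"
    and bd: "\<And>b. b \<in> B \<Longrightarrow> bounded (tr_set \<rho> B b)"
  obtains \<tau> P b1 b2 where "\<tau> \<in> auto G" "det P = 1" "b1 \<in> B" "b2 \<in> B"
    "normal_pair (conj_rep G P (compose (carrier G) \<rho> \<tau>) b1) (conj_rep G P (compose (carrier G) \<rho> \<tau>) b2)"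
    "conj_rep G P (compose (carrier G) \<rho> \<tau>) b2 $ 1 $ 2 = 1"
proof -
  interpret group G by fact
  note result = that
  have Bc: "B \<subseteq> carrier G" and gen: "generate G B = carrier G" using B by (auto simp: free_basis_def)
  note entry = irreducible_conj_entry[OF G gen Bc \<rho> irr]
  have det: "det (\<rho> b) = 1" if "b \<in> B" for b using Reps_SL2(2)[OF G \<rho>] Bc that by blast
  have I1: "det (mat 1 :: mat2) = 1" by (simp add: det_2)
  have I2: "inv\<^bsub>SL2\<^esub> (mat 1 :: mat2) = mat 1" unfolding SL2_inv[OF I1] by (simp add: mat2_eq_iff)
  \<comment> \<open>The nonzero entry ensures that the image of \<open>b1\<close> is not scalar,
    which later gives distinct eigenvalues.\<close>
  obtain b1 where b1: "b1 \<in> B" "\<rho> b1 $ 2 $ 1 \<noteq> 0" using entry(1)[OF I1] unfolding I2 by auto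
  obtain P where P: "det P = 1" "(P ** \<rho> b1 ** inv\<^bsub>SL2\<^esub> P)$2$1 = 0"
    "(P ** \<rho> b1 ** inv\<^bsub>SL2\<^esub> P)$1$1 = (P ** \<rho> b1 ** inv\<^bsub>SL2\<^esub> P)$2$2 \<or> (P ** \<rho> b1 ** inv\<^bsub>SL2\<^esub> P)$1$2 = 0"
    using ex_triangular_conj[OF det[OF b1(1)]] by blast
  define Y where "Y x = P ** \<rho> x ** inv\<^bsub>SL2\<^esub> P" for x
  have Ymult: "Y (x \<otimes>\<^bsub>G\<^esub> y) = Y x ** Y y" if "x \<in> carrier G" "y \<in> carrier G" for x y
  proof -
    have "Y x ** Y y = P ** \<rho> x ** (inv\<^bsub>SL2\<^esub> P ** (P ** (\<rho> y ** inv\<^bsub>SL2\<^esub> P)))"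
      by (simp add: Y_def matrix_mul_assoc)
    also have "\<dots> = Y (x \<otimes>\<^bsub>G\<^esub> y)" unfolding SL2_cancel(3)[OF P(1)] Y_def Reps_SL2(3)[OF G \<rho> that]
      by (simp add: matrix_mul_assoc)
    finally show ?thesis by simp
  qed
  have detY: "det (Y x) = 1" if "x \<in> B" for x
  proof -
    have "det (inv\<^bsub>SL2\<^esub> P) = 1" using P(1) unfolding SL2_inv[OF P(1)] by (simp add: det_2 mult.commute)
    then show ?thesis using det[OF that] P(1) by (simp add: Y_def det_mul)
  qed
  have Y21: "Y b1 $ 2 $ 1 = 0" using P(2) by (simp add: Y_def)
  \<comment> \<open>Otherwise \<open>Y b1\<close> is parabolic. For a generator \<open>c\<close>
    with nonzero lower-left entry, the traces of \<rho>(c) times powers of \<rho>(b1) lie in a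
    bounded set, but their linear growth has slope \<open>e * (Y c $ 2 $ 1 * Y b1 $ 1 $ 2)\<close>,
    which is nonzero.\<close>
  have diag: "Y b1 $ 1 $ 2 = 0"
  proof (rule ccontr)
    assume u: "Y b1 $ 1 $ 2 \<noteq> 0"
    define e where "e = Y b1 $ 1 $ 1"
    have e: "Y b1 $ 2 $ 2 = e" using P(3) u by (simp add: Y_def e_def)
    have ee: "e * e = 1" using detY[OF b1(1)] Y21 e by (simp add: det_2 e_def[symmetric])
    have tr: "trace (\<rho> b1) = 2 * e"
      using trace_conj[OF P(1), of "\<rho> b1"] e by (simp add: Y_def[symmetric] trace_mat2 e_def)
    obtain c where c: "c \<in> B" "Y c $ 2 $ 1 \<noteq> 0" using entry(1)[OF P(1)] unfolding Y_def by blast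
    then have "c \<noteq> b1" using Y21 by auto
    obtain C where C: "\<And>t. t \<in> tr_set \<rho> B c \<Longrightarrow> norm t \<le> C" using bd[OF c(1)] by (auto simp: bounded_iff)
    have S: "\<forall>X\<in>\<rho> ` (B - {c}). det X = 1" using det by auto
    have "\<rho> b1 [^]\<^bsub>SL2\<^esub> n \<in> sub_gen \<rho> B c" for n :: nat
      by (rule generate_SL2_pow[OF S generate_SL2(2)[OF S]]) (use b1 \<open>c \<noteq> b1\<close> in auto)
    then have "norm (trace (\<rho> c ** \<rho> b1 [^]\<^bsub>SL2\<^esub> n)) \<le> C" for n :: nat
      by (intro C) (auto simp: tr_set_def)
    then have "e * trace (\<rho> c ** \<rho> b1) = trace (\<rho> c)"
      by (rule bounded_trace_parabolic[OF det[OF b1(1)] tr ee])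
    moreover have "trace (\<rho> c ** \<rho> b1) = trace (Y c ** Y b1)"
    proof -
      have "c \<in> carrier G" "b1 \<in> carrier G" using c b1 Bc by auto
      then have "Y c ** Y b1 = P ** (\<rho> c ** \<rho> b1) ** inv\<^bsub>SL2\<^esub> P"
        using Ymult[of c b1] Reps_SL2(3)[OF G \<rho>, of c b1] by (simp add: Y_def)
      then show ?thesis using trace_conj[OF P(1), of "\<rho> c ** \<rho> b1"] by simp
    qed
    moreover have "trace (\<rho> c) = trace (Y c)" using trace_conj[OF P(1)] by (simp add: Y_def)
    ultimately have "e * trace (Y c ** Y b1) = trace (Y c)" by simp
    moreover have "e * trace (Y c ** Y b1) = (e * e) * trace (Y c) + e * (Y c $ 2 $ 1 * Y b1 $ 1 $ 2)"
      by (simp add: trace_mat2 mat2_mult_nth e Y21 e_def[symmetric] algebra_simps)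
    ultimately have "e * (Y c $ 2 $ 1 * Y b1 $ 1 $ 2) = 0" using ee by simp
    then show False using c(2) u ee by auto
  qed
  have ne: "Y b1 $ 1 $ 1 \<noteq> Y b1 $ 2 $ 2"
  proof
    assume "Y b1 $ 1 $ 1 = Y b1 $ 2 $ 2"
    then have Yb: "Y b1 = mat22 (Y b1 $ 1 $ 1) 0 0 (Y b1 $ 1 $ 1)" using Y21 diag by (simp add: mat2_eq_iff)
    have "\<rho> b1 = inv\<^bsub>SL2\<^esub> P ** Y b1 ** P" unfolding Y_def SL2_conj_cancel[OF P(1)] ..
    then have "\<rho> b1 $ 2 $ 1 = 0" unfolding SL2_inv[OF P(1)] by (subst (asm) Yb) (simp add: mat2_mult_nth)
    then show False using b1(2) by simp
  qed
  have finish: thesis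
    if t: "\<tau> \<in> auto G" and b2: "b2 \<in> B" and e: "\<tau> b1 = b1" "Y (\<tau> b2) $ 1 $ 2 \<noteq> 0" "Y (\<tau> b2) $ 2 $ 1 \<noteq> 0" for \<tau> b2
  proof -
    have "normal_pair (P ** \<rho> (\<tau> b1) ** inv\<^bsub>SL2\<^esub> P) (P ** \<rho> (\<tau> b2) ** inv\<^bsub>SL2\<^esub> P)"
      using Y21 diag ne e by (simp add: normal_pair_def Y_def)
    then obtain Q where Q: "det Q = 1"
      "normal_pair (Q ** \<rho> (\<tau> b1) ** inv\<^bsub>SL2\<^esub> Q) (Q ** \<rho> (\<tau> b2) ** inv\<^bsub>SL2\<^esub> Q)"
      "(Q ** \<rho> (\<tau> b2) ** inv\<^bsub>SL2\<^esub> Q)$1$2 = 1"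
      using normal_pair_rescale[OF P(1)] by blast
    have "conj_rep G Q (compose (carrier G) \<rho> \<tau>) b = Q ** \<rho> (\<tau> b) ** inv\<^bsub>SL2\<^esub> Q" if "b \<in> B" for b
      using that Bc by (auto simp: conj_rep_def compose_def)
    then show thesis using result[OF t Q(1) b1(1) b2] Q b1(1) b2 by simp
  qed
  obtain b2 where b2: "b2 \<in> B" "Y b2 $ 1 $ 2 \<noteq> 0" using entry(2)[OF P(1)] unfolding Y_def by blast
  obtain b3 where b3: "b3 \<in> B" "Y b3 $ 2 $ 1 \<noteq> 0" using entry(1)[OF P(1)] unfolding Y_def by blast
  have id: "(\<lambda>x\<in>carrier G. x) \<in> auto G" by (rule id_in_auto)
  show thesis
  proof (cases "Y b2 $ 2 $ 1 = 0 \<and> Y b3 $ 1 $ 2 = 0")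
    case False
    then consider "Y b2 $ 2 $ 1 \<noteq> 0" | "Y b3 $ 1 $ 2 \<noteq> 0" by blast
    then show thesis
    proof cases
      case 1
      then show thesis by (intro finish[OF id b2(1)]) (use b1 b2 Bc in auto)
    next
      case 2
      then show thesis by (intro finish[OF id b3(1)]) (use b1 b3 Bc in auto)
    qed
  next
    case True
    \<comment> \<open>Since \<open>Y b1\<close> is diagonal, \<open>b2\<close> differs from
      \<open>b1\<close>, so the transvection at \<open>b2\<close> fixes \<open>b1\<close> and keeps
      its normal form.\<close>
    then have d: "b2 \<noteq> b3" "b2 \<noteq> b1" using b2 b3 diag by auto
    have "b3 \<in> generate G (B - {b2})" by (rule generate.incl) (use b3 d in auto)
    then obtain \<tau> where \<tau>: "\<tau> \<in> auto G" "\<tau> b2 = b2 \<otimes>\<^bsub>G\<^esub> b3" "\<forall>c\<in>B - {b2}. \<tau> c = c"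
      using transvection_auto[OF G B b2(1)] by blast
    have Yt: "Y (\<tau> b2) = Y b2 ** Y b3" using \<tau>(2) Ymult b2 b3 Bc by auto
    have "Y b2 $ 1 $ 1 * Y b2 $ 2 $ 2 = 1" "Y b3 $ 1 $ 1 * Y b3 $ 2 $ 2 = 1"
      using detY[OF b2(1)] detY[OF b3(1)] True by (simp_all add: det_2)
    then have "Y b2 $ 2 $ 2 \<noteq> 0" "Y b3 $ 2 $ 2 \<noteq> 0" by auto
    then show thesis
      by (intro finish[OF \<tau>(1) b2(1)]) (use \<tau>(3) b1 b2 b3 d True in \<open>auto simp: Yt mat2_mult_nth\<close>)
  qed
qed

lemma bounded_conj_rep:
  assumes "det P = 1" "bounded (conj_rep G P \<rho> ` carrier G)"
  shows "bounded (\<rho> ` carrier G)"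
proof -
  obtain C where C: "\<And>g i j. g \<in> carrier G \<Longrightarrow> norm ((conj_rep G P \<rho> g)$i$j) \<le> C"
    using assms(2) unfolding bounded_mat2_iff by blast
  obtain D where D: "\<And>i j. norm (P$i$j) \<le> D" "\<And>i j. norm ((inv\<^bsub>SL2\<^esub> P)$i$j) \<le> D"
    using bounded_mat2_iff[of "{P, inv\<^bsub>SL2\<^esub> P}"] by auto
  have "norm (\<rho> g $ i $ j) \<le> 4 * (D * C * D)" if g: "g \<in> carrier G" for g i j
  proof -
    have D0: "0 \<le> D" using order_trans[OF norm_ge_zero D(1)] .
    let ?X = "conj_rep G P \<rho> g" and ?J = "inv\<^bsub>SL2\<^esub> P"
    have C0: "0 \<le> C" using order_trans[OF norm_ge_zero C[OF g]] .
    have e: "\<rho> g = ?J ** ?X ** P" unfolding conj_rep_eq[OF g] SL2_conj_cancel[OF assms(1)] ..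
    have t: "norm (?J$i$k * ?X$k$l * P$l$j) \<le> D * C * D" for k l
      unfolding norm_mult by (intro mult_mono D C g D0 C0 mult_nonneg_nonneg norm_ge_zero)
    have "\<rho> g $ i $ j = (?J$i$1 * ?X$1$1 * P$1$j + ?J$i$2 * ?X$2$1 * P$1$j) +
       (?J$i$1 * ?X$1$2 * P$2$j + ?J$i$2 * ?X$2$2 * P$2$j)"
      unfolding e by (simp add: mat2_mult_nth[of _ P] mat2_mult_nth[of ?J] distrib_right)
    also have "norm \<dots> \<le> (D * C * D + D * C * D) + (D * C * D + D * C * D)"
      by (intro norm_triangle_le add_mono order_trans[OF norm_triangle_ineq] t)
    also have "\<dots> = 4 * (D * C * D)" by simp
    finally show ?thesis .
  qed
  then show ?thesis unfolding bounded_mat2_iff by blast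
qed

lemma finite_conj_rep:
  assumes "det P = 1" "finite (conj_rep G P \<rho> ` carrier G)"
  shows "finite (\<rho> ` carrier G)"
proof (rule finite_subset)
  show "\<rho> ` carrier G \<subseteq> (\<lambda>X. inv\<^bsub>SL2\<^esub> P ** X ** P) ` (conj_rep G P \<rho> ` carrier G)"
  proof
    fix X assume "X \<in> \<rho> ` carrier G"
    then obtain g where g: "g \<in> carrier G" "X = \<rho> g" by blast
    have "X = inv\<^bsub>SL2\<^esub> P ** conj_rep G P \<rho> g ** P"
      unfolding conj_rep_eq[OF g(1)] SL2_conj_cancel[OF assms(1)] g(2) ..
    then show "X \<in> (\<lambda>X. inv\<^bsub>SL2\<^esub> P ** X ** P) ` (conj_rep G P \<rho> ` carrier G)" using g(1) by blast
  qed
qed (use assms(2) in blast)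


section \<open>The topology of the character variety\<close>

lemma trace_invariant_fun:
  assumes G: "group G" and g: "g \<in> carrier G"
  shows "(\<lambda>\<rho>\<in>Reps G. trace (\<rho> g)) \<in> invariant_funs G"
proof -
  have "(\<lambda>\<rho>\<in>Reps G. (\<lambda>\<rho>\<in>Reps G. \<rho> g $ 1 $ 1) \<rho> + (\<lambda>\<rho>\<in>Reps G. \<rho> g $ 2 $ 2) \<rho>) \<in> regular_funs G"
    by (intro regular_funs.add regular_funs.entry g)
  moreover have "(\<lambda>\<rho>\<in>Reps G. (\<lambda>\<rho>\<in>Reps G. \<rho> g $ 1 $ 1) \<rho> + (\<lambda>\<rho>\<in>Reps G. \<rho> g $ 2 $ 2) \<rho>) =
      (\<lambda>\<rho>\<in>Reps G. trace (\<rho> g))"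
    by (rule restrict_ext) (simp add: trace_mat2)
  ultimately have "(\<lambda>\<rho>\<in>Reps G. trace (\<rho> g)) \<in> regular_funs G" by simp
  then show ?thesis
    using G g by (simp add: invariant_funs_def conj_rep_Reps conj_rep_eq trace_conj)
qed

lemma orbit_traces_char_class:
  assumes G: "group G" and \<rho>: "\<rho> \<in> Reps G" and g: "g \<in> carrier G"
  shows "orbit_traces G \<rho> g = (\<lambda>\<phi>. \<phi> (\<lambda>\<rho>\<in>Reps G. trace (\<rho> g))) ` out_orbit G (char_class G \<rho>)"
  unfolding out_orbit_char_class[OF G \<rho>] image_image orbit_traces_def
  by (rule image_cong)
     (simp_all add: char_class_def trace_invariant_fun[OF G g] compose_Reps[OF G \<rho>] g compose_eq)

text \<open>Evaluation at an invariant function is continuous, so it maps the compact closure of the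
  orbit to a compact set of numbers.\<close>

lemma bounded_orbit_traces:
  assumes G: "group G" and \<rho>: "\<rho> \<in> Reps G" and g: "g \<in> carrier G"
    and b: "bounded_in (char_topology G) (out_orbit G (char_class G \<rho>))"
  shows "bounded (orbit_traces G \<rho> g)"
proof -
  let ?O = "out_orbit G (char_class G \<rho>)" and ?X = "char_topology G"
  let ?t = "\<lambda>\<rho>\<in>Reps G. trace (\<rho> g)"
  have "continuous_map ?X euclidean (\<lambda>\<phi>. \<phi> ?t)"
    unfolding char_topology_def
    by (intro continuous_map_from_subtopology continuous_map_product_projection trace_invariant_fun[OF G g])
  then have "compactin euclidean ((\<lambda>\<phi>. \<phi> ?t) ` (?X closure_of ?O))"
    using b image_compactin unfolding bounded_in_def by blast
  then have "bounded ((\<lambda>\<phi>. \<phi> ?t) ` (?X closure_of ?O))" by (simp add: compact_imp_bounded)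
  moreover have "?O \<subseteq> ?X closure_of ?O" using b by (simp add: bounded_in_def closure_of_subset)
  ultimately show ?thesis unfolding orbit_traces_char_class[OF G \<rho> g]
    by (meson bounded_subset image_mono)
qed

text \<open>The group is closed in the space of matrices, so closures agree and compactness of the
  closure is boundedness by Heine-Borel.\<close>

lemma bounded_in_SL2_iff:
  assumes "S \<subseteq> carrier SL2"
  shows "bounded_in SL2_topology S \<longleftrightarrow> bounded S"
proof -
  have "closed {A :: mat2. det A = 1}"
    unfolding det_2 by (intro closed_Collect_eq continuous_intros)
  then have c: "closed (carrier SL2)" by (simp add: SL2_def)
  have "SL2_topology closure_of S = closure S"
    using closure_minimal[OF assms c] assms by (simp add: closure_of_subtopology Int_absorb1)
  moreover have "compactin SL2_topology (closure S) \<longleftrightarrow> compact (closure S)"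
    using closure_minimal[OF assms c] by (simp add: compactin_subtopology)
  ultimately show ?thesis using assms by (simp add: bounded_in_def compact_closure)
qed

section \<open>From the image to the orbit\<close>

text \<open>A representation in the orbit is determined by its values on the finite basis, and these
  lie in the finite image of \<rho>.\<close>

lemma finite_orbit_of_finite_image:
  assumes G: "group G" and B: "free_basis G B" "finite B" and \<rho>: "\<rho> \<in> Reps G" and fin: "finite (\<rho> ` carrier G)"
  shows "finite (out_orbit G (char_class G \<rho>))"
proof -
  have Bc: "B \<subseteq> carrier G" and gen: "generate G B = carrier G" using B by (auto simp: free_basis_def)
  let ?R = "compose (carrier G) \<rho> ` auto G"
  have "finite ((\<lambda>\<sigma>. restrict \<sigma> B) ` ?R)"
  proof (rule finite_subset)
    show "(\<lambda>\<sigma>. restrict \<sigma> B) ` ?R \<subseteq> B \<rightarrow>\<^sub>E \<rho> ` carrier G"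
      using Bc auto_closed by (fastforce simp: compose_def)
  qed (intro finite_PiE B fin)
  moreover have "inj_on (\<lambda>\<sigma>. restrict \<sigma> B) ?R"
  proof (rule inj_onI)
    fix \<sigma> \<sigma>' assume s: "\<sigma> \<in> ?R" "\<sigma>' \<in> ?R" and e: "restrict \<sigma> B = restrict \<sigma>' B"
    have R: "\<sigma> \<in> Reps G" "\<sigma>' \<in> Reps G" using s compose_Reps[OF G \<rho>] by auto
    have eB: "\<sigma> b = \<sigma>' b" if "b \<in> B" for b using e that by (metis restrict_apply')
    show "\<sigma> = \<sigma>'"
    proof (rule extensionalityI[of _ "carrier G"])
      fix x assume "x \<in> carrier G"
      then have "x \<in> generate G B" using gen by simp
      then show "\<sigma> x = \<sigma>' x"
        by (rule hom_eq_on_generate[OF G group_SL2 _ _ Bc eB, rotated -1]) (use R in \<open>auto simp: Reps_def\<close>)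
    qed (use R in \<open>auto simp: Reps_def\<close>)
  qed
  ultimately have "finite ?R" by (rule finite_imageD)
  then have "finite (char_class G ` ?R)" by (rule finite_imageI)
  then show ?thesis unfolding out_orbit_char_class[OF G \<rho>] by (simp add: image_image)
qed

text \<open>The matrix entries of \<rho> composed with any automorphism are entries of matrices in
  the image of \<rho>, so they have a bound uniform in the automorphism; sums and products inherit
  it.\<close>

lemma regular_fun_bounded:
  assumes G: "group G" and \<rho>: "\<rho> \<in> Reps G" and b: "bounded (\<rho> ` carrier G)" and f: "f \<in> regular_funs G"
  shows "\<exists>C. \<forall>\<alpha>\<in>auto G. norm (f (compose (carrier G) \<rho> \<alpha>)) \<le> C"
  using f
proof (induction rule: regular_funs.induct)
  case (const c)
  then show ?case by (intro exI[of _ "norm c"]) (simp add: compose_Reps[OF G \<rho>])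
next
  case (entry g i j)
  obtain C where C: "\<And>x i j. x \<in> carrier G \<Longrightarrow> norm ((\<rho> x)$i$j) \<le> C"
    using b unfolding bounded_mat2_iff by blast
  show ?case using entry C[OF auto_closed[OF _ entry]]
    by (intro exI[of _ C]) (simp add: compose_Reps[OF G \<rho>] compose_eq)
next
  case (add f h)
  then obtain C D where "\<forall>\<alpha>\<in>auto G. norm (f (compose (carrier G) \<rho> \<alpha>)) \<le> C"
    "\<forall>\<alpha>\<in>auto G. norm (h (compose (carrier G) \<rho> \<alpha>)) \<le> D" by blast
  then show ?case
    by (intro exI[of _ "C + D"]) (auto simp: compose_Reps[OF G \<rho>] intro!: norm_triangle_le add_mono)
next
  case (mult f h)
  then obtain C D where "\<forall>\<alpha>\<in>auto G. norm (f (compose (carrier G) \<rho> \<alpha>)) \<le> C"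
    "\<forall>\<alpha>\<in>auto G. norm (h (compose (carrier G) \<rho> \<alpha>)) \<le> D" by blast
  then show ?case
    by (intro exI[of _ "C * D"])
       (auto simp: compose_Reps[OF G \<rho>] norm_mult intro!: mult_mono order_trans[OF norm_ge_zero])
qed

lemma continuous_map_complex_mult:
  fixes f g :: "'a \<Rightarrow> complex"
  shows "continuous_map X euclidean f \<Longrightarrow> continuous_map X euclidean g \<Longrightarrow>
    continuous_map X euclidean (\<lambda>x. f x * g x)"
  by (simp add: continuous_map_atin tendsto_mult)

lemma closedin_char_variety:
  assumes G: "group G"
  shows "closedin (product_topology (\<lambda>_. euclidean) (invariant_funs G)) (char_variety G)"
proof -
  let ?I = "invariant_funs G"
  let ?P = "product_topology (\<lambda>_. euclidean) ?I :: 'a char_point topology"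
  have proj: "continuous_map ?P euclidean (\<lambda>\<phi>. \<phi> f)" if "f \<in> ?I" for f
    using that by (rule continuous_map_product_projection)
  have closed: "closedin ?P {\<phi> \<in> topspace ?P. F \<phi> = 0}" if "continuous_map ?P euclidean F" for F :: "_ \<Rightarrow> complex"
    using closedin_continuous_map_preimage[OF that, of "{0}"] by simp
  define K1 where "K1 c = {\<phi> \<in> topspace ?P. \<phi> (\<lambda>\<rho>\<in>Reps G. c) - c = 0}" for c
  define K2 where "K2 = (\<lambda>(f, h). {\<phi> \<in> topspace ?P. \<phi> (\<lambda>\<rho>\<in>Reps G. f \<rho> + h \<rho>) - (\<phi> f + \<phi> h) = 0})"
  define K3 where "K3 = (\<lambda>(f, h). {\<phi> \<in> topspace ?P. \<phi> (\<lambda>\<rho>\<in>Reps G. f \<rho> * h \<rho>) - \<phi> f * \<phi> h = 0})"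
  have "closedin ?P (K1 c)" for c unfolding K1_def
    by (intro closed continuous_map_diff proj const_invariant[OF G] continuous_map_const[THEN iffD2]) auto
  moreover have "closedin ?P (K2 (f, h))" if "f \<in> ?I" "h \<in> ?I" for f h
    unfolding K2_def prod.case
    by (intro closed continuous_map_diff continuous_map_add proj add_invariant[OF G] that)
  moreover have "closedin ?P (K3 (f, h))" if "f \<in> ?I" "h \<in> ?I" for f h
    unfolding K3_def prod.case
    by (intro closed continuous_map_diff continuous_map_complex_mult proj mult_invariant[OF G] that)
  ultimately have "closedin ?P (\<Inter> (range K1 \<union> K2 ` (?I \<times> ?I) \<union> K3 ` (?I \<times> ?I)))"
    by (intro closedin_Inter) auto
  moreover have "\<Inter> (range K1 \<union> K2 ` (?I \<times> ?I) \<union> K3 ` (?I \<times> ?I)) = char_variety G"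
    unfolding K1_def K2_def K3_def char_variety_def by (auto simp: PiE_def)
  ultimately show ?thesis by simp
qed

text \<open>By Tychonoff a product of closed discs, one per invariant function, is compact. Its
  intersection with the closed set \<open>char_variety G\<close> is a compact set containing the
  orbit.\<close>

lemma bounded_orbit_of_bounded_image:
  assumes G: "group G" and \<rho>: "\<rho> \<in> Reps G" and b: "bounded (\<rho> ` carrier G)"
  shows "bounded_in (char_topology G) (out_orbit G (char_class G \<rho>))"
proof -
  let ?I = "invariant_funs G" and ?O = "out_orbit G (char_class G \<rho>)"
  let ?P = "product_topology (\<lambda>_. euclidean) ?I :: 'a char_point topology"
  have "\<forall>f\<in>?I. \<exists>C. \<forall>\<alpha>\<in>auto G. norm (f (compose (carrier G) \<rho> \<alpha>)) \<le> C"
    using regular_fun_bounded[OF G \<rho> b] by (auto simp: invariant_funs_def)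
  then obtain C where C: "\<And>f \<alpha>. f \<in> ?I \<Longrightarrow> \<alpha> \<in> auto G \<Longrightarrow> norm (f (compose (carrier G) \<rho> \<alpha>)) \<le> C f"
    by metis
  define K where "K = char_variety G \<inter> (\<Pi>\<^sub>E f\<in>?I. cball 0 (C f))"
  have sub: "?O \<subseteq> char_variety G"
    unfolding out_orbit_char_class[OF G \<rho>] using char_class_in_char_variety[OF G compose_Reps[OF G \<rho>]] by blast
  have "?O \<subseteq> (\<Pi>\<^sub>E f\<in>?I. cball 0 (C f))"
    unfolding out_orbit_char_class[OF G \<rho>] using C by (auto simp: char_class_def)
  then have OK: "?O \<subseteq> K" using sub by (simp add: K_def)
  have "compactin ?P (\<Pi>\<^sub>E f\<in>?I. cball 0 (C f))" by (simp add: compactin_PiE)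
  then have "compactin ?P K" unfolding K_def using closedin_char_variety[OF G]
    by (rule closed_Int_compactin[rotated])
  then have cK: "compactin (char_topology G) K"
    unfolding char_topology_def by (simp add: compactin_subtopology K_def)
  have "closedin ?P (\<Pi>\<^sub>E f\<in>?I. cball 0 (C f))" by (simp add: closedin_product_topology)
  then have "closedin (char_topology G) K" unfolding char_topology_def K_def
    by (simp add: closedin_subtopology_Int_closed)
  then have "(char_topology G) closure_of ?O \<subseteq> K" by (rule closure_of_minimal[OF OK])
  then have "compactin (char_topology G) ((char_topology G) closure_of ?O)"
    by (rule closed_compactin[OF cK _ closedin_closure_of])
  then show ?thesis using sub by (simp add: bounded_in_def topspace_char_topology)
qed


section \<open>Finite and bounded orbits\<close>

definition diagonal_SL2 :: "mat2 set" where
  "diagonal_SL2 = {X. det X = 1 \<and> X$1$2 = 0 \<and> X$2$1 = 0}"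

lemma diagonal_SL2_mult_inv:
  assumes "X \<in> diagonal_SL2" "Y \<in> diagonal_SL2"
  shows "X ** Y \<in> diagonal_SL2" "inv\<^bsub>SL2\<^esub> X \<in> diagonal_SL2" "X ** Y = Y ** X"
proof -
  have X: "det X = 1" using assms(1) by (simp add: diagonal_SL2_def)
  show "X ** Y \<in> diagonal_SL2" using assms by (auto simp: diagonal_SL2_def det_mul) (simp_all add: mat2_mult_nth)
  show "inv\<^bsub>SL2\<^esub> X \<in> diagonal_SL2"
    using assms unfolding SL2_inv[OF X] by (auto simp: diagonal_SL2_def det_2 mult.commute)
  show "X ** Y = Y ** X" using assms by (simp add: diagonal_SL2_def mat2_eq_iff mat2_mult_nth)
qed

lemma generate_diagonal_SL2:
  assumes "S \<subseteq> diagonal_SL2"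
  shows "generate SL2 S \<subseteq> diagonal_SL2"
proof
  fix X assume "X \<in> generate SL2 S"
  then show "X \<in> diagonal_SL2"
  proof (induction rule: generate.induct)
    case one
    then show ?case by (simp add: diagonal_SL2_def det_2)
  next
    case (inv h)
    then show ?case using assms diagonal_SL2_mult_inv(2) by blast
  next
    case (eng h1 h2)
    then show ?case using diagonal_SL2_mult_inv(1) by simp
  qed (use assms in blast)
qed

text \<open>The two diagonal entries have product 1, so one has modulus at most 1, and the other
  exceeds it by at most the modulus of the trace.\<close>

lemma bounded_diagonal_SL2:
  assumes S: "S \<subseteq> diagonal_SL2" and b: "bounded (trace ` S)"
  shows "bounded S"
proof -
  obtain C where C: "\<And>X. X \<in> S \<Longrightarrow> norm (trace X) \<le> C" using b by (auto simp: bounded_iff)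
  have "norm (X$i$j) \<le> 1 + \<bar>C\<bar>" if X: "X \<in> S" for X i j
  proof -
    have d: "X$1$1 * X$2$2 = 1" "X$1$2 = 0" "X$2$1 = 0"
      using X S by (auto simp: diagonal_SL2_def det_2)
    have n: "norm (X$1$1) * norm (X$2$2) = 1" using d(1) by (metis norm_mult norm_one)
    have "norm (X$1$1) \<le> norm (trace X) + norm (X$2$2)" "norm (X$2$2) \<le> norm (trace X) + norm (X$1$1)"
      using norm_triangle_ineq4[of "trace X" "X$2$2"] norm_triangle_ineq4[of "trace X" "X$1$1"]
      by (simp_all add: trace_mat2)
    moreover have "norm (X$1$1) \<le> 1 \<or> norm (X$2$2) \<le> 1"
    proof (rule ccontr)
      assume "\<not> ?thesis"
      then have "1 * 1 < norm (X$1$1) * norm (X$2$2)" by (intro mult_strict_mono) auto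
      then show False using n by simp
    qed
    ultimately have "norm (X$1$1) \<le> 1 + \<bar>C\<bar>" "norm (X$2$2) \<le> 1 + \<bar>C\<bar>" using C[OF X] by linarith+
    then show ?thesis using d(2,3) exhaust_2[of i] exhaust_2[of j] by auto
  qed
  then show ?thesis unfolding bounded_mat2_iff by blast
qed

lemma finite_diagonal_SL2:
  assumes S: "S \<subseteq> diagonal_SL2" and f: "finite (trace ` S)"
  shows "finite S"
proof (rule finite_subset)
  show "S \<subseteq> (\<Union>t\<in>trace ` S. {X \<in> diagonal_SL2. trace X = t})" using S by blast
  have "finite {X \<in> diagonal_SL2. trace X = t}" for t
  proof -
    obtain z where z: "z \<noteq> 0" "t = z + 1 / z" using ex_trace_root by blast
    have "{X \<in> diagonal_SL2. trace X = t} \<subseteq> {mat22 z 0 0 (1 / z), mat22 (1 / z) 0 0 z}"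
    proof
      fix X assume "X \<in> {X \<in> diagonal_SL2. trace X = t}"
      then have d: "X$1$1 * X$2$2 = 1" "X$1$2 = 0" "X$2$1 = 0" "X$1$1 + X$2$2 = z + 1 / z"
        using z by (auto simp: diagonal_SL2_def det_2 trace_mat2)
      then have x2: "X$2$2 = z + 1 / z - X$1$1" by (simp add: algebra_simps)
      then have "(X$1$1 - z) * (X$1$1 - 1 / z) = 0"
        using d(1)[unfolded x2] z(1) by (simp add: field_simps)
      then have "X$1$1 = z \<or> X$1$1 = 1 / z" by auto
      then show "X \<in> {mat22 z 0 0 (1 / z), mat22 (1 / z) 0 0 z}"
        using d(2,3) x2 by (auto simp: mat2_eq_iff)
    qed
    then show ?thesis using finite_subset by blast
  qed
  then show "finite (\<Union>t\<in>trace ` S. {X \<in> diagonal_SL2. trace X = t})" using f by blast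
qed

lemma diagonal_translates:
  assumes A: "\<forall>b\<in>B. A b \<in> diagonal_SL2" and k: "k \<in> B"
  shows "sub_gen A B k \<subseteq> diagonal_SL2" "(\<lambda>h. A k ** h) ` sub_gen A B k \<subseteq> diagonal_SL2"
    "trace ` (\<lambda>h. A k ** h) ` sub_gen A B k = tr_set A B k"
proof -
  show s: "sub_gen A B k \<subseteq> diagonal_SL2" by (rule generate_diagonal_SL2) (use A in auto)
  then show "(\<lambda>h. A k ** h) ` sub_gen A B k \<subseteq> diagonal_SL2"
    using A k diagonal_SL2_mult_inv(1) by blast
  show "trace ` (\<lambda>h. A k ** h) ` sub_gen A B k = tr_set A B k" by (auto simp: tr_set_def)
qed

text \<open>Each generator lies in some bounded group \<open>sub_gen A B k\<close>, so its diagonal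
  entries, being eigenvalues, are unimodular.\<close>

lemma bounded_diagonal_core:
  assumes fresh: "\<And>x. \<exists>k\<in>B. k \<noteq> x" and A: "\<forall>b\<in>B. A b \<in> diagonal_SL2"
    and b: "\<And>k. k \<in> B \<Longrightarrow> bounded (tr_set A B k)"
  shows "bounded (generate SL2 (A ` B))"
proof -
  have "A x \<in> twisted_SU2 1" if x: "x \<in> B" for x
  proof -
    obtain k where k: "k \<in> B" "k \<noteq> x" using fresh by blast
    note t = diagonal_translates[OF A k(1)]
    have kd: "det (A k) = 1" using A k by (auto simp: diagonal_SL2_def)
    have "bounded (sub_gen A B k)"
      by (rule bounded_SL2_inv_mult[OF kd bounded_diagonal_SL2[OF t(2)]]) (simp only: t(3) b k(1))
    moreover have S: "\<forall>X\<in>A ` (B - {k}). det X = 1" using A by (auto simp: diagonal_SL2_def)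
    moreover have "A x \<in> sub_gen A B k" by (rule generate_SL2(2)[OF S]) (use x k in auto)
    moreover have d: "A x $ 1 $ 1 * A x $ 2 $ 2 = 1" "A x $ 1 $ 2 = 0" "A x $ 2 $ 1 = 0" "det (A x) = 1"
      using bspec[OF A x] by (auto simp: diagonal_SL2_def det_2)
    then have nz: "A x $ 1 $ 1 \<noteq> 0" by auto
    then have i: "A x $ 2 $ 2 = 1 / A x $ 1 $ 1" using d(1) by (simp add: field_simps)
    ultimately have n: "norm (A x $ 1 $ 1) = 1"
      using unimodular_eigenvalue[of "A ` (B - {k})" "A x" "A x $ 1 $ 1"] nz by (simp add: trace_mat2 i)
    have "1 / A x $ 1 $ 1 = cnj (A x $ 1 $ 1)"
      using n complex_norm_square[of "A x $ 1 $ 1"] nz by (simp add: field_simps)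
    then show ?thesis using d i by (simp add: twisted_SU2_def)
  qed
  then have "A ` B \<subseteq> twisted_SU2 1" by (rule image_subsetI)
  then show ?thesis
    by (intro bounded_subset[OF bounded_twisted_SU2[of 1]] generate_twisted_SU2) simp_all
qed

text \<open>Omitting \<open>b\<close> and omitting \<open>c\<close> gives two finite groups that
  together contain all generators. Diagonal matrices commute, so the set of products of the two is
  closed under multiplication.\<close>

lemma finite_diagonal_core:
  assumes bc: "b \<in> B" "c \<in> B" "b \<noteq> c" and A: "\<forall>b\<in>B. A b \<in> diagonal_SL2"
    and fin: "\<And>k. k \<in> B \<Longrightarrow> finite (tr_set A B k)"
  shows "finite (generate SL2 (A ` B))"
proof -
  have fk: "finite (sub_gen A B k)" if k: "k \<in> B" for k
  proof (rule finite_imageD)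
    note t = diagonal_translates[OF A k]
    have kd: "det (A k) = 1" using A k by (auto simp: diagonal_SL2_def)
    show "finite ((\<lambda>h. A k ** h) ` sub_gen A B k)"
      by (rule finite_diagonal_SL2[OF t(2)]) (simp only: t(3) fin k)
    show "inj_on (\<lambda>h. A k ** h) (sub_gen A B k)"
      by (rule inj_onI) (metis SL2_cancel(3)[OF kd])
  qed
  let ?H = "sub_gen A B b" and ?K = "sub_gen A B c"
  let ?P = "(\<lambda>(h, k). h ** k) ` (?H \<times> ?K)"
  have S: "\<forall>X\<in>A ` (B - {k}). det X = 1" for k using A by (auto simp: diagonal_SL2_def)
  note gH = generate_SL2[OF S[of b]] and gK = generate_SL2[OF S[of c]]
  have PI: "h ** k \<in> ?P" if "h \<in> ?H" "k \<in> ?K" for h k using that by force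
  have letter: "A x \<in> ?H \<or> A x \<in> ?K" if "x \<in> B" for x
    using that bc gH(2)[of "A x"] gK(2)[of "A x"] by auto
  have HP: "h \<in> ?P" if "h \<in> ?H" for h using PI[OF that gK(1)] by simp
  have KP: "h \<in> ?P" if "h \<in> ?K" for h using PI[OF gH(1) that] by simp
  have "generate SL2 (A ` B) \<subseteq> ?P"
  proof
    fix X assume "X \<in> generate SL2 (A ` B)"
    then show "X \<in> ?P"
    proof (induction rule: generate.induct)
      case one
      then show ?case using HP[OF gH(1)] by simp
    next
      case (incl X)
      then show ?case using letter HP KP by blast
    next
      case (inv X)
      then show ?case using letter HP KP gH(4) gK(4) by blast
    next
      case (eng X Y)
      then obtain h k h' k' where e: "h \<in> ?H" "k \<in> ?K" "h' \<in> ?H" "k' \<in> ?K" "X = h ** k" "Y = h' ** k'"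
        by auto
      have "k \<in> diagonal_SL2" "h' \<in> diagonal_SL2"
        using e diagonal_translates(1)[OF A] bc by blast+
      then have c: "k ** h' = h' ** k" by (rule diagonal_SL2_mult_inv(3))
      have "X ** Y = h ** (k ** h') ** k'" using e by (simp add: matrix_mul_assoc)
      also have "\<dots> = (h ** h') ** (k ** k')" unfolding c by (simp add: matrix_mul_assoc)
      finally show ?case using PI[OF gH(3)[OF e(1,3)] gK(3)[OF e(2,4)]] by simp
    qed
  qed
  moreover have "finite ?P" using fk bc by (intro finite_imageI finite_cartesian_product) auto
  ultimately show ?thesis by (rule finite_subset)
qed

lemma tr_set_cong:
  assumes "\<And>b. b \<in> B \<Longrightarrow> A b = A' b" "k \<in> B"
  shows "tr_set A B k = tr_set A' B k"
proof -
  have "A ` (B - {k}) = A' ` (B - {k})" by (rule image_cong) (use assms in auto)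
  then show ?thesis using assms by (simp add: tr_set_def)
qed

lemma conj_compose_orbit_traces:
  assumes "group G" "\<tau> \<in> auto G" "det P = 1" "g \<in> carrier G"
  shows "orbit_traces G (conj_rep G P (compose (carrier G) \<rho> \<tau>)) g \<subseteq> orbit_traces G \<rho> g"
  unfolding orbit_traces_conj_rep[OF assms(3,4)] by (rule orbit_traces_compose[OF assms(1,2,4)])

section \<open>From the orbit to the image\<close>

lemma bounded_image_of_orbit:
  assumes G: "group G" and B: "free_basis G B" and fresh: "\<And>x y z. \<exists>k\<in>B. k \<notin> {x, y, z}"
    and \<rho>: "\<rho> \<in> Reps G" and ss: "semisimple_rep G \<rho>"
    and bd: "\<And>g. g \<in> carrier G \<Longrightarrow> bounded (orbit_traces G \<rho> g)"
  shows "bounded (\<rho> ` carrier G)"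
proof -
  have Bc: "B \<subseteq> carrier G" and gen: "generate G B = carrier G" using B by (auto simp: free_basis_def)
  have img: "\<sigma> ` carrier G = generate SL2 (\<sigma> ` B)" if "\<sigma> \<in> Reps G" for \<sigma>
    using image_generate_Reps[OF G that Bc] gen by simp
  show ?thesis
  proof (cases "irreducible_rep G \<rho>")
    case True
    have "bounded (tr_set \<rho> B b)" if "b \<in> B" for b
      using bounded_subset[OF bd tr_set_subset_orbit_traces[OF G B \<rho> that]] that Bc by blast
    then obtain \<tau> P b1 b2 where n: "\<tau> \<in> auto G" "det P = 1" "b1 \<in> B" "b2 \<in> B"
      "normal_pair (conj_rep G P (compose (carrier G) \<rho> \<tau>) b1) (conj_rep G P (compose (carrier G) \<rho> \<tau>) b2)"
      using normal_form[OF G B \<rho> True] by metis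
    define \<sigma> where "\<sigma> = conj_rep G P (compose (carrier G) \<rho> \<tau>)"
    have \<sigma>: "\<sigma> \<in> Reps G" unfolding \<sigma>_def
      by (intro conj_rep_Reps compose_Reps G \<rho> n) (simp add: n)
    have det: "\<forall>b\<in>B. det (\<sigma> b) = 1" using Reps_SL2(2)[OF G \<sigma>] Bc by blast
    have "bounded (tr_set \<sigma> B b)" if "b \<in> B" for b
    proof -
      have b: "b \<in> carrier G" using that Bc by blast
      have "tr_set \<sigma> B b \<subseteq> orbit_traces G \<rho> b"
        using tr_set_subset_orbit_traces[OF G B \<sigma> that] conj_compose_orbit_traces[OF G n(1,2) b, of \<rho>]
        unfolding \<sigma>_def by blast
      then show ?thesis using bd[OF b] bounded_subset by blast
    qed
    then have "bounded (generate SL2 (\<sigma> ` B))"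
      by (intro bounded_core[OF fresh det n(3,4)]) (use n(5) in \<open>auto simp: \<sigma>_def\<close>)
    then have "bounded (\<sigma> ` carrier G)" using img[OF \<sigma>] by simp
    \<comment> \<open>Composition with an automorphism leaves the image unchanged, and conjugation
      by a fixed matrix changes only the bound.\<close>
    then show ?thesis unfolding \<sigma>_def using bounded_conj_rep[OF n(2)] image_compose_auto[OF n(1), of \<rho>] by metis
  next
    case False
    then obtain P where P: "P \<in> carrier SL2" "diagonal_rep G (conj_rep G P \<rho>)"
      using ss unfolding semisimple_rep_def by blast
    define \<sigma> where "\<sigma> = conj_rep G P \<rho>"
    have \<sigma>: "\<sigma> \<in> Reps G" unfolding \<sigma>_def by (rule conj_rep_Reps[OF G P(1) \<rho>])
    have diag: "\<forall>b\<in>B. \<sigma> b \<in> diagonal_SL2"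
      using Reps_SL2(2)[OF G \<sigma>] P(2) Bc by (auto simp: diagonal_SL2_def diagonal_rep_def \<sigma>_def)
    have "bounded (generate SL2 (\<sigma> ` B))"
    proof (rule bounded_diagonal_core[OF _ diag])
      show "\<exists>k\<in>B. k \<noteq> x" for x using fresh[of x x x] by auto
      fix k assume k: "k \<in> B"
      then have kc: "k \<in> carrier G" using Bc by blast
      then have "tr_set \<sigma> B k \<subseteq> orbit_traces G \<rho> k"
        using tr_set_subset_orbit_traces[OF G B \<sigma> k] orbit_traces_conj_rep[of P k G \<rho>] P(1)
        by (simp add: \<sigma>_def)
      then show "bounded (tr_set \<sigma> B k)" by (rule bounded_subset[OF bd[OF kc]])
    qed
    then show ?thesis using img[OF \<sigma>] bounded_conj_rep[of P G \<rho>] P(1) by (simp add: \<sigma>_def)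
  qed
qed

lemma finite_image_of_orbit:
  assumes G: "group G" and B: "free_basis G B" "finite B" and fresh: "\<And>x y z. \<exists>k\<in>B. k \<notin> {x, y, z}"
    and \<rho>: "\<rho> \<in> Reps G" and ss: "semisimple_rep G \<rho>"
    and fin: "\<And>g. g \<in> carrier G \<Longrightarrow> finite (orbit_traces G \<rho> g)"
  shows "finite (\<rho> ` carrier G)"
proof -
  have Bc: "B \<subseteq> carrier G" and gen: "generate G B = carrier G" using B by (auto simp: free_basis_def)
  have img: "\<sigma> ` carrier G = generate SL2 (\<sigma> ` B)" if "\<sigma> \<in> Reps G" for \<sigma>
    using image_generate_Reps[OF G that Bc] gen by simp
  show ?thesis
  proof (cases "irreducible_rep G \<rho>")
    case True
    have "bounded (tr_set \<rho> B b)" if "b \<in> B" for b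
      using finite_subset[OF tr_set_subset_orbit_traces[OF G B(1) \<rho> that] fin] that Bc
      by (intro finite_imp_bounded) blast
    then obtain \<tau> P b1 b2 where n: "\<tau> \<in> auto G" "det P = 1" "b1 \<in> B" "b2 \<in> B"
      "normal_pair (conj_rep G P (compose (carrier G) \<rho> \<tau>) b1) (conj_rep G P (compose (carrier G) \<rho> \<tau>) b2)"
      "conj_rep G P (compose (carrier G) \<rho> \<tau>) b2 $ 1 $ 2 = 1"
      using normal_form[OF G B(1) \<rho> True] by metis
    define \<sigma> where "\<sigma> = conj_rep G P (compose (carrier G) \<rho> \<tau>)"
    have \<sigma>: "\<sigma> \<in> Reps G" unfolding \<sigma>_def
      by (intro conj_rep_Reps compose_Reps G \<rho> n) (simp add: n)
    have det: "\<forall>b\<in>B. det (\<sigma> b) = 1" using Reps_SL2(2)[OF G \<sigma>] Bc by blast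
    have fin\<sigma>: "finite (orbit_traces G \<sigma> b)" if "b \<in> carrier G" for b
      using finite_subset[OF conj_compose_orbit_traces[OF G n(1,2) that] fin[OF that]] by (simp add: \<sigma>_def)
    have f: "finite (tr_set \<sigma> B b)" if "b \<in> B" for b
      using finite_subset[OF tr_set_subset_orbit_traces[OF G B(1) \<sigma> that] fin\<sigma>] that Bc by blast
    \<comment> \<open>On the basis, the modified family agrees with \<sigma> composed with a
      transvection, so its trace sets are still contained in those of the orbit of \<sigma>.\<close>
    have f2: "finite (tr_set (\<sigma>(k := \<sigma> k ** \<sigma> x)) B j)" if k: "k \<in> B" "x \<in> B - {k}" "j \<in> B" for k x j
    proof -
      have "x \<in> generate G (B - {k})" by (rule generate.incl) (use k in auto)
      then obtain \<alpha> where \<alpha>: "\<alpha> \<in> auto G" "\<alpha> k = k \<otimes>\<^bsub>G\<^esub> x" "\<forall>c\<in>B - {k}. \<alpha> c = c"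
        using transvection_auto[OF G B(1) k(1)] by blast
      let ?\<sigma> = "compose (carrier G) \<sigma> \<alpha>"
      have "(\<sigma>(k := \<sigma> k ** \<sigma> x)) b = ?\<sigma> b" if "b \<in> B" for b
        using that k \<alpha> Bc Reps_SL2(3)[OF G \<sigma>, of k x] by (auto simp: compose_def)
      then have "tr_set (\<sigma>(k := \<sigma> k ** \<sigma> x)) B j = tr_set ?\<sigma> B j" using k(3) by (rule tr_set_cong)
      also have "\<dots> \<subseteq> orbit_traces G ?\<sigma> j"
        by (rule tr_set_subset_orbit_traces[OF G B(1) compose_Reps[OF G \<sigma> \<alpha>(1)] k(3)])
      also have "\<dots> \<subseteq> orbit_traces G \<sigma> j"
        using orbit_traces_compose[OF G \<alpha>(1)] k(3) Bc by blast
      finally show ?thesis using fin\<sigma> k(3) Bc finite_subset by blast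
    qed
    have "finite (generate SL2 (\<sigma> ` B))"
      by (rule finite_core[OF B(2) fresh det n(3,4)]) (use n(5,6) f f2 in \<open>auto simp: \<sigma>_def\<close>)
    then have "finite (\<sigma> ` carrier G)" using img[OF \<sigma>] by simp
    then show ?thesis unfolding \<sigma>_def using finite_conj_rep[OF n(2)] image_compose_auto[OF n(1), of \<rho>] by metis
  next
    case False
    then obtain P where P: "P \<in> carrier SL2" "diagonal_rep G (conj_rep G P \<rho>)"
      using ss unfolding semisimple_rep_def by blast
    define \<sigma> where "\<sigma> = conj_rep G P \<rho>"
    have \<sigma>: "\<sigma> \<in> Reps G" unfolding \<sigma>_def by (rule conj_rep_Reps[OF G P(1) \<rho>])
    have diag: "\<forall>b\<in>B. \<sigma> b \<in> diagonal_SL2"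
      using Reps_SL2(2)[OF G \<sigma>] P(2) Bc by (auto simp: diagonal_SL2_def diagonal_rep_def \<sigma>_def)
    obtain b where b: "b \<in> B" using fresh by blast
    obtain c where c: "c \<in> B" "c \<noteq> b" using fresh[of b b b] by auto
    have "finite (generate SL2 (\<sigma> ` B))"
    proof (rule finite_diagonal_core[OF b c(1) c(2)[symmetric] diag])
      fix k assume k: "k \<in> B"
      then have kc: "k \<in> carrier G" using Bc by blast
      then have "tr_set \<sigma> B k \<subseteq> orbit_traces G \<rho> k"
        using tr_set_subset_orbit_traces[OF G B(1) \<sigma> k] orbit_traces_conj_rep[of P k G \<rho>] P(1)
        by (simp add: \<sigma>_def)
      then show "finite (tr_set \<sigma> B k)" by (rule finite_subset[OF _ fin[OF kc]])
    qed
    then show ?thesis using img[OF \<sigma>] finite_conj_rep[of P G \<rho>] P(1) by (simp add: \<sigma>_def)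
  qed
qed

theorem mainTheorem4:
  fixes G :: "('g, 'b) monoid_scheme" and m :: nat and \<rho> :: "'g \<Rightarrow> complex^2^2"
  assumes "free_group_of_rank G m" and "m \<ge> 4"
    and "\<rho> \<in> Reps G" and "semisimple_rep G \<rho>"
  shows "(finite (out_orbit G (char_class G \<rho>)) \<longleftrightarrow> finite (\<rho> ` carrier G)) \<and>
         (bounded_in (char_topology G) (out_orbit G (char_class G \<rho>)) \<longleftrightarrow>
          bounded_in SL2_topology (\<rho> ` carrier G))"
proof -
  obtain B where G: "group G" and B: "finite B" "card B = m" "free_basis G B"
    using assms(1) unfolding free_group_of_rank_def by blast
  note \<rho> = \<open>\<rho> \<in> Reps G\<close> and ss = \<open>semisimple_rep G \<rho>\<close>
  \<comment> \<open>The rank condition enters in this form: any three generators leave a fourth one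
    to be omitted.\<close>
  have fresh: "\<exists>k\<in>B. k \<notin> {x, y, z}" for x y z
  proof (rule ccontr)
    assume "\<not> ?thesis"
    then have "B \<subseteq> {x, y, z}" by blast
    then have "card B \<le> card {x, y, z}" by (rule card_mono[rotated]) simp
    also have "\<dots> \<le> 3" by (simp add: card_insert_if)
    finally show False using B(2) assms(2) by simp
  qed
  have img: "\<rho> ` carrier G \<subseteq> carrier SL2" using Reps_SL2(2)[OF G \<rho>] by auto
  have "finite (\<rho> ` carrier G)" if f: "finite (out_orbit G (char_class G \<rho>))"
    by (rule finite_image_of_orbit[OF G B(3,1) fresh \<rho> ss])
       (simp add: orbit_traces_char_class[OF G \<rho>] f)
  moreover have "bounded (\<rho> ` carrier G)"
    if "bounded_in (char_topology G) (out_orbit G (char_class G \<rho>))"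
    by (rule bounded_image_of_orbit[OF G B(3) fresh \<rho> ss bounded_orbit_traces[OF G \<rho> _ that]])
  ultimately show ?thesis
    using finite_orbit_of_finite_image[OF G B(3,1) \<rho>] bounded_orbit_of_bounded_image[OF G \<rho>]
    unfolding bounded_in_SL2_iff[OF img] by blast
qed

end
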